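(* Let $U=\{x_2>0\}\subset\mathbb{R}^2$ and let $(K,u)$ be an elementary generalized minimizer on $U$. Then one and only one of the following holds. (i) $K=\emptyset$ and $u=0$. (ii) $K=\partial U=\{x_2=0\}$ and $u$ is constant. (iii) $K=\{x_2=a\}$ for some $a\in(0,+\infty)$ and $u=u^+\chi_{\{x_2>a\}}$ for some constant $u^+\in\mathbb{R}$.
   Context: Let $U\subset\mathbb{R}^2$ be an open half-plane. $\mathcal{A}(U)$ is the set of pairs $(K,u)$ with $K\subset\overline U$ closed, $u\in W^{1,2}_{\mathrm{loc}}(U\setminus K)$ (locally up to $\partial U\setminus K$, so that traces make sense) and $u=0$ on $\partial U\setminus K$. For a set $A$, $E(K,u,A)=\int_{(A\cap U)\setminus K}|\nabla u|^2+\mathcal{H}^1(K\cap A)$. A pair $(J,w)\in\mathcal{A}(U)$ is an admissible competitor for $(K,u)\in\mathcal{A}(U)$ if there is a bounded open set $O\subset\mathbb{R}^2$ such that: (1) $(J,w)$ coincides with $(K,u)$ in $\overline U\setminus O$; (2) whenever two points of $\mathbb{R}^2\setminus(O\cup K)$ belong to distinct connected components of $\mathbb{R}^2\setminus K$, they belong to distinct connected components of $\mathbb{R}^2\setminus J$. (Components are those of the complement in the whole plane $\mathbb{R}^2$.) $(K,u)\in\mathcal{A}(U)$ is a generalized minimizer on $U$ if $E(K,u,O)\le E(J,w,O)$ for every admissible competitor $(J,w)$ and every associated set $O$. Minimizers are always assumed normalized: $\mathcal{H}^1(K\cap B_\rho(x))>0$ for all $x\in K$, $\rho>0$. A generalized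 minimizer $(K,u)$ is elementary if $\int_{U\setminus K}|\nabla u|^2=0$. $\chi_A$ denotes the characteristic function of $A$. *)

theory Defs
  imports "HOL-Analysis.Analysis"
begin

type_synonym plane = "real^2"

section \<open>One-dimensional Hausdorff (outer) measure\<close>

text \<open>Normalised so that segments are measured by their length. \<^const>\<open>diameter\<close> is only
  meaningful on bounded sets, hence the restriction on the covers.\<close>

definition hausdorff1 :: "'a::metric_space set \<Rightarrow> ennreal" where
  "hausdorff1 A =
    (SUP \<delta>\<in>{0::real<..}.
      INF C\<in>{C :: nat \<Rightarrow> 'a set. A \<subseteq> (\<Union>i. C i) \<and> (\<forall>i. bounded (C i) \<and> diameter (C i) \<le> \<delta>)}.
        (\<Sum>i. ennreal (diameter (C i))))"

section \<open>Sobolev functions on the complement of a closed set\<close>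

primrec Ck :: "nat \<Rightarrow> (plane \<Rightarrow> real) \<Rightarrow> bool" where
  "Ck 0 f \<longleftrightarrow> continuous_on UNIV f"
| "Ck (Suc k) f \<longleftrightarrow>
    (\<forall>x. f differentiable (at x)) \<and> (\<forall>v. Ck k (\<lambda>x. frechet_derivative f (at x) v))"

definition test_function :: "plane set \<Rightarrow> (plane \<Rightarrow> real) \<Rightarrow> bool" where
  "test_function \<Omega> \<phi> \<longleftrightarrow> (\<forall>k. Ck k \<phi>) \<and>
    compact (closure {x. \<phi> x \<noteq> 0}) \<and> closure {x. \<phi> x \<noteq> 0} \<subseteq> \<Omega>"

definition weak_gradient :: "plane set \<Rightarrow> (plane \<Rightarrow> real) \<Rightarrow> (plane \<Rightarrow> plane) \<Rightarrow> bool" where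
  "weak_gradient \<Omega> u g \<longleftrightarrow>
    (\<forall>C. compact C \<and> C \<subseteq> \<Omega> \<longrightarrow> set_integrable lebesgue C u \<and> set_integrable lebesgue C g) \<and>
    (\<forall>\<phi> i. test_function \<Omega> \<phi> \<longrightarrow>
      (LINT x:\<Omega>|lebesgue. u x * frechet_derivative \<phi> (at x) (axis i 1)) =
      - (LINT x:\<Omega>|lebesgue. (g x $ i) * \<phi> x))"

text \<open>The weak gradient is unique almost everywhere, so the choice does not affect integrals.\<close>

definition wgrad :: "plane set \<Rightarrow> (plane \<Rightarrow> real) \<Rightarrow> plane \<Rightarrow> plane" where
  "wgrad \<Omega> u = (SOME g. weak_gradient \<Omega> u g)"

text \<open>Functions in \<open>W\<^sup>1\<^sup>,\<^sup>2\<close> locally in \<open>U \<setminus> K\<close> up to \<open>\<partial>U \<setminus> K\<close>: the compact sets \<open>C\<close> may touch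
  \<open>\<partial>U \<setminus> K\<close>. The values of \<open>u\<close> outside \<open>U \<setminus> K\<close> are irrelevant.\<close>

definition W12_loc :: "plane set \<Rightarrow> plane set \<Rightarrow> (plane \<Rightarrow> real) \<Rightarrow> bool" where
  "W12_loc U K u \<longleftrightarrow>
    (\<exists>g. weak_gradient (U - K) u g \<and>
      (\<forall>C. compact C \<and> C \<subseteq> closure U - K \<longrightarrow>
        set_integrable lebesgue (C \<inter> U) (\<lambda>x. (u x)\<^sup>2) \<and>
        set_integrable lebesgue (C \<inter> U) (\<lambda>x. (norm (g x))\<^sup>2)))"

text \<open>\<open>t\<close> is the (one-sided) trace of \<open>u\<close> at the boundary point \<open>x\<close> of \<open>\<Omega>\<close>: the mean of
  \<open>\<bar>u - t\<bar>\<close> over \<open>B\<^sub>r(x) \<inter> \<Omega>\<close> vanishes as \<open>r\<close> tends to \<open>0\<close>. For a Sobolev (or BV) function this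
  determines the trace \<open>\<H>\<^sup>1\<close>-almost everywhere on a Lipschitz part of the boundary.\<close>

definition has_trace_at :: "plane set \<Rightarrow> (plane \<Rightarrow> real) \<Rightarrow> plane \<Rightarrow> real \<Rightarrow> bool" where
  "has_trace_at \<Omega> u x t \<longleftrightarrow>
    ((\<lambda>r. (\<integral>\<^sup>+y\<in>ball x r \<inter> \<Omega>. ennreal \<bar>u y - t\<bar> \<partial>lebesgue) / emeasure lebesgue (ball x r \<inter> \<Omega>))
      \<longlongrightarrow> 0) (at_right 0)"

definition zero_trace :: "plane set \<Rightarrow> plane set \<Rightarrow> (plane \<Rightarrow> real) \<Rightarrow> bool" where
  "zero_trace U K u \<longleftrightarrow>
    (\<exists>N. hausdorff1 N = 0 \<and> (\<forall>x\<in>frontier U - K - N. has_trace_at (U - K) u x 0))"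

section \<open>Pairs, energy and generalized minimizers\<close>

text \<open>In what follows \<open>U\<close> is meant to be an open half-plane.\<close>

definition adm_pair :: "plane set \<Rightarrow> plane set \<Rightarrow> (plane \<Rightarrow> real) \<Rightarrow> bool" where
  "adm_pair U K u \<longleftrightarrow> closed K \<and> K \<subseteq> closure U \<and> W12_loc U K u \<and> zero_trace U K u"

definition dirichlet :: "plane set \<Rightarrow> plane set \<Rightarrow> (plane \<Rightarrow> real) \<Rightarrow> plane set \<Rightarrow> ennreal" where
  "dirichlet U K u A = (\<integral>\<^sup>+x\<in>(A \<inter> U) - K. ennreal ((norm (wgrad (U - K) u x))\<^sup>2) \<partial>lebesgue)"

definition energy :: "plane set \<Rightarrow> plane set \<Rightarrow> (plane \<Rightarrow> real) \<Rightarrow> plane set \<Rightarrow> ennreal" where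
  "energy U K u A = dirichlet U K u A + hausdorff1 (K \<inter> A)"

text \<open>Competitors \<open>(J, w)\<close> for \<open>(K, u)\<close> with associated set \<open>V\<close>. Components are taken in the whole
  plane, not in \<open>U\<close>.\<close>

definition competitor ::
  "plane set \<Rightarrow> plane set \<Rightarrow> (plane \<Rightarrow> real) \<Rightarrow> plane set \<Rightarrow> (plane \<Rightarrow> real) \<Rightarrow> plane set \<Rightarrow> bool" where
  "competitor U K u J w V \<longleftrightarrow>
    adm_pair U J w \<and> open V \<and> bounded V \<and>
    J \<inter> (closure U - V) = K \<inter> (closure U - V) \<and>
    (AE x in lebesgue. x \<in> U - V - K \<longrightarrow> w x = u x) \<and>
    (\<forall>x y. x \<notin> V \<union> K \<and> y \<notin> V \<union> K \<and>
        connected_component_set (- K) x \<noteq> connected_component_set (- K) y \<longrightarrow>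
        connected_component_set (- J) x \<noteq> connected_component_set (- J) y)"

definition normalized :: "plane set \<Rightarrow> bool" where
  "normalized K \<longleftrightarrow> (\<forall>x\<in>K. \<forall>\<rho>>0. hausdorff1 (K \<inter> ball x \<rho>) > 0)"

definition generalized_minimizer :: "plane set \<Rightarrow> plane set \<Rightarrow> (plane \<Rightarrow> real) \<Rightarrow> bool" where
  "generalized_minimizer U K u \<longleftrightarrow>
    adm_pair U K u \<and> normalized K \<and>
    (\<forall>J w V. competitor U K u J w V \<longrightarrow> energy U K u V \<le> energy U J w V)"

definition elementary :: "plane set \<Rightarrow> plane set \<Rightarrow> (plane \<Rightarrow> real) \<Rightarrow> bool" where
  "elementary U K u \<longleftrightarrow> dirichlet U K u UNIV = 0"

end

theory Submission
  imports Defs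
begin

text \<open>Since \<open>\<nabla>u = 0\<close>, \<open>u\<close> is constant on the components of \<open>U - K\<close>, and it vanishes on those which touch
  the boundary. Extended by \<open>0\<close> to the lower half-plane it is thus locally constant off \<open>K\<close>, and
  \<open>K\<close> minimizes length among the closed subsets of the closed half-plane which separate the components
  of its complement.

  Let \<open>m\<^sub>x(r)\<close> be the length of \<open>K\<close> in the disc \<open>B\<^sub>r(x)\<close>. If the circle carries finitely many points of
  \<open>K\<close>, the cone over these points with apex in one of them is a competitor, so no points or one point
  force \<open>m\<^sub>x(r) = 0\<close>, and two points force \<open>m\<^sub>x(r) \<le> 2r\<close>. Hence for \<open>x \<in> K\<close> all circles carry at least
  two points and \<open>m\<^sub>x(r) \<ge> 2r\<close>. For discs centred on \<open>\<partial>U\<close> the half circle gives \<open>m(r) \<le> \<pi>r < 4r\<close>, so that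
  arbitrarily large circles carry at most three points; three points on a half circle give
  \<open>m(r) \<le> 2\<surd>2 r < 3r\<close>, so that arbitrarily large circles carry at most two. This yields
  \<open>m\<^sub>x(r) = 2r\<close> for \<open>x \<in> K\<close> and all \<open>r\<close>, every circle about \<open>x\<close> contains an antipodal pair of \<open>K\<close>, and
  comparing the discs about two points of \<open>K\<close> shows that \<open>K\<close> contains the line through them. Lying in
  the half-plane, this line is horizontal.\<close>

section \<open>Hausdorff measure\<close>

text \<open>Counting and length are tied together by one inequality: if all circles with radius in
  an interval carry at least \<open>k\<close> points of \<open>K\<close>, then \<open>K\<close>
  gains there at least \<open>k\<close> times the length of the interval. Each contradiction is a
  strict gap between two linear growth rates: 4 against \<pi>, 3 against \<open>2 * sqrt 2\<close>,
  3 against 2. The obstacle is the separation condition, which concerns components in the whole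
  plane. It is met by constructing, along with the new set \<open>J\<close>, a map
  \<open>\<rho>\<close> that carries points joined off \<open>J\<close> to points joined off
  \<open>K\<close> and fixes the points off \<open>K\<close> outside the disc. A cone has such a map
  when its apex lies on the circle and in \<open>K\<close>: pushing points away from the apex is
  continuous off the apex and never leads out of the lower half-plane. This apex also saves one
  segment, so that one point costs nothing and two points cost a chord. Discs about a boundary point
  are special because their inside can be merged with the lower half-plane through the lower half
  circle at no cost; a full circle would cost \<open>2 * pi * r\<close>, which exceeds
  \<open>4 * r\<close>.\<close>

definition covers :: "real \<Rightarrow> 'a::metric_space set \<Rightarrow> (nat \<Rightarrow> 'a set) set" where
  "covers \<delta> A = {C. A \<subseteq> (\<Union>i. C i) \<and> (\<forall>i. bounded (C i) \<and> diameter (C i) \<le> \<delta>)}"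

definition pre_hausdorff1 :: "real \<Rightarrow> 'a::metric_space set \<Rightarrow> ennreal" where
  "pre_hausdorff1 \<delta> A = (INF C\<in>covers \<delta> A. \<Sum>i. ennreal (diameter (C i)))"

lemma hausdorff1_eq: "hausdorff1 A = (SUP \<delta>\<in>{0<..}. pre_hausdorff1 \<delta> A)"
  by (simp add: hausdorff1_def pre_hausdorff1_def covers_def)

lemma pre_hausdorff1_le: "0 < \<delta> \<Longrightarrow> pre_hausdorff1 \<delta> A \<le> hausdorff1 A"
  unfolding hausdorff1_eq by (rule SUP_upper) auto

lemma pre_hausdorff1_le_cover:
  "C \<in> covers \<delta> A \<Longrightarrow> pre_hausdorff1 \<delta> A \<le> (\<Sum>i. ennreal (diameter (C i)))"
  unfolding pre_hausdorff1_def by (rule INF_lower)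

lemma hausdorff1_leI: "(\<And>\<delta>. 0 < \<delta> \<Longrightarrow> pre_hausdorff1 \<delta> A \<le> c) \<Longrightarrow> hausdorff1 A \<le> c"
  unfolding hausdorff1_eq by (rule SUP_least) auto

lemma pre_hausdorff1_obtain_cover:
  assumes "pre_hausdorff1 \<delta> A < t"
  obtains C where "C \<in> covers \<delta> A" "(\<Sum>i. ennreal (diameter (C i))) < t"
  using assms unfolding pre_hausdorff1_def INF_less_iff by blast

lemma hausdorff1_obtain_cover:
  assumes "hausdorff1 A < t" "0 < \<delta>"
  obtains C where "C \<in> covers \<delta> A" "(\<Sum>i. ennreal (diameter (C i))) < t"
  using pre_hausdorff1_obtain_cover le_less_trans[OF pre_hausdorff1_le assms(1)] assms(2) by metis

lemma pre_hausdorff1_mono: "A \<subseteq> B \<Longrightarrow> pre_hausdorff1 \<delta> A \<le> pre_hausdorff1 \<delta> B"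
  unfolding pre_hausdorff1_def covers_def by (rule INF_superset_mono) auto

lemma pre_hausdorff1_antimono: "\<delta> \<le> \<delta>' \<Longrightarrow> pre_hausdorff1 \<delta>' A \<le> pre_hausdorff1 \<delta> A"
  unfolding pre_hausdorff1_def covers_def
  by (rule INF_superset_mono) (auto intro: order_trans)

lemma hausdorff1_mono: "A \<subseteq> B \<Longrightarrow> hausdorff1 A \<le> hausdorff1 B"
  by (meson hausdorff1_leI order_trans pre_hausdorff1_le pre_hausdorff1_mono)

lemma hausdorff1_empty [simp]: "hausdorff1 ({} :: 'a::metric_space set) = 0"
proof -
  have "hausdorff1 ({} :: 'a set) \<le> 0"
  proof (rule hausdorff1_leI)
    fix \<delta> :: real assume "0 < \<delta>"
    then have "(\<lambda>_. {}) \<in> covers \<delta> ({} :: 'a set)" by (auto simp: covers_def)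
    from pre_hausdorff1_le_cover[OF this] show "pre_hausdorff1 \<delta> ({} :: 'a set) \<le> 0" by simp
  qed
  then show ?thesis by simp
qed

lemma hausdorff1_UN_le:
  fixes A :: "nat \<Rightarrow> 'a::metric_space set"
  shows "hausdorff1 (\<Union>i. A i) \<le> (\<Sum>i. hausdorff1 (A i))"
proof (cases "(\<Sum>i. hausdorff1 (A i)) = \<infinity>")
  case False
  then have fin: "hausdorff1 (A i) < \<infinity>" for i
    by (metis ennreal_suminf_lessD infinity_ennreal_def less_top)
  show ?thesis
  proof (rule hausdorff1_leI, rule ennreal_le_epsilon)
    fix \<delta> e :: real assume "0 < \<delta>" and e: "0 < e"
    define t where "t i = hausdorff1 (A i) + ennreal (e * (1/2) ^ Suc i)" for i
    have "\<exists>C. C \<in> covers \<delta> (A i) \<and> (\<Sum>j. ennreal (diameter (C j))) < t i" for i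
    proof -
      have "hausdorff1 (A i) < t i" unfolding t_def using fin[of i] e
        by (cases "hausdorff1 (A i)") (auto simp flip: ennreal_plus intro!: ennreal_lessI add_nonneg_pos)
      then show ?thesis using hausdorff1_obtain_cover \<open>0 < \<delta>\<close> by metis
    qed
    then obtain C where C: "\<And>i. C i \<in> covers \<delta> (A i)"
      "\<And>i. (\<Sum>j. ennreal (diameter (C i j))) < t i" by metis
    define D where "D n = (case prod_decode n of (i, j) \<Rightarrow> C i j)" for n
    have "D \<in> covers \<delta> (\<Union>i. A i)"
    proof -
      have "x \<in> (\<Union>n. D n)" if "x \<in> A i" for x i
      proof -
        have "x \<in> (\<Union>j. C i j)" using C(1)[of i] that by (auto simp: covers_def)
        then obtain j where "x \<in> C i j" by blast
        then have "x \<in> D (prod_encode (i, j))" by (simp add: D_def)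
        then show ?thesis by blast
      qed
      then show ?thesis using C(1) unfolding covers_def D_def by (auto split: prod.split)
    qed
    then have "pre_hausdorff1 \<delta> (\<Union>i. A i) \<le> (\<Sum>n. ennreal (diameter (D n)))"
      by (rule pre_hausdorff1_le_cover)
    also have "\<dots> = (\<Sum>i. \<Sum>j. ennreal (diameter (C i j)))"
      using suminf_ennreal_2dimen[of "\<lambda>i. \<Sum>j. ennreal (diameter (C i j))"
          "\<lambda>(i,j). ennreal (diameter (C i j))"]
      by (simp add: D_def split_beta)
    also have "\<dots> \<le> (\<Sum>i. t i)"
      by (intro suminf_le) (auto intro: less_imp_le[OF C(2)])
    also have "\<dots> = (\<Sum>i. hausdorff1 (A i)) + (\<Sum>i. ennreal (e * (1/2) ^ Suc i))"
      unfolding t_def by (rule suminf_add[symmetric]) auto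
    also have "(\<Sum>i. ennreal (e * (1/2) ^ Suc i)) = ennreal e"
      using sums_mult[OF power_half_series, of e] e by (intro suminf_ennreal_eq) auto
    finally show "pre_hausdorff1 \<delta> (\<Union>i. A i) \<le> (\<Sum>i. hausdorff1 (A i)) + ennreal e" .
  qed
qed simp

lemma hausdorff1_Un_le: "hausdorff1 (A \<union> B) \<le> hausdorff1 A + hausdorff1 B"
proof -
  have "hausdorff1 (\<Union>i. binaryset A B i) \<le> (\<Sum>i. hausdorff1 (binaryset A B i))"
    by (rule hausdorff1_UN_le)
  also have "(\<Sum>i. hausdorff1 (binaryset A B i)) = hausdorff1 A + hausdorff1 B"
    by (rule suminf_binaryset_eq) simp
  finally show ?thesis by (simp add: UN_binaryset_eq)
qed

lemma hausdorff1_UN_finite_le: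
  "finite I \<Longrightarrow> hausdorff1 (\<Union>i\<in>I. A i) \<le> (\<Sum>i\<in>I. hausdorff1 (A i))"
proof (induction rule: finite_induct)
  case (insert i I)
  have "hausdorff1 (\<Union>i\<in>insert i I. A i) \<le> hausdorff1 (A i) + hausdorff1 (\<Union>i\<in>I. A i)"
    using hausdorff1_Un_le[of "A i" "\<Union>i\<in>I. A i"] by simp
  also have "\<dots> \<le> hausdorff1 (A i) + (\<Sum>i\<in>I. hausdorff1 (A i))"
    using insert.IH by (intro add_left_mono)
  finally show ?case using insert.hyps by simp
qed simp

section \<open>Additivity on Borel sets by Caratheodory's criterion\<close>

lemma hausdorff1_separated:
  fixes A B :: "'a::metric_space set"
  assumes "0 < \<eta>" and sep: "\<And>x y. x \<in> A \<Longrightarrow> y \<in> B \<Longrightarrow> \<eta> \<le> dist x y"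
  shows "hausdorff1 A + hausdorff1 B \<le> hausdorff1 (A \<union> B)"
proof -
  have small: "pre_hausdorff1 \<delta> A + pre_hausdorff1 \<delta> B \<le> pre_hausdorff1 \<delta> (A \<union> B)"
    if "0 < \<delta>" "\<delta> < \<eta>" for \<delta>
    unfolding pre_hausdorff1_def[of \<delta> "A \<union> B"]
  proof (rule INF_greatest)
    fix C assume C: "C \<in> covers \<delta> (A \<union> B)"
    define CA where "CA i = (if C i \<inter> A \<noteq> {} then C i else {})" for i
    define CB where "CB i = (if C i \<inter> B \<noteq> {} then C i else {})" for i
    \<comment> \<open>Once the mesh is below the gap \<open>\<eta>\<close>, no covering set meets
      both \<open>A\<close> and \<open>B\<close>, so the cover splits into one of \<open>A\<close>
      and one of \<open>B\<close>.\<close>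
    have disj: "C i \<inter> A = {} \<or> C i \<inter> B = {}" for i
    proof (rule ccontr)
      assume "\<not> ?thesis"
      then obtain x y where "x \<in> C i" "x \<in> A" "y \<in> C i" "y \<in> B" by blast
      then have "\<eta> \<le> diameter (C i)"
        using C sep diameter_bounded_bound[of "C i" x y] unfolding covers_def by fastforce
      then show False using C that unfolding covers_def by (auto simp: not_le dest!: spec[of _ i])
    qed
    have "CA \<in> covers \<delta> A" "CB \<in> covers \<delta> B"
      using C that unfolding covers_def CA_def CB_def by fastforce+
    then have "pre_hausdorff1 \<delta> A + pre_hausdorff1 \<delta> B
        \<le> (\<Sum>i. ennreal (diameter (CA i))) + (\<Sum>i. ennreal (diameter (CB i)))"
      by (intro add_mono pre_hausdorff1_le_cover)
    also have "\<dots> = (\<Sum>i. ennreal (diameter (CA i)) + ennreal (diameter (CB i)))"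
      by (rule suminf_add) auto
    also have "\<dots> \<le> (\<Sum>i. ennreal (diameter (C i)))"
      using disj by (intro suminf_le) (auto simp: CA_def CB_def)
    finally show "pre_hausdorff1 \<delta> A + pre_hausdorff1 \<delta> B \<le> (\<Sum>i. ennreal (diameter (C i)))" .
  qed
  have "hausdorff1 A + hausdorff1 B =
      (SUP \<delta>\<in>{0<..}. pre_hausdorff1 \<delta> A + pre_hausdorff1 \<delta> B)"
    unfolding hausdorff1_eq
  proof (rule SUP_add_directed_ennreal[symmetric])
    fix i j :: real assume "i \<in> {0<..}" "j \<in> {0<..}"
    then show "\<exists>k\<in>{0<..}. pre_hausdorff1 i A + pre_hausdorff1 j B
        \<le> pre_hausdorff1 k A + pre_hausdorff1 k B"
      by (intro bexI[of _ "min i j"] add_mono pre_hausdorff1_antimono) auto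
  qed
  also have "\<dots> \<le> hausdorff1 (A \<union> B)"
  proof (rule SUP_least)
    fix \<delta> :: real assume "\<delta> \<in> {0<..}"
    define k where "k = min \<delta> (\<eta>/2)"
    have k: "0 < k" "k < \<eta>" "k \<le> \<delta>" using \<open>\<delta> \<in> _\<close> \<open>0 < \<eta>\<close> by (auto simp: k_def)
    have "pre_hausdorff1 \<delta> A + pre_hausdorff1 \<delta> B \<le> pre_hausdorff1 k A + pre_hausdorff1 k B"
      by (intro add_mono pre_hausdorff1_antimono k)
    also have "\<dots> \<le> pre_hausdorff1 k (A \<union> B)" by (rule small[OF k(1,2)])
    also have "\<dots> \<le> hausdorff1 (A \<union> B)" by (rule pre_hausdorff1_le[OF k(1)])
    finally show "pre_hausdorff1 \<delta> A + pre_hausdorff1 \<delta> B \<le> hausdorff1 (A \<union> B)" .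
  qed
  finally show ?thesis .
qed

lemma hausdorff1_separated_sum:
  fixes R :: "nat \<Rightarrow> 'a::metric_space set"
  assumes sep: "\<And>m. \<exists>\<eta>>0. \<forall>k<m. \<forall>x\<in>R k. \<forall>y\<in>R m. \<eta> \<le> dist x y"
  shows "(\<Sum>k<m. hausdorff1 (R k)) \<le> hausdorff1 (\<Union>k<m. R k)"
proof (induction m)
  case (Suc m)
  obtain \<eta> where \<eta>: "0 < \<eta>" "\<forall>k<m. \<forall>x\<in>R k. \<forall>y\<in>R m. \<eta> \<le> dist x y" using sep by blast
  have "(\<Sum>k<Suc m. hausdorff1 (R k)) \<le> hausdorff1 (\<Union>k<m. R k) + hausdorff1 (R m)"
    using Suc by (simp add: add_right_mono)
  also have "\<dots> \<le> hausdorff1 ((\<Union>k<m. R k) \<union> R m)"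
    using \<eta> by (intro hausdorff1_separated[of \<eta>]) auto
  also have "(\<Union>k<m. R k) \<union> R m = (\<Union>k<Suc m. R k)" by (auto simp: less_Suc_eq)
  finally show ?case .
qed simp

text \<open>The part \<open>S\<close> of \<open>T\<close> at distance at least
  \<open>1 / (n + 1)\<close> from \<open>F\<close> is separated from \<open>F\<close>, so only the
  remainder of \<open>T - F\<close> has to be small. It is covered by the rings \<open>R k\<close>
  with \<open>k \<ge> n\<close>. Rings of equal parity are separated by the rings between them, so
  the lengths of all rings sum to at most \<open>2 * hausdorff1 T\<close>, and the tails of this
  series tend to 0.\<close>

lemma hausdorff1_closed_split:
  fixes F T :: "'a::metric_space set"
  assumes "closed F"
  shows "hausdorff1 (T \<inter> F) + hausdorff1 (T - F) \<le> hausdorff1 T"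
proof (cases "F = {} \<or> hausdorff1 T = \<infinity>")
  case False
  define d where "d x = infdist x F" for x
  have d_pos: "0 < d x" if "x \<notin> F" for x
    using that False assms in_closed_iff_infdist_zero[of F x] infdist_nonneg[of x F]
    unfolding d_def by (metis less_le)
  have d_lip: "d x \<le> d y + dist x y" for x y
    unfolding d_def by (rule infdist_triangle)
  define R where "R k = {x\<in>T. 1 / real (k+2) \<le> d x \<and> d x < 1 / real (k+1)}" for k
  have half: "(\<Sum>k<m. hausdorff1 (R (2*k+p))) \<le> hausdorff1 T" for m p
  proof -
    have "\<exists>\<eta>>0. \<forall>k<m. \<forall>x\<in>R (2*k+p). \<forall>y\<in>R (2*m+p). \<eta> \<le> dist x y" for m
    proof (cases "m = 0")
      case False
      \<comment> \<open>The gap is the width of the skipped ring \<open>R (2*m+p-1)\<close>.\<close>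
      show ?thesis
      proof (intro exI[of _ "1 / real (2*m+p) - 1 / real (2*m+p+1)"] conjI allI impI ballI)
        show "0 < 1 / real (2*m+p) - 1 / real (2*m+p+1)"
          using False frac_less2[of 1 1 "real (2*m+p)" "real (2*m+p+1)"] by simp
        fix k x y assume k: "k < m" and x: "x \<in> R (2*k+p)" and y: "y \<in> R (2*m+p)"
        have "1 / real (2*m+p) \<le> 1 / real (2*k+p+2)"
          using k False by (intro divide_left_mono) auto
        also have "\<dots> \<le> d x" using x by (simp add: R_def add_ac)
        finally have "1 / real (2*m+p) \<le> d x" .
        moreover have "d y \<le> 1 / real (2*m+p+1)" using y by (simp add: R_def add_ac)
        ultimately show "1 / real (2*m+p) - 1 / real (2*m+p+1) \<le> dist x y"
          using d_lip[of x y] by linarith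
      qed
    qed (auto intro: exI[of _ 1])
    from hausdorff1_separated_sum[OF this, of m]
    show ?thesis
      by (rule order_trans) (auto simp: R_def intro!: hausdorff1_mono)
  qed
  have tail: "\<exists>n. (\<Sum>k. hausdorff1 (R (k+n))) \<le> ennreal e" if "0 < e" for e
  proof -
    have part: "(\<Sum>k<2*m. hausdorff1 (R k)) =
        (\<Sum>k<m. hausdorff1 (R (2*k+0))) + (\<Sum>k<m. hausdorff1 (R (2*k+1)))" for m
      by (induction m) (simp_all add: algebra_simps)
    have "(\<Sum>k. hausdorff1 (R k)) \<le> 2 * hausdorff1 T"
    proof (rule suminf_le_const)
      fix n
      have "(\<Sum>k<n. hausdorff1 (R k)) \<le> (\<Sum>k<2*n. hausdorff1 (R k))"
        by (rule sum_mono2) auto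
      also have "\<dots> \<le> hausdorff1 T + hausdorff1 T"
        unfolding part by (intro add_mono half)
      finally show "(\<Sum>k<n. hausdorff1 (R k)) \<le> 2 * hausdorff1 T" by (simp add: mult_2)
    qed simp
    then have fin: "(\<Sum>k. hausdorff1 (R k)) < \<infinity>"
      using False by (auto simp: ennreal_mult_less_top less_top intro: le_less_trans)
    have "\<exists>n. (\<Sum>k. hausdorff1 (R k)) \<le> (\<Sum>k<n. hausdorff1 (R k)) + ennreal e"
    proof (rule ccontr)
      assume "\<not> ?thesis"
      then have le: "(\<Sum>k<n. hausdorff1 (R k)) + ennreal e \<le> (\<Sum>k. hausdorff1 (R k))" for n
        by (meson linear)
      have "(\<lambda>n. (\<Sum>k<n. hausdorff1 (R k)) + ennreal e) \<longlonglongrightarrow> (\<Sum>k. hausdorff1 (R k)) + ennreal e"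
        by (intro tendsto_add summable_LIMSEQ) auto
      then have "(\<Sum>k. hausdorff1 (R k)) + ennreal e \<le> (\<Sum>k. hausdorff1 (R k))"
        by (rule LIMSEQ_le_const2) (use le in blast)
      with fin \<open>0 < e\<close> show False
        by (cases "\<Sum>k. hausdorff1 (R k)") (auto simp flip: ennreal_plus)
    qed
    then obtain n where n: "(\<Sum>k. hausdorff1 (R k)) \<le> (\<Sum>k<n. hausdorff1 (R k)) + ennreal e" ..
    have "(\<Sum>k. hausdorff1 (R (k+n))) + (\<Sum>k<n. hausdorff1 (R k)) = (\<Sum>k. hausdorff1 (R k))"
      by (rule suminf_offset[symmetric]) simp
    then have "(\<Sum>k. hausdorff1 (R (k+n))) + (\<Sum>k<n. hausdorff1 (R k))
        \<le> (\<Sum>k<n. hausdorff1 (R k)) + ennreal e" using n by simp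
    moreover have "(\<Sum>k<n. hausdorff1 (R k)) < \<infinity>"
    proof -
      have "(\<Sum>k<n. hausdorff1 (R k)) \<le> (\<Sum>k. hausdorff1 (R k))"
        by (intro sum_le_suminf) auto
      then show ?thesis using fin by (rule le_less_trans)
    qed
    ultimately have "(\<Sum>k. hausdorff1 (R (k+n))) \<le> ennreal e"
      using \<open>0 < e\<close>
      by (cases "\<Sum>k. hausdorff1 (R (k+n))"; cases "\<Sum>k<n. hausdorff1 (R k)")
        (auto simp: top_unique simp flip: ennreal_plus)
    then show ?thesis ..
  qed
  show ?thesis
  proof (rule ennreal_le_epsilon)
    fix e :: real assume "0 < e"
    then obtain n where n: "(\<Sum>k. hausdorff1 (R (k+n))) \<le> ennreal e" using tail by blast
    define S where "S = {x\<in>T. 1 / real (n+1) \<le> d x}"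
    have "T - F \<subseteq> S \<union> (\<Union>k. R (k+n))"
    proof
      fix x assume x: "x \<in> T - F"
      then have pos: "0 < d x" using d_pos by blast
      show "x \<in> S \<union> (\<Union>k. R (k+n))"
      proof (cases "x \<in> S")
        case nS: False
        have ex: "\<exists>m. 1 / real (m+1) \<le> d x"
          using reals_Archimedean[OF pos] by (auto simp: inverse_eq_divide intro: less_imp_le)
        \<comment> \<open>The least \<open>m\<close> with \<open>1 / (m+1) \<le> d x\<close> puts
          \<open>x\<close> into \<open>R (m-1)\<close>; \<open>n < m\<close> makes
          \<open>m - 1 - n\<close> a genuine difference.\<close>
        define m where "m = (LEAST m. 1 / real (m+1) \<le> d x)"
        have m: "1 / real (m+1) \<le> d x" unfolding m_def by (rule LeastI_ex[OF ex])
        have "d x < 1 / real (n+1)" using x nS by (auto simp: S_def)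
        then have "1 / real (m+1) < 1 / real (n+1)" using m by linarith
        then have "n < m" by (simp add: field_simps)
        moreover have "\<not> 1 / real (m - 1 + 1) \<le> d x"
          using not_less_Least[of "m-1" "\<lambda>m. 1 / real (m+1) \<le> d x"] \<open>n < m\<close>
          unfolding m_def by auto
        ultimately have "x \<in> R ((m - 1 - n) + n)"
          using x m by (auto simp: R_def not_le)
        then show ?thesis by blast
      qed simp
    qed
    then have "hausdorff1 (T - F) \<le> hausdorff1 S + hausdorff1 (\<Union>k. R (k+n))"
      using hausdorff1_mono hausdorff1_Un_le order_trans by metis
    also have "hausdorff1 (\<Union>k. R (k+n)) \<le> ennreal e"
      using hausdorff1_UN_le n by (rule order_trans)
    finally have 1: "hausdorff1 (T - F) \<le> hausdorff1 S + ennreal e" by (simp add: add_left_mono)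
    have "hausdorff1 (T \<inter> F) + hausdorff1 S \<le> hausdorff1 (T \<inter> F \<union> S)"
    proof (rule hausdorff1_separated[of "1 / real (n+1)"])
      fix x y assume "x \<in> T \<inter> F" "y \<in> S"
      then have "d x = 0" "1 / real (n+1) \<le> d y" by (auto simp: d_def S_def)
      then show "1 / real (n+1) \<le> dist x y" using d_lip[of y x] by (simp add: dist_commute)
    qed simp
    also have "\<dots> \<le> hausdorff1 T" by (rule hausdorff1_mono) (auto simp: S_def)
    finally have 2: "hausdorff1 (T \<inter> F) + hausdorff1 S \<le> hausdorff1 T" .
    have "hausdorff1 (T \<inter> F) + hausdorff1 (T - F)
        \<le> hausdorff1 (T \<inter> F) + hausdorff1 S + ennreal e"
      using add_left_mono[OF 1] by (simp add: add.assoc)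
    also have "\<dots> \<le> hausdorff1 T + ennreal e" using 2 by (rule add_right_mono)
    finally show "hausdorff1 (T \<inter> F) + hausdorff1 (T - F) \<le> hausdorff1 T + ennreal e" .
  qed
qed auto

text \<open>A vehicle for importing countable additivity on Borel sets; lengths are stated with
  \<open>hausdorff1\<close> itself.\<close>

definition hausdorff1_measure :: "'a::metric_space measure" where
  "hausdorff1_measure = measure_of UNIV (sets borel) hausdorff1"

lemma measure_space_hausdorff1:
  "measure_space UNIV (sets (borel :: 'a::metric_space measure)) hausdorff1"
proof -
  interpret P: sigma_algebra UNIV "Pow UNIV :: 'a set set" by (rule sigma_algebra_Pow)
  have oms: "outer_measure_space (Pow UNIV) (hausdorff1 :: 'a set \<Rightarrow> ennreal)"
    by (auto simp: outer_measure_space_def positive_def increasing_def countably_subadditive_def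
        intro: hausdorff1_mono hausdorff1_UN_le)
  define \<Lambda> where "\<Lambda> = lambda_system UNIV (Pow UNIV) (hausdorff1 :: 'a set \<Rightarrow> ennreal)"
  have ms: "measure_space UNIV \<Lambda> (hausdorff1 :: 'a set \<Rightarrow> ennreal)"
    unfolding \<Lambda>_def by (rule P.caratheodory_lemma[OF oms])
  then interpret L: sigma_algebra UNIV \<Lambda> by (simp add: measure_space_def)
  have "F \<in> \<Lambda>" if "closed F" for F :: "'a set"
    unfolding \<Lambda>_def P.lambda_system_eq
    using hausdorff1_closed_split[OF that]
    by (auto intro!: antisym) (metis Int_Diff_Un hausdorff1_Un_le)
  then have "{F :: 'a set. closed F} \<subseteq> \<Lambda>" by blast
  from L.sigma_sets_subset[OF this] have "sets (borel :: 'a measure) \<subseteq> \<Lambda>"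
    by (simp add: borel_eq_closed)
  then show ?thesis
    by (rule measure_down[OF ms, rotated]) (use sets.sigma_algebra_axioms[of "borel :: 'a measure"] in simp)
qed

lemma sets_hausdorff1_measure [simp, measurable_cong]: "sets hausdorff1_measure = sets borel"
  unfolding hausdorff1_measure_def using sets.sigma_sets_eq[of borel]
  by (simp add: sets_measure_of)

lemma emeasure_hausdorff1_measure:
  "A \<in> sets borel \<Longrightarrow> emeasure hausdorff1_measure A = hausdorff1 A"
  unfolding hausdorff1_measure_def
  using measure_space_hausdorff1[where 'a='a]
  by (intro emeasure_measure_of_sigma) (auto simp: measure_space_def)

lemma hausdorff1_add:
  assumes "A \<in> sets borel" "B \<in> sets borel" "A \<inter> B = {}"
  shows "hausdorff1 (A \<union> B) = hausdorff1 A + hausdorff1 B"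
  using plus_emeasure[of A hausdorff1_measure B] assms by (simp add: emeasure_hausdorff1_measure)

lemma hausdorff1_suminf:
  assumes "\<And>i::nat. A i \<in> sets borel" "disjoint_family A"
  shows "hausdorff1 (\<Union>i. A i) = (\<Sum>i. hausdorff1 (A i))"
  using suminf_emeasure[of A hausdorff1_measure] assms
  by (simp add: emeasure_hausdorff1_measure subset_eq image_iff)

section \<open>Lipschitz comparisons and the length of segments\<close>

lemma metric_diameter_le:
  fixes S :: "'a::metric_space set"
  assumes "0 \<le> c" "\<And>x y. x \<in> S \<Longrightarrow> y \<in> S \<Longrightarrow> dist x y \<le> c"
  shows "diameter S \<le> c"
  using assms by (auto simp: diameter_def intro!: cSUP_least)

text \<open>Covers of the image are pulled back along \<open>f\<close>. The bound has this direction
  because \<open>f\<close> serves as a coordinate (distance from an end point, angle, direction)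
  that carries a curve to a set of known length.\<close>

lemma hausdorff1_le_expansive:
  fixes f :: "'a::metric_space \<Rightarrow> 'b::metric_space"
  assumes "0 < L" and exp: "\<And>x y. x \<in> A \<Longrightarrow> y \<in> A \<Longrightarrow> dist x y \<le> L * dist (f x) (f y)"
  shows "hausdorff1 A \<le> ennreal L * hausdorff1 (f ` A)"
proof (cases "hausdorff1 (f ` A) = \<infinity>")
  case True
  then show ?thesis using \<open>0 < L\<close> by (simp add: ennreal_mult_top)
next
  case False
  show ?thesis
  proof (rule hausdorff1_leI, rule ennreal_le_epsilon)
    fix \<delta> e :: real assume "0 < \<delta>" "0 < e"
    have "hausdorff1 (f ` A) < hausdorff1 (f ` A) + ennreal (e / L)"
      using False \<open>0 < e\<close> \<open>0 < L\<close>
      by (cases "hausdorff1 (f ` A)") (auto simp flip: ennreal_plus intro!: ennreal_lessI add_nonneg_pos)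
    then obtain C where C: "C \<in> covers (\<delta> / L) (f ` A)"
      "(\<Sum>i. ennreal (diameter (C i))) < hausdorff1 (f ` A) + ennreal (e / L)"
      by (rule hausdorff1_obtain_cover[of _ _ "\<delta> / L"]) (use \<open>0 < \<delta>\<close> \<open>0 < L\<close> in auto)
    have bdC: "bounded (C i)" for i using C(1) by (auto simp: covers_def)
    define D where "D i = A \<inter> f -` C i" for i
    have D: "dist x y \<le> L * diameter (C i)" if "x \<in> D i" "y \<in> D i" for x y i
    proof -
      have "dist (f x) (f y) \<le> diameter (C i)"
        using that by (auto simp: D_def intro!: diameter_bounded_bound bdC)
      then show ?thesis
        using exp[of x y] that \<open>0 < L\<close> mult_left_mono[of "dist (f x) (f y)" "diameter (C i)" L]
        unfolding D_def by (meson IntD1 less_imp_le order_trans)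
    qed
    have diam: "diameter (D i) \<le> L * diameter (C i)" for i
      using \<open>0 < L\<close> diameter_ge_0[OF bdC[of i]] by (intro metric_diameter_le D) auto
    have "D \<in> covers \<delta> A"
    proof -
      have "bounded (D i)" for i
        unfolding bounded_def using D[of _ i] by (cases "D i = {}") blast+
      moreover have "diameter (D i) \<le> \<delta>" for i
      proof -
        have "L * diameter (C i) \<le> L * (\<delta> / L)"
          using C(1) \<open>0 < L\<close> by (intro mult_left_mono) (auto simp: covers_def)
        then show ?thesis using diam[of i] \<open>0 < L\<close> by simp
      qed
      moreover have "A \<subseteq> (\<Union>i. D i)" using C(1) unfolding covers_def D_def by blast
      ultimately show ?thesis by (auto simp: covers_def)
    qed
    then have "pre_hausdorff1 \<delta> A \<le> (\<Sum>i. ennreal (diameter (D i)))"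
      by (rule pre_hausdorff1_le_cover)
    also have "\<dots> \<le> (\<Sum>i. ennreal L * ennreal (diameter (C i)))"
      using \<open>0 < L\<close> diam by (intro suminf_le) (auto simp flip: ennreal_mult' intro!: ennreal_leI)
    also have "\<dots> = ennreal L * (\<Sum>i. ennreal (diameter (C i)))" by simp
    also have "\<dots> \<le> ennreal L * (hausdorff1 (f ` A) + ennreal (e / L))"
      by (intro mult_left_mono less_imp_le[OF C(2)]) auto
    also have "\<dots> = ennreal L * hausdorff1 (f ` A) + ennreal e"
      using \<open>0 < L\<close> \<open>0 < e\<close> by (simp add: distrib_left flip: ennreal_mult)
    finally show "pre_hausdorff1 \<delta> A \<le> ennreal L * hausdorff1 (f ` A) + ennreal e" .
  qed
qed

lemma hausdorff1_interval_le:
  fixes a b :: real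
  assumes "a \<le> b"
  shows "hausdorff1 {a..b} \<le> ennreal (b - a)"
proof (rule hausdorff1_leI)
  fix \<delta> :: real assume "0 < \<delta>"
  obtain n :: nat where n: "0 < n" "(b - a) / \<delta> \<le> real n"
    by (metis gr0I le_less_trans not_less of_nat_0 of_nat_0_less_iff order_less_imp_le real_arch_simple reals_Archimedean2)
  define h where "h = (b - a) / real n"
  have h: "0 \<le> h" "h \<le> \<delta>" "real n * h = b - a"
    using n \<open>0 < \<delta>\<close> assms by (auto simp: h_def field_simps)
  define C where "C i = (if i < n then {a + real i * h .. a + real i * h + h} else {})" for i
  have "{a..b} \<subseteq> (\<Union>i. C i)"
  proof
    fix x assume x: "x \<in> {a..b}"
    show "x \<in> (\<Union>i. C i)"
    proof (cases "h = 0")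
      case True
      then have "x \<in> C 0" using x h(3) n(1) by (auto simp: C_def)
      then show ?thesis by blast
    next
      case False
      then have "0 < h" using h by simp
      show ?thesis
      proof (cases "x = b")
        case True
        have "real (n - 1) * h + h = b - a" using h(3) n(1) by (simp add: of_nat_diff algebra_simps)
        then have "b \<in> C (n - 1)" using n(1) h(1) by (auto simp: C_def)
        then show ?thesis using True by blast
      next
        case xb: False
        define i where "i = nat \<lfloor>(x - a) / h\<rfloor>"
        have nn: "0 \<le> (x - a) / h" using x \<open>0 < h\<close> by simp
        have i: "real i \<le> (x - a) / h" "(x - a) / h < real i + 1"
          unfolding i_def using nn by linarith+
        then have "real i * h \<le> x - a" "x - a \<le> real i * h + h"
          using \<open>0 < h\<close> by (auto simp: field_simps)
        moreover have "i < n"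
        proof -
          have "real i * h < real n * h" using \<open>real i * h \<le> x - a\<close> x xb h(3) by auto
          then show ?thesis using \<open>0 < h\<close> by simp
        qed
        ultimately have "x \<in> C i" by (auto simp: C_def)
        then show ?thesis by blast
      qed
    qed
  qed
  then have "C \<in> covers \<delta> {a..b}" using h by (auto simp: covers_def C_def)
  then have "pre_hausdorff1 \<delta> {a..b} \<le> (\<Sum>i. ennreal (diameter (C i)))"
    by (rule pre_hausdorff1_le_cover)
  also have "\<dots> = (\<Sum>i<n. ennreal (diameter (C i)))"
    by (rule suminf_finite) (auto simp: C_def)
  also have "\<dots> = (\<Sum>i<n. ennreal h)" using h by (intro sum.cong) (auto simp: C_def)
  also have "\<dots> = ennreal (b - a)"
    using h by (simp add: ennreal_of_nat_eq_real_of_nat flip: ennreal_mult)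
  finally show "pre_hausdorff1 \<delta> {a..b} \<le> ennreal (b - a)" .
qed

lemma hausdorff1_closed_segment_le:
  fixes p q :: "'a::real_normed_vector"
  shows "hausdorff1 (closed_segment p q) \<le> ennreal (dist p q)"
proof -
  have norms: "dist p (p + t *\<^sub>R (q - p)) = t * dist p q" if "0 \<le> t" for t
    using that by (simp add: dist_norm norm_minus_commute)
  have seg: "closed_segment p q = (\<lambda>t. p + t *\<^sub>R (q - p)) ` {0..1}"
    by (auto simp: closed_segment_def algebra_simps image_def)
  have "hausdorff1 (closed_segment p q) \<le> ennreal 1 * hausdorff1 (dist p ` closed_segment p q)"
  proof (rule hausdorff1_le_expansive)
    fix x y assume "x \<in> closed_segment p q" "y \<in> closed_segment p q"
    then obtain s t where st: "x = p + s *\<^sub>R (q - p)" "y = p + t *\<^sub>R (q - p)" "0 \<le> s" "0 \<le> t"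
      unfolding seg by force
    have "dist x y = \<bar>s - t\<bar> * norm (q - p)"
      unfolding st by (simp add: dist_norm flip: scaleR_left_diff_distrib)
    also have "\<dots> = dist (dist p x) (dist p y)"
      unfolding st(1,2) norms[OF st(3)] norms[OF st(4)]
      by (simp add: dist_real_def abs_mult dist_norm norm_minus_commute flip: left_diff_distrib)
    finally show "dist x y \<le> 1 * dist (dist p x) (dist p y)" by simp
  qed simp
  also have "dist p ` closed_segment p q \<subseteq> {0..dist p q}"
    unfolding seg by (auto simp: norms mult_left_le_one_le)
  then have "hausdorff1 (dist p ` closed_segment p q) \<le> hausdorff1 {0..dist p q}"
    by (rule hausdorff1_mono)
  also have "\<dots> \<le> ennreal (dist p q)" using hausdorff1_interval_le[of 0 "dist p q"] by simp
  finally show ?thesis by (simp add: mult_left_mono)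
qed

lemma hausdorff1_singleton [simp]: "hausdorff1 {p :: 'a::real_normed_vector} = 0"
  using hausdorff1_closed_segment_le[of p p] by simp

text \<open>Each covering set is replaced by the interval hull of its image, whose length is at most
  the diameter. The outer measure appears because the image need not be measurable.\<close>

lemma outer_lborel_image_le_hausdorff1:
  fixes f :: "'a::metric_space \<Rightarrow> real"
  assumes lip: "\<And>x y. dist (f x) (f y) \<le> dist x y"
  shows "outer_measure_of lborel (f ` A) \<le> hausdorff1 A"
proof (rule ennreal_le_epsilon)
  fix e :: real assume "0 < e" and fin: "hausdorff1 A < top"
  have "hausdorff1 A < hausdorff1 A + ennreal e"
    using fin \<open>0 < e\<close>
    by (cases "hausdorff1 A") (auto simp flip: ennreal_plus intro!: ennreal_lessI add_nonneg_pos)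
  then obtain C where C: "C \<in> covers 1 A"
    "(\<Sum>i. ennreal (diameter (C i))) < hausdorff1 A + ennreal e"
    by (rule hausdorff1_obtain_cover[of _ _ 1]) auto
  have bdC: "bounded (C i)" for i using C(1) by (auto simp: covers_def)
  define I where "I i = (if C i = {} then {} else {Inf (f ` C i) .. Sup (f ` C i)})" for i
  have f_diam: "\<bar>f x - f y\<bar> \<le> diameter (C i)" if "x \<in> C i" "y \<in> C i" for x y i
    using lip[of x y] diameter_bounded_bound[OF bdC that] by (simp add: dist_real_def)
  have bdd: "bdd_above (f ` C i)" "bdd_below (f ` C i)" for i
  proof -
    have "bdd_above (f ` C i) \<and> bdd_below (f ` C i)"
    proof (cases "C i = {}")
      case False
      then obtain y where "y \<in> C i" by blast
      then show ?thesis
        using f_diam[of _ i y]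
        by (auto intro!: bdd_aboveI[of _ "f y + diameter (C i)"] bdd_belowI[of _ "f y - diameter (C i)"]
            simp: abs_le_iff algebra_simps)
    qed simp
    then show "bdd_above (f ` C i)" "bdd_below (f ` C i)" by auto
  qed
  have "f ` A \<subseteq> (\<Union>i. I i)"
  proof (rule image_subsetI)
    fix x assume "x \<in> A"
    then have "x \<in> (\<Union>i. C i)" using C(1) by (auto simp: covers_def)
    then obtain i where "x \<in> C i" by blast
    then have "f x \<in> I i" using bdd by (auto simp: I_def intro!: cInf_lower cSup_upper)
    then show "f x \<in> (\<Union>i. I i)" by blast
  qed
  then have "outer_measure_of lborel (f ` A) \<le> outer_measure_of lborel (\<Union>i. I i)"
    by (rule outer_measure_of_mono)
  also have "\<dots> = emeasure lborel (\<Union>i. I i)"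
    by (rule outer_measure_of_eq) (auto simp: I_def)
  also have "\<dots> \<le> (\<Sum>i. emeasure lborel (I i))"
    by (rule emeasure_subadditive_countably) (auto simp: I_def)
  also have "\<dots> \<le> (\<Sum>i. ennreal (diameter (C i)))"
  proof (rule suminf_le)
    fix i
    have "Sup (f ` C i) - Inf (f ` C i) \<le> diameter (C i)" if "C i \<noteq> {}"
    proof -
      have "Sup (f ` C i) \<le> diameter (C i) + Inf (f ` C i)"
      proof (rule cSup_least)
        fix s assume "s \<in> f ` C i"
        have "s - diameter (C i) \<le> Inf (f ` C i)"
        proof (rule cInf_greatest)
          fix t assume "t \<in> f ` C i"
          then show "s - diameter (C i) \<le> t" using \<open>s \<in> f ` C i\<close> f_diam[of _ i]
            by (fastforce simp: abs_le_iff)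
        qed (use that in auto)
        then show "s \<le> diameter (C i) + Inf (f ` C i)" by simp
      qed (use that in auto)
      then show ?thesis by simp
    qed
    moreover have "Inf (f ` C i) \<le> Sup (f ` C i)" if "C i \<noteq> {}"
      using that bdd by (intro cInf_le_cSup) auto
    ultimately show "emeasure lborel (I i) \<le> ennreal (diameter (C i))"
      by (auto simp: I_def intro!: ennreal_leI)
  qed auto
  also have "\<dots> \<le> hausdorff1 A + ennreal e" using C(2) by (rule less_imp_le)
  finally show "outer_measure_of lborel (f ` A) \<le> hausdorff1 A + ennreal e" .
qed

section \<open>Counting points on level sets\<close>

lemma separated_finite:
  fixes F :: "'a::metric_space set"
  assumes "finite F"
  shows "\<exists>\<eta>>0. \<forall>x\<in>F. \<forall>y\<in>F. x \<noteq> y \<longrightarrow> \<eta> \<le> dist x y"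
proof -
  define S where "S = insert 1 ((\<lambda>(x,y). dist x y) ` {(x,y). x \<in> F \<and> y \<in> F \<and> x \<noteq> y})"
  have "finite {(x,y). x \<in> F \<and> y \<in> F \<and> x \<noteq> y}"
    by (rule finite_subset[of _ "F \<times> F"]) (use assms in auto)
  then have fin: "finite S" by (auto simp: S_def)
  have "0 < Min S" using fin by (subst Min_gr_iff) (auto simp: S_def)
  moreover have "Min S \<le> dist x y" if "x \<in> F" "y \<in> F" "x \<noteq> y" for x y
    using fin that by (intro Min_le) (auto simp: S_def image_iff)
  ultimately show ?thesis by blast
qed

text \<open>A weak form of the Eilenberg inequality. The slices are counted by the pieces of a fine
  partition that they meet, and Fatou's lemma lets the mesh tend to zero.\<close>

lemma hausdorff1_slices:
  fixes f :: "'a::{metric_space,second_countable_topology} \<Rightarrow> real"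
  assumes A: "A \<in> sets borel" and lip: "\<And>x y. dist (f x) (f y) \<le> dist x y" and "a \<le> b"
    and slices: "\<And>r. a < r \<Longrightarrow> r < b \<Longrightarrow> \<exists>F\<subseteq>A. f ` F \<subseteq> {r} \<and> finite F \<and> card F = k"
  shows "ennreal (real k * (b - a)) \<le> hausdorff1 A"
proof -
  obtain D :: "'a set" where D: "countable D" "\<And>X. open X \<Longrightarrow> X \<noteq> {} \<Longrightarrow> \<exists>d\<in>D. d \<in> X"
    using countable_dense_setE by metis
  have "D \<noteq> {}" using D(2)[of UNIV] by auto
  define B where "B n j = ball (from_nat_into D j) (1 / real (Suc n))" for n j
  define Q where "Q n = disjointed (B n)" for n
  have Q_borel: "Q n j \<in> sets borel" for n j
  proof -
    have "range (B n) \<subseteq> sets borel" by (auto simp: B_def)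
    from sets.range_disjointed_sets'[OF this] show ?thesis by (auto simp: Q_def)
  qed
  have Q_disj: "disjoint_family (Q n)" for n
    unfolding Q_def by (rule disjoint_family_disjointed)
  have Q_UN: "(\<Union>j. Q n j) = UNIV" for n
  proof -
    have "x \<in> (\<Union>j. B n j)" for x
    proof -
      obtain d where "d \<in> D" "dist x d < 1 / real (Suc n)"
        using D(2)[of "ball x (1 / real (Suc n))"] by (auto simp: ball_eq_empty)
      then obtain j where "from_nat_into D j = d" using from_nat_into_surj[OF D(1)] by blast
      then have "x \<in> B n j" using \<open>dist x d < _\<close> by (simp add: B_def dist_commute)
      then show ?thesis by blast
    qed
    then show ?thesis by (auto simp: Q_def UN_disjointed_eq)
  qed
  have Q_diam: "dist x y < 2 / real (Suc n)" if "x \<in> Q n j" "y \<in> Q n j" for x y n j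
  proof -
    have "x \<in> B n j" "y \<in> B n j"
      using that disjointed_subset[of "B n" j] by (auto simp: Q_def)
    then have "dist x y < 1 / real (Suc n) + 1 / real (Suc n)"
      using dist_triangle3[of x y "from_nat_into D j"] unfolding B_def mem_ball by linarith
    then show ?thesis by simp
  qed
  \<comment> \<open>Measurable hulls stand in for the projections of the pieces, so that the
    counting function \<open>g n\<close> can be integrated.\<close>
  have "\<exists>M. M \<in> sets lborel \<and> f ` (A \<inter> Q n j) \<subseteq> M \<and> emeasure lborel M \<le> hausdorff1 (A \<inter> Q n j)" for n j
    using outer_measure_of_attain[of "f ` (A \<inter> Q n j)" lborel]
      outer_lborel_image_le_hausdorff1[of f "A \<inter> Q n j", OF lip] by auto
  then obtain M where M: "\<And>n j. M n j \<in> sets lborel" "\<And>n j. f ` (A \<inter> Q n j) \<subseteq> M n j"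
    "\<And>n j. emeasure lborel (M n j) \<le> hausdorff1 (A \<inter> Q n j)" by metis
  have [measurable]: "M n j \<in> sets borel" for n j using M(1) by simp
  define g where "g n r = (\<Sum>j. indicator (M n j) r :: ennreal)" for n r
  have [measurable]: "g n \<in> borel_measurable borel" for n unfolding g_def by measurable
  have int: "(\<integral>\<^sup>+r. g n r \<partial>lborel) \<le> hausdorff1 A" for n
  proof -
    have "(\<integral>\<^sup>+r. g n r \<partial>lborel) = (\<Sum>j. emeasure lborel (M n j))"
      unfolding g_def by (subst nn_integral_suminf) auto
    also have "\<dots> \<le> (\<Sum>j. hausdorff1 (A \<inter> Q n j))" by (intro suminf_le M(3)) auto
    also have "\<dots> = hausdorff1 (\<Union>j. A \<inter> Q n j)"
      using Q_disj[of n] A Q_borel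
      by (intro hausdorff1_suminf[symmetric]) (auto simp: disjoint_family_on_def)
    also have "(\<Union>j. A \<inter> Q n j) = A" using Q_UN[of n] by auto
    finally show ?thesis .
  qed
  have count: "of_nat k * indicator {a<..<b} r \<le> liminf (\<lambda>n. g n r)" for r
  proof (cases "a < r \<and> r < b")
    case True
    obtain F where F: "F \<subseteq> A" "f ` F \<subseteq> {r}" "finite F" "card F = k" using slices True by blast
    obtain \<eta> where \<eta>: "0 < \<eta>" "\<forall>x\<in>F. \<forall>y\<in>F. x \<noteq> y \<longrightarrow> \<eta> \<le> dist x y"
      using separated_finite[OF F(3)] by blast
    \<comment> \<open>As soon as the pieces are smaller than the least distance between the
      \<open>k\<close> points, these lie in \<open>k\<close> different pieces, all counted by
      \<open>g n r\<close>.\<close>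
    have ev: "\<forall>\<^sub>F n in sequentially. 2 / real (Suc n) < \<eta>"
      using \<open>0 < \<eta>\<close> by real_asymp
    have "\<forall>\<^sub>F n in sequentially. of_nat k \<le> g n r"
      using ev
    proof eventually_elim
      case (elim n)
      have "\<exists>j. x \<in> Q n j" for x using Q_UN[of n] by blast
      then obtain c where c: "\<And>x. x \<in> Q n (c x)" by metis
      have inj: "inj_on c F"
      proof (rule inj_onI, rule ccontr)
        fix x y assume "x \<in> F" "y \<in> F" "c x = c y" "x \<noteq> y"
        then show False using c[of x] c[of y] Q_diam[of x n "c x" y] \<eta> elim by fastforce
      qed
      have "of_nat k = (\<Sum>j\<in>c ` F. 1 :: ennreal)" using F(4) inj by (simp add: card_image)
      also have "\<dots> = (\<Sum>j\<in>c ` F. indicator (M n j) r)"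
      proof (rule sum.cong)
        fix j assume "j \<in> c ` F"
        then obtain x where x: "x \<in> F" "j = c x" by blast
        then have "f x \<in> M n j" using M(2)[of n j] c[of x] F(1) by blast
        then show "1 = (indicator (M n j) r :: ennreal)" using F(2) x by auto
      qed simp
      also have "\<dots> \<le> g n r" unfolding g_def using F(3) by (intro sum_le_suminf) auto
      finally show ?case .
    qed
    then have "of_nat k \<le> liminf (\<lambda>n. g n r)" by (rule Liminf_bounded)
    then show ?thesis using True by simp
  qed auto
  have "ennreal (real k * (b - a)) = (\<integral>\<^sup>+r. of_nat k * indicator {a<..<b} r \<partial>lborel)"
    using \<open>a \<le> b\<close> by (simp add: nn_integral_cmult ennreal_mult ennreal_of_nat_eq_real_of_nat)
  also have "\<dots> \<le> (\<integral>\<^sup>+r. liminf (\<lambda>n. g n r) \<partial>lborel)" by (intro nn_integral_mono count)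
  also have "\<dots> \<le> liminf (\<lambda>n. \<integral>\<^sup>+r. g n r \<partial>lborel)" by (rule nn_integral_liminf) auto
  also have "\<dots> \<le> hausdorff1 A" by (rule Liminf_le) (auto simp: int)
  finally show ?thesis .
qed

section \<open>Smooth functions of one variable\<close>

text \<open>Coinduction reduces a smoothness proof to finding a family of functions closed under
  differentiation, with no formula for higher derivatives.\<close>

coinductive smooth :: "(real \<Rightarrow> real) \<Rightarrow> bool" where
  smoothI: "(\<And>x. (f has_real_derivative f' x) (at x)) \<Longrightarrow> smooth f' \<Longrightarrow> smooth f"

lemma smooth_obtain_deriv:
  assumes "smooth f"
  obtains f' where "\<And>x. (f has_real_derivative f' x) (at x)" "smooth f'"
  using smooth.cases[OF assms] by metis

lemma smooth_continuous: "smooth f \<Longrightarrow> continuous_on S f"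
  by (metis DERIV_isCont continuous_at_imp_continuous_on smooth_obtain_deriv)

lemma smooth_closed_derivI:
  assumes "P f" and step: "\<And>g. P g \<Longrightarrow> \<exists>g'. P g' \<and> (\<forall>x. (g has_real_derivative g' x) (at x))"
  shows "smooth f"
  using \<open>P f\<close>
proof (rule smooth.coinduct[of P])
  fix g assume "P g"
  then obtain g' where "P g'" "\<forall>x. (g has_real_derivative g' x) (at x)" using step by blast
  then show "\<exists>f f'. g = f \<and> (\<forall>x. (f has_real_derivative f' x) (at x)) \<and> (P f' \<or> smooth f')"
    by (intro exI[of _ g] exI[of _ g']) simp
qed

text \<open>Single products are not closed under differentiation, but finite sums of products are:
  by the Leibniz rule each pair is replaced by two.\<close>

lemma smooth_sum_products:
  assumes "\<forall>(f, g)\<in>set xs. smooth f \<and> smooth g"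
  shows "smooth (\<lambda>x. \<Sum>(f, g)\<leftarrow>xs. f x * g x)"
proof -
  define P where "P h \<longleftrightarrow> (\<exists>xs. (\<forall>(f, g)\<in>set xs. smooth f \<and> smooth g) \<and>
      h = (\<lambda>x. \<Sum>(f, g)\<leftarrow>xs. f x * g x))" for h :: "real \<Rightarrow> real"
  have step: "\<exists>h'. P h' \<and> (\<forall>x. (h has_real_derivative h' x) (at x))" if Ph: "P h" for h
  proof -
    obtain xs where xs: "\<forall>(f, g)\<in>set xs. smooth f \<and> smooth g"
      "h = (\<lambda>x. \<Sum>(f, g)\<leftarrow>xs. f x * g x)" using Ph unfolding P_def by blast
    from xs(1) have "\<exists>ys. (\<forall>(f, g)\<in>set ys. smooth f \<and> smooth g) \<and>
        (\<forall>x. ((\<lambda>x. \<Sum>(f, g)\<leftarrow>xs. f x * g x) has_real_derivative (\<Sum>(f, g)\<leftarrow>ys. f x * g x)) (at x))"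
    proof (induction xs)
      case (Cons p xs)
      obtain f g where p: "p = (f, g)" by force
      from Cons obtain ys where ys: "\<forall>(f, g)\<in>set ys. smooth f \<and> smooth g"
        "\<And>x. ((\<lambda>x. \<Sum>(f, g)\<leftarrow>xs. f x * g x) has_real_derivative (\<Sum>(f, g)\<leftarrow>ys. f x * g x)) (at x)"
        by auto
      obtain f' where f': "\<And>x. (f has_real_derivative f' x) (at x)" "smooth f'"
        using Cons.prems p smooth_obtain_deriv by auto
      obtain g' where g': "\<And>x. (g has_real_derivative g' x) (at x)" "smooth g'"
        using Cons.prems p smooth_obtain_deriv by auto
      show ?case
        using ys(1) f'(2) g'(2) Cons.prems p
        by (intro exI[of _ "(f', g) # (f, g') # ys"])
          (auto intro!: derivative_eq_intros f'(1) g'(1) ys(2))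
    qed (auto intro: exI[of _ "[]"])
    then obtain ys where "\<forall>(f, g)\<in>set ys. smooth f \<and> smooth g"
      "\<forall>x. (h has_real_derivative (\<Sum>(f, g)\<leftarrow>ys. f x * g x)) (at x)"
      unfolding xs(2) by blast
    then show ?thesis unfolding P_def by blast
  qed
  have "P (\<lambda>x. \<Sum>(f, g)\<leftarrow>xs. f x * g x)" using assms unfolding P_def by blast
  then show ?thesis by (rule smooth_closed_derivI[where P=P, OF _ step])
qed

lemma smooth_const: "smooth (\<lambda>_. c)"
proof (rule smooth_closed_derivI[where P="\<lambda>f. \<exists>c. f = (\<lambda>_. c)"])
  fix g :: "real \<Rightarrow> real" assume "\<exists>c. g = (\<lambda>_. c)"
  then show "\<exists>g'. (\<exists>c. g' = (\<lambda>_. c)) \<and> (\<forall>x. (g has_real_derivative g' x) (at x))"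
    by (intro exI[of _ "\<lambda>_. 0"]) auto
qed blast

lemma smooth_mult: "smooth f \<Longrightarrow> smooth g \<Longrightarrow> smooth (\<lambda>x. f x * g x)"
  using smooth_sum_products[of "[(f, g)]"] by simp

lemma smooth_add: "smooth f \<Longrightarrow> smooth g \<Longrightarrow> smooth (\<lambda>x. f x + g x)"
  using smooth_sum_products[of "[(f, \<lambda>_. 1), (g, \<lambda>_. 1)]"] by (simp add: smooth_const)

lemma smooth_affine:
  assumes "smooth f"
  shows "smooth (\<lambda>x. f (a * x + b))"
\<comment> \<open>The factor \<open>c\<close> in the invariant absorbs the powers of
  \<open>a\<close> that the chain rule produces.\<close>
proof (rule smooth_closed_derivI[where P="\<lambda>h. \<exists>c g. smooth g \<and> h = (\<lambda>x. c * g (a * x + b))"])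
  show "\<exists>c g. smooth g \<and> (\<lambda>x. f (a * x + b)) = (\<lambda>x. c * g (a * x + b))"
    using assms by (intro exI[of _ 1] exI[of _ f]) simp
next
  fix h assume "\<exists>c g. smooth g \<and> h = (\<lambda>x. c * g (a * x + b))"
  then obtain c g where g: "smooth g" "h = (\<lambda>x. c * g (a * x + b))" by blast
  obtain g' where g': "\<And>x. (g has_real_derivative g' x) (at x)" "smooth g'"
    using g(1) smooth_obtain_deriv by blast
  have "(h has_real_derivative (c * a) * g' (a * x + b)) (at x)" for x
    unfolding g(2) by (auto intro!: derivative_eq_intros DERIV_chain'[where g=g] g'(1))
  then show "\<exists>h'. (\<exists>c g. smooth g \<and> h' = (\<lambda>x. c * g (a * x + b))) \<and>
      (\<forall>x. (h has_real_derivative h' x) (at x))"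
    using g'(2) by (intro exI[of _ "\<lambda>x. (c * a) * g' (a * x + b)"]) blast
qed

section \<open>The flat exponential and bump functions\<close>

lemma tendsto_power_poly_exp:
  fixes p :: "real poly"
  shows "((\<lambda>y. y ^ k * poly p y / exp y) \<longlongrightarrow> 0) at_top"
proof (induction p arbitrary: k)
  case (pCons a p)
  have "((\<lambda>y. a * (y ^ k / exp y) + y ^ Suc k * poly p y / exp y) \<longlongrightarrow> a * 0 + 0) at_top"
    by (intro tendsto_intros tendsto_power_div_exp_0 pCons.IH)
  then show ?case by (simp add: field_simps)
qed simp

text \<open>The polynomial in \<open>1 / x\<close> closes the family under differentiation:
  differentiating turns \<open>p\<close> into \<open>p - pderiv p\<close> and brings out a factor
  \<open>1 / x^2\<close>, whence \<open>monom 1 2\<close>.\<close>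

definition flat_exp :: "real poly \<Rightarrow> real \<Rightarrow> real" where
  "flat_exp p x = (if 0 < x then poly p (1 / x) * exp (- (1 / x)) else 0)"

lemma flat_exp_deriv:
  "(flat_exp p has_real_derivative flat_exp (monom 1 2 * (p - pderiv p)) x) (at x)"
proof (cases "x = 0")
  case False
  show ?thesis
  proof (cases "0 < x")
    case True
    have "((\<lambda>x. poly p (1 / x) * exp (- (1 / x))) has_real_derivative
        flat_exp (monom 1 2 * (p - pderiv p)) x) (at x)"
      using True
      by (auto intro!: derivative_eq_intros DERIV_chain'[where g="poly p"] poly_DERIV
          simp: flat_exp_def poly_monom field_simps power2_eq_square)
    then show ?thesis
      by (rule DERIV_cong_ev[THEN iffD1, rotated -1])
        (use eventually_nhds_in_open[of "{0<..}" x] True in \<open>auto elim!: eventually_mono simp: flat_exp_def\<close>)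
  next
    case neg: False
    then have "x < 0" using False by simp
    have "((\<lambda>x. 0) has_real_derivative flat_exp (monom 1 2 * (p - pderiv p)) x) (at x)"
      using neg by (auto simp: flat_exp_def)
    then show ?thesis
      by (rule DERIV_cong_ev[THEN iffD1, rotated -1])
        (use eventually_nhds_in_open[of "{..<0}" x] \<open>x < 0\<close> in \<open>auto elim!: eventually_mono simp: flat_exp_def\<close>)
  qed
next
  case True
  have "((\<lambda>h. (flat_exp p (0 + h) - flat_exp p 0) / h) \<longlongrightarrow> 0) (at_right 0)"
  proof -
    \<comment> \<open>With \<open>y = 1 / h\<close> the difference quotient contributes one further
      factor \<open>y\<close>, and the exponential beats every polynomial.\<close>
    have "((\<lambda>h. inverse h ^ 1 * poly p (inverse h) / exp (inverse h)) \<longlongrightarrow> (0::real)) (at_right 0)"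
      by (rule filterlim_compose[OF tendsto_power_poly_exp filterlim_inverse_at_top_right])
    then show ?thesis
      by (rule Lim_transform_eventually)
        (auto simp: eventually_at_right_field flat_exp_def exp_minus field_simps intro!: exI[of _ 1])
  qed
  moreover have "((\<lambda>h. (flat_exp p (0 + h) - flat_exp p 0) / h) \<longlongrightarrow> 0) (at_left 0)"
    by (rule Lim_transform_eventually[OF tendsto_const])
      (auto simp: eventually_at_left_field flat_exp_def intro!: exI[of _ "-1"])
  ultimately have "(flat_exp p has_real_derivative 0) (at 0)"
    unfolding DERIV_def by (simp add: filterlim_split_at_real)
  then show ?thesis using True by (simp add: flat_exp_def)
qed

lemma smooth_flat_exp: "smooth (flat_exp p)"
  by (rule smooth_closed_derivI[where P="\<lambda>h. \<exists>q. h = flat_exp q"]) (use flat_exp_deriv in blast)+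

text \<open>\<open>n\<close> controls the steepness: the functions are positive exactly on the open
  interval from \<open>p\<close> to \<open>q\<close>, bounded by 1, and tend pointwise to its
  indicator. For \<open>q \<le> p\<close> they vanish.\<close>

definition bump :: "real \<Rightarrow> real \<Rightarrow> nat \<Rightarrow> real \<Rightarrow> real" where
  "bump p q n x = flat_exp 1 (real (Suc n) * (x - p)) * flat_exp 1 (real (Suc n) * (q - x))"

lemma smooth_bump: "smooth (bump p q n)"
proof -
  have "smooth (\<lambda>x. flat_exp 1 (real (Suc n) * x + - real (Suc n) * p) *
      flat_exp 1 (- real (Suc n) * x + real (Suc n) * q))"
    by (intro smooth_mult smooth_affine smooth_flat_exp)
  then show ?thesis unfolding bump_def[abs_def] by (simp add: algebra_simps)
qed

lemma bump_eq_0: "x \<notin> {p<..<q} \<Longrightarrow> bump p q n x = 0"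
  by (auto simp: bump_def flat_exp_def zero_less_mult_iff)

lemma bump_pos: "x \<in> {p<..<q} \<Longrightarrow> 0 < bump p q n x"
  by (auto simp: bump_def flat_exp_def zero_less_mult_iff)

lemma bump_nonneg: "0 \<le> bump p q n x"
  using bump_pos[of x p q n] bump_eq_0[of x p q n] by (cases "x \<in> {p<..<q}") auto

lemma bump_le_1: "bump p q n x \<le> 1"
  unfolding bump_def flat_exp_def by (auto intro!: mult_le_one)

lemma bump_tendsto: "(\<lambda>n. bump p q n x) \<longlonglongrightarrow> indicator {p<..<q} x"
proof (cases "x \<in> {p<..<q}")
  case True
  have "(\<lambda>n. exp (- (1 / (real (Suc n) * c)))) \<longlonglongrightarrow> 1" if "0 < c" for c
    using that by real_asymp
  then have "(\<lambda>n. exp (- (1 / (real (Suc n) * (x - p)))) * exp (- (1 / (real (Suc n) * (q - x))))) \<longlonglongrightarrow> 1 * 1"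
    using True by (intro tendsto_mult) auto
  then show ?thesis using True by (simp add: bump_def flat_exp_def zero_less_mult_iff)
qed (simp add: bump_eq_0)

section \<open>Product test functions\<close>

lemma Ck_add:
  "Ck k f \<Longrightarrow> Ck k g \<Longrightarrow> Ck k (\<lambda>x. f x + g x)"
proof (induction k arbitrary: f g)
  case (Suc k)
  have "frechet_derivative (\<lambda>x. f x + g x) (at x) = (\<lambda>v. frechet_derivative f (at x) v + frechet_derivative g (at x) v)" for x
    using Suc.prems
    by (intro frechet_derivative_at[symmetric] has_derivative_add) (auto simp: frechet_derivative_works)
  then show ?case using Suc by (auto intro!: derivative_intros)
qed (auto intro: continuous_on_add)

lemma Ck_cmult: "Ck k f \<Longrightarrow> Ck k (\<lambda>x. c * f x)"
proof (induction k arbitrary: f)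
  case (Suc k)
  have "frechet_derivative (\<lambda>x. c * f x) (at x) = (\<lambda>v. c * frechet_derivative f (at x) v)" for x
  proof -
    have "(f has_derivative frechet_derivative f (at x)) (at x)"
      using Suc.prems by (simp add: frechet_derivative_works)
    from has_derivative_mult_right[OF this, of c] show ?thesis
      by (rule frechet_derivative_at[symmetric])
  qed
  then show ?case using Suc by (auto intro!: derivative_intros)
qed (auto intro: continuous_intros)

text \<open>Products of one-variable bumps are test functions enough: they approximate indicators of
  boxes, and a partial derivative acts on one factor only.\<close>

definition tensor :: "(real \<Rightarrow> real) \<Rightarrow> (real \<Rightarrow> real) \<Rightarrow> plane \<Rightarrow> real" where
  "tensor f g x = f (x $ 1) * g (x $ 2)"

lemma tensor_has_derivative:
  assumes "\<And>t. (f has_real_derivative f' t) (at t)" "\<And>t. (g has_real_derivative g' t) (at t)"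
  shows "(tensor f g has_derivative (\<lambda>v. v $ 1 * tensor f' g x + v $ 2 * tensor f g' x)) (at x)"
proof -
  have "((\<lambda>x. f (x $ i)) has_derivative (\<lambda>v. v $ i * f' (x $ i))) (at x)"
    if "\<And>t. (f has_real_derivative f' t) (at t)" for f f' :: "real \<Rightarrow> real" and i :: 2
    using has_derivative_compose[OF bounded_linear.has_derivative[OF bounded_linear_vec_nth has_derivative_ident]
        that[unfolded has_field_derivative_def], of i x]
    by (simp add: mult.commute)
  from has_derivative_mult[OF this[OF assms(1), of 1] this[OF assms(2), of 2]] show ?thesis
    unfolding tensor_def[abs_def] by (rule has_derivative_eq_rhs) (simp add: fun_eq_iff mult_ac add_ac)
qed

lemma Ck_tensor: "smooth f \<Longrightarrow> smooth g \<Longrightarrow> Ck k (tensor f g)"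
proof (induction k arbitrary: f g)
  case 0
  have "continuous_on UNIV (\<lambda>x :: plane. f (x $ 1) * g (x $ 2))"
    by (intro continuous_on_mult continuous_on_compose2[OF smooth_continuous[OF 0(1)], of UNIV]
        continuous_on_compose2[OF smooth_continuous[OF 0(2)], of UNIV] continuous_intros) auto
  then show ?case by (simp add: tensor_def[abs_def])
next
  case (Suc k)
  obtain f' where f': "\<And>x. (f has_real_derivative f' x) (at x)" "smooth f'"
    using Suc.prems smooth_obtain_deriv by auto
  obtain g' where g': "\<And>x. (g has_real_derivative g' x) (at x)" "smooth g'"
    using Suc.prems smooth_obtain_deriv by auto
  note D = tensor_has_derivative[OF f'(1) g'(1)]
  have "Ck k (\<lambda>x. v $ 1 * tensor f' g x + v $ 2 * tensor f g' x)" for v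
    by (intro Ck_add Ck_cmult Suc.IH f' g' Suc.prems)
  then show ?case
    using D by (auto simp: frechet_derivative_at[OF D, symmetric] differentiable_def)
qed

definition bump_fun :: "real \<Rightarrow> real \<Rightarrow> (real \<Rightarrow> real) \<Rightarrow> bool" where
  "bump_fun a b f \<longleftrightarrow> smooth f \<and> (\<forall>x. x \<notin> {a..b} \<longrightarrow> f x = 0)"

lemma bump_fun_bump: "a \<le> p \<Longrightarrow> q \<le> b \<Longrightarrow> bump_fun a b (bump p q n)"
  unfolding bump_fun_def by (auto intro!: smooth_bump bump_eq_0)

lemma test_function_tensor:
  assumes "bump_fun (a $ 1) (b $ 1) f" "bump_fun (a $ 2) (b $ 2) g" "cbox a b \<subseteq> \<Omega>"
  shows "test_function \<Omega> (tensor f g)"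
proof -
  have "{x. tensor f g x \<noteq> 0} \<subseteq> cbox a b"
    using assms(1,2) by (force simp: tensor_def bump_fun_def mem_box_cart forall_2)
  then have "closure {x. tensor f g x \<noteq> 0} \<subseteq> cbox a b"
    by (rule closure_minimal) (rule closed_cbox)
  then have "compact (closure {x. tensor f g x \<noteq> 0})" "closure {x. tensor f g x \<noteq> 0} \<subseteq> \<Omega>"
    using assms(3) bounded_subset[OF bounded_cbox] by (auto simp: compact_eq_bounded_closed)
  then show ?thesis using assms by (auto simp: test_function_def bump_fun_def intro: Ck_tensor)
qed

text \<open>A function supported in the interval has a primitive supported there exactly when its
  integral vanishes. Subtracting a multiple of a fixed \<open>\<eta>\<close> with positive integral
  achieves this; \<open>I \<alpha>\<close> is the quotient of the two integrals.\<close>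

lemma bump_fun_primitive:
  assumes "a < b"
  obtains \<eta> I where "bump_fun a b \<eta>"
    "\<And>\<alpha>. bump_fun a b \<alpha> \<Longrightarrow>
      \<exists>A. bump_fun a b A \<and> (\<forall>t. (A has_real_derivative \<alpha> t - I \<alpha> * \<eta> t) (at t))"
proof -
  have prim: "\<exists>F. \<forall>t. (F has_real_derivative f t) (at t)" if "smooth f" for f
  proof -
    have "isCont f x" for x
      using smooth_continuous[OF that, of UNIV] by (simp add: continuous_on_eq_continuous_at)
    then show ?thesis
      using einterval_antiderivative[of "-\<infinity>" "\<infinity>" f]
      by (auto simp: has_real_derivative_iff_has_vector_derivative)
  qed
  have const_left: "F t = F a"
    if F: "\<And>t. (F has_real_derivative f t) (at t)" and f: "bump_fun a b f" and t: "t \<le> a" for F f t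
  proof (cases "t = a")
    case False
    then obtain z where "t < z" "z < a" "F a - F t = (a - t) * f z"
      using MVT2[of t a F f] F t by auto
    then show ?thesis using f by (simp add: bump_fun_def)
  qed simp
  have const_right: "F t = F b"
    if F: "\<And>t. (F has_real_derivative f t) (at t)" and f: "bump_fun a b f" and t: "b \<le> t" for F f t
  proof (cases "t = b")
    case False
    then obtain z where "b < z" "z < t" "F t - F b = (t - b) * f z"
      using MVT2[of b t F f] F t by auto
    then show ?thesis using f by (simp add: bump_fun_def)
  qed simp
  define \<eta> where "\<eta> = bump a b 0"
  have \<eta>: "bump_fun a b \<eta>" unfolding \<eta>_def by (rule bump_fun_bump) auto
  then obtain H where H: "\<And>t. (H has_real_derivative \<eta> t) (at t)"
    using prim unfolding bump_fun_def by blast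
  obtain z where "a < z" "z < b" "H b - H a = (b - a) * \<eta> z"
    using MVT2[of a b H \<eta>] \<open>a < b\<close> H by auto
  then have Hpos: "0 < H b - H a" using \<open>a < b\<close> bump_pos[of z a b 0] by (simp add: \<eta>_def)
  have "\<exists>I A. bump_fun a b A \<and> (\<forall>t. (A has_real_derivative \<alpha> t - I * \<eta> t) (at t))"
    if \<alpha>: "bump_fun a b \<alpha>" for \<alpha>
  proof -
    obtain G where G: "\<And>t. (G has_real_derivative \<alpha> t) (at t)"
      using prim \<alpha> unfolding bump_fun_def by blast
    define I where "I = (G b - G a) / (H b - H a)"
    define A where "A t = G t - G a - I * (H t - H a)" for t
    have A: "(A has_real_derivative \<alpha> t - I * \<eta> t) (at t)" for t
      unfolding A_def[abs_def] by (auto intro!: derivative_eq_intros G H)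
    have "smooth (\<lambda>t. \<alpha> t + (- I) * \<eta> t)"
      using \<alpha> \<eta> by (intro smooth_add smooth_mult smooth_const) (auto simp: bump_fun_def)
    then have "smooth A" using A by (intro smoothI[of A "\<lambda>t. \<alpha> t - I * \<eta> t"]) auto
    moreover have "A t = 0" if "t \<notin> {a..b}" for t
    proof -
      from that consider "t \<le> a" | "b \<le> t" by fastforce
      then show ?thesis
      proof cases
        case 1
        then show ?thesis using const_left[OF G \<alpha> 1] const_left[OF H \<eta> 1] by (simp add: A_def)
      next
        case 2
        then show ?thesis
          using const_right[OF G \<alpha> 2] const_right[OF H \<eta> 2] Hpos by (simp add: A_def I_def)
      qed
    qed
    ultimately show ?thesis using A unfolding bump_fun_def by blast
  qed
  then obtain I where "\<And>\<alpha>. bump_fun a b \<alpha> \<Longrightarrow>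
      \<exists>A. bump_fun a b A \<and> (\<forall>t. (A has_real_derivative \<alpha> t - I \<alpha> * \<eta> t) (at t))" by metis
  with \<eta> show ?thesis by (rule that)
qed

section \<open>The fundamental lemma of the calculus of variations\<close>

text \<open>\<open>ennreal\<close> cuts off negative values, so the two densities are the positive
  and the negative part of \<open>f\<close>. Their measures are finite and agree on boxes, which are
  stable under intersection; so the measures coincide, hence the densities, and equal parts leave
  only \<open>f = 0\<close>.\<close>

lemma AE_zero_if_box_integrals_zero:
  fixes f :: "'a::euclidean_space \<Rightarrow> real"
  assumes f: "integrable lborel f"
    and zero: "\<And>a b. (\<integral>x. f x * indicator (box a b) x \<partial>lborel) = 0"
  shows "AE x in lborel. f x = 0"
proof -
  have [measurable]: "f \<in> borel_measurable borel" using f by auto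
  define M where "M = density lborel (\<lambda>x. ennreal (f x))"
  define N where "N = density lborel (\<lambda>x. ennreal (- f x))"
  have int: "integrable lborel (\<lambda>x. f x * indicator (box a b) x)" for a b
    by (rule integrable_real_mult_indicator) (use f in auto)
  have eq: "emeasure M (box a b) = emeasure N (box a b)"
    and fin: "emeasure M (box a b) \<noteq> \<infinity>" for a b
  proof -
    let ?g = "\<lambda>x. f x * indicator (box a b) x"
    have M: "emeasure M (box a b) = (\<integral>\<^sup>+x. ennreal (?g x) \<partial>lborel)"
      unfolding M_def by (subst emeasure_density) (auto intro!: nn_integral_cong split: split_indicator)
    have N: "emeasure N (box a b) = (\<integral>\<^sup>+x. ennreal (- ?g x) \<partial>lborel)"
      unfolding N_def by (subst emeasure_density) (auto intro!: nn_integral_cong split: split_indicator)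
    have "enn2real (\<integral>\<^sup>+x. ennreal (?g x) \<partial>lborel) - enn2real (\<integral>\<^sup>+x. ennreal (- ?g x) \<partial>lborel) = 0"
      using real_lebesgue_integral_def[OF int[of a b]] zero[of a b] by simp
    moreover have "(\<integral>\<^sup>+x. ennreal (?g x) \<partial>lborel) < \<infinity>" "(\<integral>\<^sup>+x. ennreal (- ?g x) \<partial>lborel) < \<infinity>"
      using int[of a b] by (auto simp: real_integrable_def less_top)
    ultimately show "emeasure M (box a b) = emeasure N (box a b)" "emeasure M (box a b) \<noteq> \<infinity>"
      unfolding M N
      by (cases "\<integral>\<^sup>+x. ennreal (?g x) \<partial>lborel"; cases "\<integral>\<^sup>+x. ennreal (- ?g x) \<partial>lborel"; simp)+
  qed
  have "M = N"
  proof (rule measure_eqI_generator_eq[where E="range (\<lambda>(a, b). box a b)" and \<Omega>=UNIV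
        and A="\<lambda>n. box (- real n *\<^sub>R One) (real n *\<^sub>R One)"])
    show "Int_stable (range (\<lambda>(a, b). box a b :: 'a set))"
      by (auto simp: Int_stable_def box_Int_box)
    show "(\<Union>i. box (- real i *\<^sub>R One) (real i *\<^sub>R One)) = (UNIV :: 'a set)"
      using UN_box_eq_UNIV by (auto simp: scaleR_minus_left)
    show "sets M = sigma_sets UNIV (range (\<lambda>(a, b). box a b))"
      "sets N = sigma_sets UNIV (range (\<lambda>(a, b). box a b))"
      by (simp_all add: M_def N_def borel_eq_box)
  qed (use eq fin in auto)
  then have "AE x in lborel. ennreal (f x) = ennreal (- f x)"
    unfolding M_def N_def by (intro sigma_finite_measure.density_unique[OF sigma_finite_lborel]) auto
  then show ?thesis
  proof eventually_elim
    case (elim x)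
    then show ?case by (cases "0 \<le> f x") (auto simp: ennreal_neg ennreal_eq_0_iff)
  qed
qed

lemma fundamental_lemma_box:
  fixes f :: "plane \<Rightarrow> real"
  assumes f: "set_integrable lebesgue (cbox a b) f"
    and zero: "\<And>\<alpha> \<beta>. bump_fun (a $ 1) (b $ 1) \<alpha> \<Longrightarrow> bump_fun (a $ 2) (b $ 2) \<beta> \<Longrightarrow>
      (LINT x:cbox a b|lebesgue. f x * tensor \<alpha> \<beta> x) = 0"
  shows "AE x in lebesgue. x \<in> cbox a b \<longrightarrow> f x = 0"
proof -
  define F where "F x = indicator (cbox a b) x * f x" for x
  have F: "integrable lebesgue F" using f by (simp add: F_def[abs_def] set_integrable_def)
  have box_zero: "(\<integral>x. F x * indicator (box p q) x \<partial>lebesgue) = 0" for p q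
  proof -
    \<comment> \<open>The box is clipped to \<open>cbox a b\<close> to make the bumps admissible; if
      nothing remains, they vanish. As \<open>F\<close> is zero off \<open>cbox a b\<close>,
      clipping matters only on its negligible boundary.\<close>
    define p' where "p' = (\<chi> i. max (p $ i) (a $ i))"
    define q' where "q' = (\<chi> i. min (q $ i) (b $ i))"
    define \<phi> where "\<phi> n = tensor (bump (p' $ 1) (q' $ 1) n) (bump (p' $ 2) (q' $ 2) n)" for n
    have tens: "continuous_on UNIV (tensor \<alpha> \<beta>)" if "smooth \<alpha>" "smooth \<beta>" for \<alpha> \<beta>
      using Ck_tensor[OF that, of 0] by simp
    have m: "\<phi> n \<in> borel_measurable lebesgue" for n
      using tens[OF smooth_bump smooth_bump]
      by (auto simp: \<phi>_def intro!: borel_measurable_continuous_onI measurable_completion)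
    have "(\<lambda>n. \<integral>x. F x * \<phi> n x \<partial>lebesgue) \<longlonglongrightarrow> (\<integral>x. F x * indicator (box p' q') x \<partial>lebesgue)"
    proof (rule integral_dominated_convergence[where w="\<lambda>x. norm (F x)"])
      have "(\<lambda>n. \<phi> n x) \<longlonglongrightarrow> indicator {p' $ 1<..<q' $ 1} (x $ 1) * indicator {p' $ 2<..<q' $ 2} (x $ 2)" for x
        unfolding \<phi>_def tensor_def by (intro tendsto_mult bump_tendsto)
      moreover have "indicator {p' $ 1<..<q' $ 1} (x $ 1) * indicator {p' $ 2<..<q' $ 2} (x $ 2)
          = (indicator (box p' q') x :: real)" for x
        by (auto simp: indicator_def mem_box_cart forall_2)
      ultimately show "AE x in lebesgue. (\<lambda>n. F x * \<phi> n x) \<longlonglongrightarrow> F x * indicator (box p' q') x"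
        by (auto intro!: tendsto_mult)
      show "AE x in lebesgue. norm (F x * \<phi> n x) \<le> norm (F x)" for n
        by (auto simp: abs_mult \<phi>_def tensor_def bump_nonneg bump_le_1 abs_of_nonneg
            intro!: mult_left_le mult_le_one)
    qed (use F m in \<open>auto intro!: borel_measurable_times borel_measurable_indicator
        dest: borel_measurable_integrable\<close>)
    moreover have "(\<integral>x. F x * \<phi> n x \<partial>lebesgue) = 0" for n
    proof -
      have "(LINT x:cbox a b|lebesgue. f x * \<phi> n x) = 0"
        unfolding \<phi>_def by (intro zero bump_fun_bump) (auto simp: p'_def q'_def)
      then show ?thesis by (simp add: set_lebesgue_integral_def F_def mult_ac)
    qed
    ultimately have "(\<integral>x. F x * indicator (box p' q') x \<partial>lebesgue) = 0"
      by (simp add: LIMSEQ_const_iff)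
    moreover have "AE x in lebesgue. F x * indicator (box p q) x = F x * indicator (box p' q') x"
    proof -
      have "negligible (cbox a b - box a b)" by (rule negligible_frontier_interval)
      then have "AE x in lebesgue. x \<notin> cbox a b - box a b"
        by (intro AE_not_in) (simp add: negligible_iff_null_sets)
      then show ?thesis
        by eventually_elim (auto simp: F_def indicator_def p'_def q'_def mem_box_cart)
    qed
    ultimately show ?thesis
      using F by (subst integral_cong_AE[where g="\<lambda>x. F x * indicator (box p' q') x"])
        (auto intro!: borel_measurable_integrable integrable_real_mult_indicator)
  qed
  obtain F' where F': "F' \<in> borel_measurable lborel" "AE x in lborel. F x = F' x"
    using completion_ex_borel_measurable_real[OF borel_measurable_integrable[OF F]] by blast
  have F'_eq: "AE x in lebesgue. F x = F' x" using F'(2) by (rule AE_completion)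
  have F'm: "F' \<in> borel_measurable lebesgue" using F'(1) by (rule measurable_completion)
  have "integrable lebesgue F'"
    using F F'_eq F'm by (subst integrable_cong_AE[where g=F]) (auto elim: eventually_mono)
  then have "integrable lborel F'" using F'(1) by (simp add: integrable_completion)
  moreover have "(\<integral>x. F' x * indicator (box p q) x \<partial>lborel) = 0" for p q
  proof -
    have "(\<integral>x. F' x * indicator (box p q) x \<partial>lborel) = (\<integral>x. F' x * indicator (box p q) x \<partial>lebesgue)"
      using F'(1) by (intro integral_completion[symmetric]) auto
    also have "\<dots> = (\<integral>x. F x * indicator (box p q) x \<partial>lebesgue)"
      using F'_eq F'm borel_measurable_integrable[OF F]
      by (intro integral_cong_AE borel_measurable_times borel_measurable_indicator) (auto elim: eventually_mono)
    finally show ?thesis using box_zero by simp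
  qed
  ultimately have "AE x in lborel. F' x = 0" by (rule AE_zero_if_box_integrals_zero)
  then have "AE x in lebesgue. F' x = 0" by (rule AE_completion)
  with F'_eq show ?thesis by eventually_elim (auto simp: F_def)
qed

section \<open>Integrals of derivatives\<close>

lemma continuous_compact_support_integrable:
  fixes f :: "'a::euclidean_space \<Rightarrow> real"
  assumes "continuous_on UNIV f" "\<And>x. R < norm x \<Longrightarrow> f x = 0"
  shows "integrable lborel f"
proof -
  have "integrable lborel (\<lambda>x. indicator (cball 0 R) x *\<^sub>R f x)"
    by (intro borel_integrable_compact continuous_on_subset[OF assms(1)]) auto
  moreover have "(\<lambda>x. indicator (cball 0 R) x *\<^sub>R f x) = f"
    using assms(2) by (auto simp: indicator_def fun_eq_iff not_le)
  ultimately show ?thesis by simp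
qed

text \<open>Difference quotients have integral zero by translation invariance, and the mean value
  theorem bounds them by the maximum of the derivative, so dominated convergence applies.\<close>

lemma integral_directional_derivative_zero:
  fixes f :: "'a::euclidean_space \<Rightarrow> real"
  assumes D: "\<And>x. (f has_derivative f' x) (at x)" and cont: "continuous_on UNIV (\<lambda>x. f' x v)"
    and supp: "\<And>x. R < norm x \<Longrightarrow> f x = 0"
  shows "integrable lborel (\<lambda>x. f' x v)" "(\<integral>x. f' x v \<partial>lborel) = 0"
proof -
  have f_cont: "continuous_on UNIV f"
    by (metis D continuous_at_imp_continuous_on has_derivative_continuous)
  have D0: "f' x v = 0" if "R < norm x" for x
  proof -
    have "open {y :: 'a. R < norm y}" by (intro open_Collect_less continuous_intros)
    then have "(f has_derivative (\<lambda>_. 0)) (at x)"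
      using that supp
      by (intro has_derivative_transform_within_open[OF has_derivative_const[of 0]]) auto
    then show ?thesis using has_derivative_unique[OF D] by metis
  qed
  show "integrable lborel (\<lambda>x. f' x v)"
    using cont D0 by (rule continuous_compact_support_integrable)
  have "bounded ((\<lambda>x. f' x v) ` cball 0 R)"
    by (intro compact_imp_bounded compact_continuous_image continuous_on_subset[OF cont]) auto
  then obtain M0 where M0: "\<And>x. x \<in> cball 0 R \<Longrightarrow> \<bar>f' x v\<bar> \<le> M0"
    unfolding bounded_iff by fastforce
  define M where "M = max M0 0"
  have M: "\<bar>f' x v\<bar> \<le> M" for x
    using M0[of x] D0[of x] by (cases "R < norm x") (auto simp: M_def)
  have line: "((\<lambda>t. f (x + t *\<^sub>R v)) has_real_derivative f' (x + t *\<^sub>R v) v) (at t)" for x t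
  proof -
    have "((\<lambda>t. x + t *\<^sub>R v) has_derivative (\<lambda>h. h *\<^sub>R v)) (at t)"
      by (auto intro!: derivative_eq_intros)
    from has_derivative_compose[OF this D] have "((\<lambda>t. f (x + t *\<^sub>R v)) has_derivative
        (\<lambda>h. f' (x + t *\<^sub>R v) (h *\<^sub>R v))) (at t)" .
    moreover have "linear (f' (x + t *\<^sub>R v))" using D has_derivative_linear by blast
    ultimately show ?thesis
      by (simp add: has_field_derivative_def linear_scale mult_commute_abs)
  qed
  define s where "s n = 1 / real (Suc n)" for n
  have s: "0 < s n" "s n \<le> 1" for n by (auto simp: s_def)
  define g where "g n x = (f (x + s n *\<^sub>R v) - f x) / s n" for n x
  have f_int: "integrable lborel f" using f_cont supp by (rule continuous_compact_support_integrable)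
  have trans: "integrable lborel (\<lambda>x. f (x + c))" "(\<integral>x. f (x + c) \<partial>lborel) = (\<integral>x. f x \<partial>lborel)" for c
  proof -
    have "integrable (distr lborel borel ((+) c)) f" using f_int by (simp add: lborel_distr_plus)
    then show "integrable lborel (\<lambda>x. f (x + c))"
      by (subst (asm) integrable_distr_eq) (use f_int in \<open>auto simp: add.commute\<close>)
    have "(\<integral>x. f x \<partial>lborel) = (\<integral>x. f x \<partial>distr lborel borel ((+) c))" by (simp add: lborel_distr_plus)
    also have "\<dots> = (\<integral>x. f (c + x) \<partial>lborel)" using f_int by (intro integral_distr) auto
    finally show "(\<integral>x. f (x + c) \<partial>lborel) = (\<integral>x. f x \<partial>lborel)" by (simp add: add.commute)
  qed
  have "(\<integral>x. g n x \<partial>lborel) = 0" for n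
    unfolding g_def using trans[of "s n *\<^sub>R v"] f_int by simp
  \<comment> \<open>The steps \<open>s n\<close> are at most 1, so the translated supports stay in
    the ball of radius \<open>R + norm v\<close>.\<close>
  moreover have "(\<lambda>n. \<integral>x. g n x \<partial>lborel) \<longlonglongrightarrow> (\<integral>x. f' x v \<partial>lborel)"
  proof (rule integral_dominated_convergence[where w="\<lambda>x. M * indicator (cball 0 (R + norm v)) x"])
    show "integrable lborel (\<lambda>x::'a. M * indicator (cball 0 (R + norm v)) x :: real)"
      by (intro integrable_mult_right integrable_real_indicator) (use emeasure_bounded_finite[of "cball (0::'a) (R + norm v)"] in auto)
    show "AE x in lborel. (\<lambda>n. g n x) \<longlonglongrightarrow> f' x v"
    proof (rule AE_I2)
      fix x
      have "((\<lambda>t. (f (x + t *\<^sub>R v) - f x) / t) \<longlongrightarrow> f' x v) (at 0)"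
        using line[of x 0] by (simp add: DERIV_def)
      moreover have "filterlim s (at 0) sequentially"
        unfolding s_def by real_asymp
      ultimately show "(\<lambda>n. g n x) \<longlonglongrightarrow> f' x v" unfolding g_def by (rule filterlim_compose)
    qed
    show "AE x in lborel. norm (g n x) \<le> M * indicator (cball 0 (R + norm v)) x" for n
    proof (rule AE_I2)
      fix x
      show "norm (g n x) \<le> M * indicator (cball 0 (R + norm v)) x"
      proof (cases "norm x \<le> R + norm v")
        case True
        obtain z where "0 < z" "z < s n"
          "f (x + s n *\<^sub>R v) - f (x + 0 *\<^sub>R v) = (s n - 0) * f' (x + z *\<^sub>R v) v"
          using MVT2[of 0 "s n" "\<lambda>t. f (x + t *\<^sub>R v)" "\<lambda>t. f' (x + t *\<^sub>R v) v"] line s by blast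
        then have "g n x = f' (x + z *\<^sub>R v) v" using s[of n] by (simp add: g_def)
        then show ?thesis using M True by simp
      next
        case False
        have "norm (s n *\<^sub>R v) \<le> norm v" using s[of n] by (simp add: mult_left_le_one_le)
        then have "R < norm (x + s n *\<^sub>R v)" "R < norm x"
          using False norm_triangle_ineq4[of "x + s n *\<^sub>R v" "s n *\<^sub>R v"] norm_ge_zero[of v]
          by (simp_all only: add_diff_cancel_right')
        then show ?thesis using supp False by (simp add: g_def)
      qed
    qed
  qed (use \<open>integrable lborel (\<lambda>x. f' x v)\<close> f_int trans in \<open>auto simp: g_def[abs_def]\<close>)
  ultimately show "(\<integral>x. f' x v \<partial>lborel) = 0"
    by (simp add: LIMSEQ_const_iff)
qed

section \<open>Locally constant functions\<close>

text \<open>The neighbourhoods are those of the whole space, so constancy is required on a full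
  neighbourhood of each point of \<open>S\<close>. The value type is arbitrary, which admits the map
  from points to components of a complement.\<close>

definition locally_constant_on :: "'a::topological_space set \<Rightarrow> ('a \<Rightarrow> 'b) \<Rightarrow> bool" where
  "locally_constant_on S w \<longleftrightarrow> (\<forall>x\<in>S. \<forall>\<^sub>F y in nhds x. w y = w x)"

lemma locally_constant_on_subset:
  "locally_constant_on S w \<Longrightarrow> T \<subseteq> S \<Longrightarrow> locally_constant_on T w"
  unfolding locally_constant_on_def by blast

lemma locally_constant_on_isCont:
  fixes w :: "'a::t2_space \<Rightarrow> 'b::topological_space"
  assumes "locally_constant_on S w" "x \<in> S"
  shows "isCont w x"
proof -
  have "\<forall>\<^sub>F y in nhds x. w y = w x" using assms by (auto simp: locally_constant_on_def)
  then show ?thesis by (subst isCont_cong[where g="\<lambda>_. w x"]) auto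
qed

lemma locally_constant_on_continuous:
  fixes w :: "'a::t2_space \<Rightarrow> 'b::topological_space"
  shows "locally_constant_on S w \<Longrightarrow> continuous_on S w"
  by (simp add: continuous_at_imp_continuous_on locally_constant_on_isCont)

lemma locally_constant_on_connected:
  assumes w: "locally_constant_on S w" and "connected S" "x \<in> S" "y \<in> S"
  shows "w x = w y"
proof -
  have op: "open {z. \<forall>\<^sub>F y in nhds z. w y = c}" for c
    by (subst open_subopen) (auto simp: eventually_nhds)
  let ?A = "{z. \<forall>\<^sub>F y in nhds z. w y = w x}" and ?B = "\<Union>c\<in>- {w x}. {z. \<forall>\<^sub>F y in nhds z. w y = c}"
  have "y \<in> ?A"
  proof (rule ccontr)
    assume "y \<notin> ?A"
    have *: "w z = c" if "\<forall>\<^sub>F y in nhds z. w y = c" for z c using eventually_nhds_x_imp_x[OF that] .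
    have "S \<subseteq> ?A \<union> ?B"
    proof
      fix z assume "z \<in> S"
      then have "\<forall>\<^sub>F y in nhds z. w y = w z" using w by (auto simp: locally_constant_on_def)
      then show "z \<in> ?A \<union> ?B" by (cases "w z = w x") auto
    qed
    moreover have "?A \<inter> ?B \<inter> S = {}" using * by blast
    moreover have "x \<in> ?A \<inter> S" using w \<open>x \<in> S\<close> by (auto simp: locally_constant_on_def)
    moreover have "y \<in> ?B \<inter> S" using \<open>S \<subseteq> ?A \<union> ?B\<close> \<open>y \<in> S\<close> \<open>y \<notin> ?A\<close> by blast
    moreover have "open ?A" "open ?B" using op by blast+
    ultimately show False using \<open>connected S\<close> unfolding connected_def by blast
  qed
  then show ?thesis using eventually_nhds_x_imp_x by fastforce
qed

lemma AE_locally: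
  fixes \<Omega> :: "'a::euclidean_space set"
  assumes "\<And>x. x \<in> \<Omega> \<Longrightarrow> \<exists>S. open S \<and> x \<in> S \<and> (AE y in lebesgue. y \<in> S \<longrightarrow> P y)"
  shows "AE y in lebesgue. y \<in> \<Omega> \<longrightarrow> P y"
proof -
  define F where "F = {S. open S \<and> (AE y in lebesgue. y \<in> S \<longrightarrow> P y)}"
  obtain F' where F': "F' \<subseteq> F" "countable F'" "\<Union>F' = \<Union>F"
    using Lindelof[of F] unfolding F_def by auto
  have "AE y in lebesgue. \<forall>S\<in>F'. y \<in> S \<longrightarrow> P y"
    using F' by (subst AE_ball_countable) (auto simp: F_def)
  then show ?thesis
  proof eventually_elim
    case (elim y)
    show ?case
    proof
      assume "y \<in> \<Omega>"
      then have "y \<in> \<Union>F" using assms unfolding F_def by blast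
      then show "P y" using elim F'(3) by blast
    qed
  qed
qed

lemma set_integrable_lebesgue_compact:
  fixes f :: "'a::euclidean_space \<Rightarrow> 'b::{banach, second_countable_topology}"
  assumes "compact C" "continuous_on C f"
  shows "set_integrable lebesgue C f"
  using borel_integrable_compact[OF assms] by (simp add: set_integrable_def integrable_completion)

lemma set_integrable_lebesgue_mult_continuous:
  fixes u \<phi> :: "'a::euclidean_space \<Rightarrow> real"
  assumes u: "set_integrable lebesgue C u" and "compact C" and \<phi>: "continuous_on UNIV \<phi>"
  shows "set_integrable lebesgue C (\<lambda>x. u x * \<phi> x)"
proof -
  have "bounded (\<phi> ` C)"
    by (intro compact_imp_bounded compact_continuous_image continuous_on_subset[OF \<phi>] assms) auto
  then obtain M where M: "\<And>x. x \<in> C \<Longrightarrow> \<bar>\<phi> x\<bar> \<le> M" unfolding bounded_iff by fastforce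
  have m: "\<phi> \<in> borel_measurable lebesgue"
    using borel_measurable_continuous_onI[OF \<phi>] by (auto intro: measurable_completion)
  have "integrable lebesgue (\<lambda>x. (indicator C x *\<^sub>R u x) * \<phi> x)"
  proof (rule Bochner_Integration.integrable_bound[where f="\<lambda>x. M *\<^sub>R (indicator C x *\<^sub>R u x)"])
    show "integrable lebesgue (\<lambda>x. M *\<^sub>R (indicator C x *\<^sub>R u x))"
      using u unfolding set_integrable_def by (rule integrable_scaleR_right)
    show "(\<lambda>x. (indicator C x *\<^sub>R u x) * \<phi> x) \<in> borel_measurable lebesgue"
      using u m unfolding set_integrable_def by (intro borel_measurable_times) auto
    show "AE x in lebesgue. norm ((indicator C x *\<^sub>R u x) * \<phi> x) \<le> norm (M *\<^sub>R (indicator C x *\<^sub>R u x))"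
    proof (rule AE_I2)
      fix x
      show "norm ((indicator C x *\<^sub>R u x) * \<phi> x) \<le> norm (M *\<^sub>R (indicator C x *\<^sub>R u x))"
        using M[of x] by (cases "x \<in> C") (auto simp: abs_mult mult.commute intro!: mult_right_mono order_trans[OF M abs_ge_self])
    qed
  qed
  then show ?thesis by (simp add: set_integrable_def mult_ac)
qed

section \<open>Vanishing weak gradients\<close>

lemma test_function_frechet:
  assumes "test_function \<Omega> \<phi>"
  shows "(\<phi> has_derivative frechet_derivative \<phi> (at x)) (at x)"
    "continuous_on UNIV (\<lambda>x. frechet_derivative \<phi> (at x) v)"
proof -
  have "Ck (Suc 0) \<phi>" using assms by (simp only: test_function_def)
  then show "(\<phi> has_derivative frechet_derivative \<phi> (at x)) (at x)"
    "continuous_on UNIV (\<lambda>x. frechet_derivative \<phi> (at x) v)"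
    by (auto simp: frechet_derivative_works)
qed

text \<open>The product \<open>w * \<phi>\<close>, extended by zero, is continuously differentiable
  with compact support, and its derivative is \<open>w\<close> times that of
  \<open>\<phi>\<close>.\<close>

lemma integral_locally_constant_test_derivative:
  assumes "open \<Omega>" and w: "locally_constant_on \<Omega> w" and \<phi>: "test_function \<Omega> \<phi>"
  shows "(LINT x:\<Omega>|lebesgue. w x * frechet_derivative \<phi> (at x) v) = 0"
proof -
  define \<psi> where "\<psi> x = (if x \<in> \<Omega> then w x * \<phi> x else 0)" for x
  define S where "S = closure {x. \<phi> x \<noteq> 0}"
  have S: "compact S" "S \<subseteq> \<Omega>" "closed S" using \<phi> by (auto simp: test_function_def S_def)
  define c where "c x = (if x \<in> \<Omega> then w x else 0)" for x
  have loc: "\<forall>\<^sub>F y in nhds x. \<psi> y = c x * \<phi> y" for x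
  proof (cases "x \<in> \<Omega>")
    case True
    then have "\<forall>\<^sub>F y in nhds x. w y = w x \<and> y \<in> \<Omega>"
      using w eventually_nhds_in_open[OF \<open>open \<Omega>\<close> True]
      by (auto simp: locally_constant_on_def eventually_conj_iff)
    then show ?thesis by eventually_elim (auto simp: \<psi>_def c_def True)
  next
    case False
    then have "x \<in> - S" using S by blast
    then have "\<forall>\<^sub>F y in nhds x. y \<in> - S" using S by (intro eventually_nhds_in_open) auto
    then show ?thesis
    proof eventually_elim
      case (elim y)
      then have "\<phi> y = 0" using closure_subset[of "{x. \<phi> x \<noteq> 0}"] by (auto simp: S_def)
      then show ?case by (simp add: \<psi>_def)
    qed
  qed
  have D: "(\<psi> has_derivative (\<lambda>v. c x * frechet_derivative \<phi> (at x) v)) (at x)" for x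
  proof -
    obtain T where T: "open T" "x \<in> T" "\<And>y. y \<in> T \<Longrightarrow> \<psi> y = c x * \<phi> y"
      using loc[of x] unfolding eventually_nhds by blast
    show ?thesis
      by (rule has_derivative_transform_within_open[OF has_derivative_mult_right[OF test_function_frechet(1)[OF \<phi>]] T(1,2)])
        (simp add: T(3))
  qed
  \<comment> \<open>\<open>c\<close> itself may jump at the boundary of \<open>\<Omega>\<close>. The
    product is continuous because near \<open>x\<close> it is the fixed multiple \<open>c x\<close>
    of the derivative of \<open>\<phi>\<close>, by uniqueness of derivatives.\<close>
  have "isCont (\<lambda>x. c x * frechet_derivative \<phi> (at x) v) x" for x
  proof -
    obtain T where T: "open T" "x \<in> T" "\<And>y. y \<in> T \<Longrightarrow> \<psi> y = c x * \<phi> y"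
      using loc[of x] unfolding eventually_nhds by blast
    have "c y * frechet_derivative \<phi> (at y) v = c x * frechet_derivative \<phi> (at y) v" if "y \<in> T" for y
    proof -
      have "(\<psi> has_derivative (\<lambda>v. c x * frechet_derivative \<phi> (at y) v)) (at y)"
        by (rule has_derivative_transform_within_open[OF has_derivative_mult_right[OF test_function_frechet(1)[OF \<phi>]] T(1) that])
          (simp add: T(3))
      from has_derivative_unique[OF this D] show ?thesis by metis
    qed
    then have "\<forall>\<^sub>F y in nhds x. c y * frechet_derivative \<phi> (at y) v = c x * frechet_derivative \<phi> (at y) v"
      using T unfolding eventually_nhds by blast
    moreover have "isCont (\<lambda>y. c x * frechet_derivative \<phi> (at y) v) x"
      using test_function_frechet(2)[OF \<phi>, of v]
      by (intro continuous_intros) (simp add: continuous_on_eq_continuous_at)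
    ultimately show ?thesis by (subst isCont_cong) auto
  qed
  then have cont: "continuous_on UNIV (\<lambda>x. c x * frechet_derivative \<phi> (at x) v)"
    by (simp add: continuous_at_imp_continuous_on)
  obtain R where R: "\<And>x. x \<in> S \<Longrightarrow> norm x \<le> R"
    using compact_imp_bounded[OF S(1)] unfolding bounded_iff by blast
  have supp: "\<psi> x = 0" if "R < norm x" for x
    using R[of x] that closure_subset[of "{x. \<phi> x \<noteq> 0}"] by (auto simp: \<psi>_def S_def)
  have "(LINT x:\<Omega>|lebesgue. w x * frechet_derivative \<phi> (at x) v) =
      (\<integral>x. c x * frechet_derivative \<phi> (at x) v \<partial>lebesgue)"
    unfolding set_lebesgue_integral_def by (rule Bochner_Integration.integral_cong) (auto simp: c_def)
  also have "\<dots> = (\<integral>x. c x * frechet_derivative \<phi> (at x) v \<partial>lborel)"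
    using cont by (intro integral_completion) (simp add: borel_measurable_continuous_onI)
  also have "\<dots> = 0" by (rule integral_directional_derivative_zero(2)[OF D cont supp])
  finally show ?thesis .
qed

lemma weak_gradient_locally_constant:
  assumes "open \<Omega>" "locally_constant_on \<Omega> w"
  shows "weak_gradient \<Omega> w (\<lambda>_. 0)"
  unfolding weak_gradient_def
  using assms integral_locally_constant_test_derivative[OF assms]
  by (auto simp: set_lebesgue_integral_def intro!: set_integrable_lebesgue_compact
      intro: continuous_on_subset[OF locally_constant_on_continuous])

lemma lebesgue_set_integral_tensor:
  fixes f :: "plane \<Rightarrow> real"
  assumes "\<And>t. t \<notin> {a $ 1..b $ 1} \<Longrightarrow> \<alpha> t = 0" "\<And>t. t \<notin> {a $ 2..b $ 2} \<Longrightarrow> \<beta> t = 0"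
    and "cbox a b \<subseteq> \<Omega>"
  shows "(LINT x:\<Omega>|lebesgue. f x * tensor \<alpha> \<beta> x) = (LINT x:cbox a b|lebesgue. f x * tensor \<alpha> \<beta> x)"
proof -
  have "tensor \<alpha> \<beta> x = 0" if "x \<notin> cbox a b" for x
    using that assms(1,2) by (auto simp: tensor_def mem_box_cart forall_2)
  then show ?thesis
    using assms(3) unfolding set_lebesgue_integral_def
    by (intro Bochner_Integration.integral_cong) (auto simp: indicator_def)
qed

text \<open>\<open>wgrad\<close> is a weak gradient picked by choice, so the vanishing of the
  Dirichlet energy rests on a statement about every weak gradient.\<close>

lemma weak_gradient_locally_constant_AE_zero:
  assumes "open \<Omega>" "locally_constant_on \<Omega> w" and g: "weak_gradient \<Omega> w g"
  shows "AE x in lebesgue. x \<in> \<Omega> \<longrightarrow> g x = 0"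
proof (rule AE_locally)
  fix x assume "x \<in> \<Omega>"
  then obtain a b where ab: "cbox a b \<subseteq> \<Omega>" "x \<in> box a b" using open_contains_cbox[OF \<open>open \<Omega>\<close>] by metis
  have "AE x in lebesgue. x \<in> cbox a b \<longrightarrow> g x $ i = 0" for i
  proof (rule fundamental_lemma_box)
    have "set_integrable lebesgue (cbox a b) g" using g ab by (auto simp: weak_gradient_def)
    from integrable_bounded_linear[OF bounded_linear_vec_nth this[unfolded set_integrable_def], of i]
    show "set_integrable lebesgue (cbox a b) (\<lambda>x. g x $ i)" by (simp add: set_integrable_def)
    fix \<alpha> \<beta> assume bump: "bump_fun (a $ 1) (b $ 1) \<alpha>" "bump_fun (a $ 2) (b $ 2) \<beta>"
    then have t: "test_function \<Omega> (tensor \<alpha> \<beta>)" using ab by (intro test_function_tensor)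
    then have "(LINT x:\<Omega>|lebesgue. g x $ i * tensor \<alpha> \<beta> x) = 0"
      using g integral_locally_constant_test_derivative[OF assms(1,2) t, of "axis i 1"]
      by (simp add: weak_gradient_def)
    then show "(LINT x:cbox a b|lebesgue. g x $ i * tensor \<alpha> \<beta> x) = 0"
      using lebesgue_set_integral_tensor[of a b \<alpha> \<beta> \<Omega> "\<lambda>x. g x $ i"] bump ab
      by (simp add: bump_fun_def)
  qed
  then have "AE x in lebesgue. \<forall>i. x \<in> cbox a b \<longrightarrow> g x $ i = 0"
    unfolding AE_all_countable by blast
  then have "AE x in lebesgue. x \<in> box a b \<longrightarrow> g x = 0"
    by eventually_elim (use box_subset_cbox[of a b] in \<open>auto simp: vec_eq_iff\<close>)
  then show "\<exists>S. open S \<and> x \<in> S \<and> (AE y in lebesgue. y \<in> S \<longrightarrow> g y = 0)"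
    using ab(2) open_box by blast
qed

text \<open>A bilinear functional that kills derivatives of bumps in either variable is determined
  by one value: modulo such derivatives \<open>\<alpha>\<close> is
  \<open>I1 \<alpha> * \<eta>1\<close> and \<open>\<beta>\<close> is
  \<open>I2 \<beta> * \<eta>2\<close>.\<close>

lemma tensor_integral_factorization:
  fixes T :: "(real \<Rightarrow> real) \<Rightarrow> (real \<Rightarrow> real) \<Rightarrow> real"
  assumes \<eta>1: "bump_fun a1 b1 \<eta>1"
    and prim1: "\<And>\<alpha>. bump_fun a1 b1 \<alpha> \<Longrightarrow>
      \<exists>A. bump_fun a1 b1 A \<and> (\<forall>t. (A has_real_derivative \<alpha> t - I1 \<alpha> * \<eta>1 t) (at t))"
    and \<eta>2: "bump_fun a2 b2 \<eta>2"
    and prim2: "\<And>\<beta>. bump_fun a2 b2 \<beta> \<Longrightarrow>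
      \<exists>B. bump_fun a2 b2 B \<and> (\<forall>t. (B has_real_derivative \<beta> t - I2 \<beta> * \<eta>2 t) (at t))"
    and lin1: "\<And>\<alpha> \<beta> c. bump_fun a1 b1 \<alpha> \<Longrightarrow> bump_fun a2 b2 \<beta> \<Longrightarrow>
      T (\<lambda>t. \<alpha> t - c * \<eta>1 t) \<beta> = T \<alpha> \<beta> - c * T \<eta>1 \<beta>"
    and lin2: "\<And>\<alpha> \<beta> c. bump_fun a1 b1 \<alpha> \<Longrightarrow> bump_fun a2 b2 \<beta> \<Longrightarrow>
      T \<alpha> (\<lambda>t. \<beta> t - c * \<eta>2 t) = T \<alpha> \<beta> - c * T \<alpha> \<eta>2"
    and zero1: "\<And>A \<gamma> \<beta>. bump_fun a1 b1 A \<Longrightarrow> (\<And>t. (A has_real_derivative \<gamma> t) (at t)) \<Longrightarrow>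
      bump_fun a2 b2 \<beta> \<Longrightarrow> T \<gamma> \<beta> = 0"
    and zero2: "\<And>\<alpha> B \<gamma>. bump_fun a1 b1 \<alpha> \<Longrightarrow> bump_fun a2 b2 B \<Longrightarrow>
      (\<And>t. (B has_real_derivative \<gamma> t) (at t)) \<Longrightarrow> T \<alpha> \<gamma> = 0"
    and \<alpha>: "bump_fun a1 b1 \<alpha>" and \<beta>: "bump_fun a2 b2 \<beta>"
  shows "T \<alpha> \<beta> = I1 \<alpha> * I2 \<beta> * T \<eta>1 \<eta>2"
proof -
  obtain A where A: "bump_fun a1 b1 A" "\<And>t. (A has_real_derivative \<alpha> t - I1 \<alpha> * \<eta>1 t) (at t)"
    using prim1[OF \<alpha>] by blast
  obtain B where B: "bump_fun a2 b2 B" "\<And>t. (B has_real_derivative \<beta> t - I2 \<beta> * \<eta>2 t) (at t)"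
    using prim2[OF \<beta>] by blast
  have "T \<alpha> \<beta> = I1 \<alpha> * T \<eta>1 \<beta>" using zero1[OF A \<beta>] lin1[OF \<alpha> \<beta>] by simp
  also have "T \<eta>1 \<beta> = I2 \<beta> * T \<eta>1 \<eta>2" using zero2[OF \<eta>1 B] lin2[OF \<eta>1 \<beta>] by simp
  finally show ?thesis by simp
qed

text \<open>Both \<open>u\<close> and the constant 1 give functionals of the kind treated in
  \<open>tensor_integral_factorization\<close>, so their integrals against product bumps are
  proportional. Hence \<open>u - U / W\<close> is orthogonal to all product bumps.\<close>

lemma weak_gradient_zero_AE_const_box:
  assumes wg: "weak_gradient \<Omega> u g" and g: "AE x in lebesgue. x \<in> \<Omega> \<longrightarrow> g x = 0"
    and "open \<Omega>" and ab: "cbox a b \<subseteq> \<Omega>" "box a b \<noteq> {}"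
  shows "\<exists>c. AE x in lebesgue. x \<in> cbox a b \<longrightarrow> u x = c"
proof -
  have lt: "a $ 1 < b $ 1" "a $ 2 < b $ 2"
    using ab(2) by (auto simp: ex_in_conv[symmetric] mem_box_cart forall_2)
  obtain \<eta>1 I1 where \<eta>1: "bump_fun (a $ 1) (b $ 1) \<eta>1" "\<And>\<alpha>. bump_fun (a $ 1) (b $ 1) \<alpha> \<Longrightarrow>
      \<exists>A. bump_fun (a $ 1) (b $ 1) A \<and> (\<forall>t. (A has_real_derivative \<alpha> t - I1 \<alpha> * \<eta>1 t) (at t))"
    using bump_fun_primitive[OF lt(1)] by metis
  obtain \<eta>2 I2 where \<eta>2: "bump_fun (a $ 2) (b $ 2) \<eta>2" "\<And>\<alpha>. bump_fun (a $ 2) (b $ 2) \<alpha> \<Longrightarrow>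
      \<exists>A. bump_fun (a $ 2) (b $ 2) A \<and> (\<forall>t. (A has_real_derivative \<alpha> t - I2 \<alpha> * \<eta>2 t) (at t))"
    using bump_fun_primitive[OF lt(2)] by metis
  have cont: "continuous_on UNIV (tensor \<alpha> \<beta>)"
    if "bump_fun (a $ 1) (b $ 1) \<alpha>" "bump_fun (a $ 2) (b $ 2) \<beta>" for \<alpha> \<beta>
    using Ck_tensor[of \<alpha> \<beta> 0] that by (simp add: bump_fun_def)
  have fact: "(LINT x:cbox a b|lebesgue. v x * tensor \<alpha> \<beta> x) =
      I1 \<alpha> * I2 \<beta> * (LINT x:cbox a b|lebesgue. v x * tensor \<eta>1 \<eta>2 x)"
    if int: "set_integrable lebesgue (cbox a b) v"
      and zero: "\<And>\<phi> i. test_function \<Omega> \<phi> \<Longrightarrow>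
        (LINT x:\<Omega>|lebesgue. v x * frechet_derivative \<phi> (at x) (axis i 1)) = 0"
      and bump: "bump_fun (a $ 1) (b $ 1) \<alpha>" "bump_fun (a $ 2) (b $ 2) \<beta>" for v \<alpha> \<beta>
  proof (rule tensor_integral_factorization[OF \<eta>1 \<eta>2 _ _ _ _ bump])
    note int' = set_integrable_lebesgue_mult_continuous[OF int compact_cbox cont]
    have tens1: "v x * tensor (\<lambda>t. \<alpha> t - c * \<eta>1 t) \<beta> x = v x * tensor \<alpha> \<beta> x - c * (v x * tensor \<eta>1 \<beta> x)"
      and tens2: "v x * tensor \<alpha> (\<lambda>t. \<beta> t - c * \<eta>2 t) x = v x * tensor \<alpha> \<beta> x - c * (v x * tensor \<alpha> \<eta>2 x)"
      for \<alpha> \<beta> c x by (simp_all add: tensor_def algebra_simps)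
    show "(LINT x:cbox a b|lebesgue. v x * tensor (\<lambda>t. \<alpha> t - c * \<eta>1 t) \<beta> x) =
        (LINT x:cbox a b|lebesgue. v x * tensor \<alpha> \<beta> x) - c * (LINT x:cbox a b|lebesgue. v x * tensor \<eta>1 \<beta> x)"
      if "bump_fun (a $ 1) (b $ 1) \<alpha>" "bump_fun (a $ 2) (b $ 2) \<beta>" for \<alpha> \<beta> c
      unfolding tens1 using int'[OF that] int'[OF \<eta>1(1) that(2)]
      by (subst set_integral_diff(2)) auto
    show "(LINT x:cbox a b|lebesgue. v x * tensor \<alpha> (\<lambda>t. \<beta> t - c * \<eta>2 t) x) =
        (LINT x:cbox a b|lebesgue. v x * tensor \<alpha> \<beta> x) - c * (LINT x:cbox a b|lebesgue. v x * tensor \<alpha> \<eta>2 x)"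
      if "bump_fun (a $ 1) (b $ 1) \<alpha>" "bump_fun (a $ 2) (b $ 2) \<beta>" for \<alpha> \<beta> c
      unfolding tens2 using int'[OF that] int'[OF that(1) \<eta>2(1)]
      by (subst set_integral_diff(2)) auto
    have deriv_supp: "\<gamma> t = 0" if A: "bump_fun p q A" and D: "\<And>t. (A has_real_derivative \<gamma> t) (at t)"
      and t: "t \<notin> {p..q}" for A \<gamma> p q t
    proof -
      have "open (- {p..q})" by (simp add: open_Compl)
      then have "(A has_derivative (\<lambda>_. 0)) (at t)"
        by (rule has_derivative_transform_within_open[OF has_derivative_const[of 0]])
          (use A t in \<open>auto simp: bump_fun_def\<close>)
      then have "(A has_real_derivative 0) (at t)"
        by (simp add: has_field_derivative_def lambda_zero)
      then show ?thesis by (rule DERIV_unique[OF D])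
    qed
    show "(LINT x:cbox a b|lebesgue. v x * tensor \<gamma> \<beta> x) = 0"
      if A: "bump_fun (a $ 1) (b $ 1) A" and D: "\<And>t. (A has_real_derivative \<gamma> t) (at t)"
        and \<beta>: "bump_fun (a $ 2) (b $ 2) \<beta>" for A \<gamma> \<beta>
    proof -
      obtain \<beta>' where \<beta>': "\<And>t. (\<beta> has_real_derivative \<beta>' t) (at t)"
        using \<beta> smooth_obtain_deriv unfolding bump_fun_def by blast
      have "test_function \<Omega> (tensor A \<beta>)" using A \<beta> ab by (intro test_function_tensor)
      from zero[OF this, of 1] have "(LINT x:\<Omega>|lebesgue. v x * tensor \<gamma> \<beta> x) = 0"
        by (simp add: frechet_derivative_at[OF tensor_has_derivative[OF D \<beta>'], symmetric] axis_def)
      then show ?thesis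
        using lebesgue_set_integral_tensor[of a b \<gamma> \<beta> \<Omega> v] deriv_supp[OF A D] \<beta> ab
        by (simp add: bump_fun_def)
    qed
    show "(LINT x:cbox a b|lebesgue. v x * tensor \<alpha> \<gamma> x) = 0"
      if \<alpha>: "bump_fun (a $ 1) (b $ 1) \<alpha>" and B: "bump_fun (a $ 2) (b $ 2) B"
        and D: "\<And>t. (B has_real_derivative \<gamma> t) (at t)" for \<alpha> B \<gamma>
    proof -
      obtain \<alpha>' where \<alpha>': "\<And>t. (\<alpha> has_real_derivative \<alpha>' t) (at t)"
        using \<alpha> smooth_obtain_deriv unfolding bump_fun_def by blast
      have "test_function \<Omega> (tensor \<alpha> B)" using \<alpha> B ab by (intro test_function_tensor)
      from zero[OF this, of 2] have "(LINT x:\<Omega>|lebesgue. v x * tensor \<alpha> \<gamma> x) = 0"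
        by (simp add: frechet_derivative_at[OF tensor_has_derivative[OF \<alpha>' D], symmetric] axis_def)
      then show ?thesis
        using lebesgue_set_integral_tensor[of a b \<alpha> \<gamma> \<Omega> v] deriv_supp[OF B D] \<alpha> ab
        by (simp add: bump_fun_def)
    qed
  qed
  have int_u: "set_integrable lebesgue (cbox a b) u" using wg ab by (auto simp: weak_gradient_def)
  have zero_u: "(LINT x:\<Omega>|lebesgue. u x * frechet_derivative \<phi> (at x) (axis i 1)) = 0"
    if "test_function \<Omega> \<phi>" for \<phi> i
  proof -
    have "(LINT x:\<Omega>|lebesgue. (g x $ i) * \<phi> x) = 0"
      unfolding set_lebesgue_integral_def
      by (rule integral_eq_zero_AE) (use g in eventually_elim, auto simp: indicator_def)
    then show ?thesis using wg that by (simp add: weak_gradient_def)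
  qed
  have int_1: "set_integrable lebesgue (cbox a b) (\<lambda>_. 1 :: real)"
    by (intro set_integrable_lebesgue_compact) auto
  have zero_1: "(LINT x:\<Omega>|lebesgue. 1 * frechet_derivative \<phi> (at x) (axis i 1)) = 0"
    if "test_function \<Omega> \<phi>" for \<phi> i
    by (rule integral_locally_constant_test_derivative[OF \<open>open \<Omega>\<close> _ that])
      (simp add: locally_constant_on_def)
  define U where "U = (LINT x:cbox a b|lebesgue. u x * tensor \<eta>1 \<eta>2 x)"
  define W where "W = (LINT x:cbox a b|lebesgue. 1 * tensor \<eta>1 \<eta>2 x)"
  \<comment> \<open>Otherwise 1 would be orthogonal to every product bump, and the fundamental lemma
    would make the box negligible.\<close>
  have "W \<noteq> 0"
  proof
    assume "W = 0"
    then have "AE x in lebesgue. x \<in> cbox a b \<longrightarrow> (1::real) = 0"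
      using fact[OF int_1 zero_1] int_1 by (intro fundamental_lemma_box) (auto simp: W_def)
    then have "AE x in lebesgue. x \<notin> cbox a b" by simp
    then have "negligible (cbox a b)"
      by (simp add: negligible_iff_null_sets AE_iff_null_sets)
    then show False using ab(2) negligible_interval(1) by blast
  qed
  have "AE x in lebesgue. x \<in> cbox a b \<longrightarrow> u x - U / W = 0"
  proof (rule fundamental_lemma_box)
    show "set_integrable lebesgue (cbox a b) (\<lambda>x. u x - U / W)"
      by (intro set_integral_diff(1)[OF int_u] set_integrable_lebesgue_compact) auto
    fix \<alpha> \<beta> assume bump: "bump_fun (a $ 1) (b $ 1) \<alpha>" "bump_fun (a $ 2) (b $ 2) \<beta>"
    have "(LINT x:cbox a b|lebesgue. (u x - U / W) * tensor \<alpha> \<beta> x) =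
        (LINT x:cbox a b|lebesgue. u x * tensor \<alpha> \<beta> x - (U / W) * (1 * tensor \<alpha> \<beta> x))"
      by (simp add: algebra_simps)
    also have "\<dots> = (LINT x:cbox a b|lebesgue. u x * tensor \<alpha> \<beta> x) -
        (U / W) * (LINT x:cbox a b|lebesgue. 1 * tensor \<alpha> \<beta> x)"
      using set_integrable_lebesgue_mult_continuous[OF int_u compact_cbox cont[OF bump]]
        set_integrable_lebesgue_mult_continuous[OF int_1 compact_cbox cont[OF bump]]
      by (subst set_integral_diff(2)) auto
    also have "\<dots> = I1 \<alpha> * I2 \<beta> * U - (U / W) * (I1 \<alpha> * I2 \<beta> * W)"
      using fact[OF int_u zero_u bump] fact[OF int_1 zero_1 bump] by (simp add: U_def W_def)
    also have "\<dots> = 0" using \<open>W \<noteq> 0\<close> by simp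
    finally show "(LINT x:cbox a b|lebesgue. (u x - U / W) * tensor \<alpha> \<beta> x) = 0" .
  qed
  then show ?thesis by auto
qed

section \<open>Pairs with locally constant functions\<close>

lemma dist_add_axis: "dist x (x + axis 2 t) = \<bar>t :: real\<bar>" for x :: plane
  by (simp add: dist_norm norm_vec_def L2_set_def sum_2 axis_def)

lemma upper_half_plane:
  assumes U: "U = {x :: plane. 0 < x $ 2}"
  shows "open U" "closure U = {x. 0 \<le> x $ 2}" "frontier U = {x. x $ 2 = 0}"
proof -
  show o: "open U" unfolding U by (rule open_halfspace_component_gt_cart)
  show c: "closure U = {x. 0 \<le> x $ 2}" unfolding U using closure_halfspace_component_gt[of 0 2] by simp
  show "frontier U = {x. x $ 2 = 0}"
    unfolding frontier_def c interior_open[OF o] by (auto simp: U)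
qed

lemma dirichlet_locally_constant:
  assumes "open (U - J)" "locally_constant_on (U - J) w"
  shows "dirichlet U J w V = 0"
proof -
  have "weak_gradient (U - J) w (wgrad (U - J) w)"
    unfolding wgrad_def
    by (rule someI[where P="weak_gradient (U - J) w"]) (rule weak_gradient_locally_constant[OF assms])
  then have "AE x in lebesgue. x \<in> U - J \<longrightarrow> wgrad (U - J) w x = 0"
    by (rule weak_gradient_locally_constant_AE_zero[OF assms])
  then have "dirichlet U J w V = (\<integral>\<^sup>+x. 0 \<partial>(lebesgue :: plane measure))"
    unfolding dirichlet_def
    by (intro nn_integral_cong_AE) (auto elim!: eventually_mono simp: indicator_def)
  then show ?thesis by simp
qed

text \<open>The trace condition holds because a boundary point off \<open>J\<close> has a full ball
  on which \<open>w\<close> is constant, and this ball reaches into the lower half-plane, where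
  \<open>w\<close> vanishes.\<close>

lemma adm_pair_locally_constant:
  assumes U: "U = {x :: plane. 0 < x $ 2}" and J: "closed J" "J \<subseteq> closure U"
    and w: "locally_constant_on (- J) w" and low: "\<And>x. x $ 2 < 0 \<Longrightarrow> w x = 0"
  shows "adm_pair U J w"
  unfolding adm_pair_def
proof (intro conjI J)
  have op: "open (U - J)" using upper_half_plane(1)[OF U] J(1) by (rule open_Diff)
  have wU: "locally_constant_on (U - J) w" by (rule locally_constant_on_subset[OF w]) auto
  show "W12_loc U J w"
    unfolding W12_loc_def
  proof (intro exI[of _ "\<lambda>_. 0"] conjI allI impI weak_gradient_locally_constant op wU)
    fix C assume C: "compact C \<and> C \<subseteq> closure U - J"
    have "continuous_on C w"
      using C by (intro continuous_on_subset[OF locally_constant_on_continuous[OF w]]) auto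
    then have "set_integrable lebesgue C (\<lambda>x. (w x)\<^sup>2)"
      using C by (intro set_integrable_lebesgue_compact continuous_intros) auto
    then show "set_integrable lebesgue (C \<inter> U) (\<lambda>x. (w x)\<^sup>2)"
      by (rule set_integrable_subset)
        (use C upper_half_plane(1)[OF U] in \<open>auto intro!: sets.Int dest: compact_imp_closed\<close>)
  qed (auto simp: set_integrable_def)
  show "zero_trace U J w"
    unfolding zero_trace_def
  proof (intro exI[of _ "{}"] conjI ballI)
    fix x assume x: "x \<in> frontier U - J - {}"
    then have x2: "x $ 2 = 0" "x \<in> - J" using upper_half_plane(3)[OF U] by auto
    then obtain S where S: "open S" "x \<in> S" "\<And>y. y \<in> S \<Longrightarrow> w y = w x"
      using w unfolding locally_constant_on_def eventually_nhds by metis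
    then obtain e where e: "0 < e" "ball x e \<subseteq> S" by (auto simp: open_contains_ball)
    have "x + axis 2 (- (e / 2)) \<in> ball x e" using e by (simp add: dist_add_axis)
    then have "w (x + axis 2 (- (e / 2))) = w x" using S e by blast
    then have wx: "w x = 0" using low[of "x + axis 2 (- (e / 2))"] x2 e by (simp add: axis_def)
    show "has_trace_at (U - J) w x 0"
      unfolding has_trace_at_def
    proof (rule Lim_transform_eventually[OF tendsto_const])
      show "\<forall>\<^sub>F r in at_right 0. 0 = (\<integral>\<^sup>+y\<in>ball x r \<inter> (U - J). ennreal \<bar>w y - 0\<bar> \<partial>lebesgue) /
          emeasure lebesgue (ball x r \<inter> (U - J))"
        unfolding eventually_at_right_field
      proof (intro exI[of _ e] conjI allI impI)
        fix r assume r: "0 < r" "r < e"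
        have "(\<integral>\<^sup>+y\<in>ball x r \<inter> (U - J). ennreal \<bar>w y - 0\<bar> \<partial>lebesgue) = (\<integral>\<^sup>+y. 0 \<partial>(lebesgue :: plane measure))"
        proof (rule nn_integral_cong)
          fix y
          show "ennreal \<bar>w y - 0\<bar> * indicator (ball x r \<inter> (U - J)) y = 0"
          proof (cases "y \<in> ball x r")
            case True
            then have "y \<in> S" using r e by (auto simp: subset_eq)
            then show ?thesis using S(3) wx by simp
          qed simp
        qed
        then show "0 = (\<integral>\<^sup>+y\<in>ball x r \<inter> (U - J). ennreal \<bar>w y - 0\<bar> \<partial>lebesgue) /
          emeasure lebesgue (ball x r \<inter> (U - J))" by simp
      qed (use e in auto)
    qed
  qed simp
qed

lemma AE_const_unique:
  fixes S :: "'a::euclidean_space set"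
  assumes "open S" "S \<noteq> {}" "AE y in lebesgue. y \<in> S \<longrightarrow> u y = c" "AE y in lebesgue. y \<in> S \<longrightarrow> u y = d"
  shows "c = d"
proof (rule ccontr)
  assume "c \<noteq> d"
  have "AE y in lebesgue. y \<notin> S" using assms(3,4) by eventually_elim (use \<open>c \<noteq> d\<close> in auto)
  then have "negligible S"
    using assms(1) by (simp add: negligible_iff_null_sets AE_iff_null_sets)
  then show False using open_not_negligible assms by blast
qed

text \<open>Guarantees that the exceptional set of the trace condition, having length zero, contains
  no segment of the boundary line.\<close>

lemma hausdorff1_horizontal_pos:
  assumes "0 < e"
  shows "0 < hausdorff1 {z :: plane. z $ 2 = h \<and> a < z $ 1 \<and> z $ 1 < a + e}"
proof -
  let ?S = "{z :: plane. z $ 2 = h \<and> a < z $ 1 \<and> z $ 1 < a + e}"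
  have "ennreal (real 1 * (a + e - a)) \<le> hausdorff1 ?S"
  proof (rule hausdorff1_slices[where f="\<lambda>z. z $ 1"])
    have "?S = {z. z $ 2 = h} \<inter> {z. a < z $ 1} \<inter> {z. z $ 1 < a + e}" by auto
    moreover have "closed {z :: plane. z $ 2 = h}"
      by (intro closed_Collect_eq continuous_intros)
    ultimately show "?S \<in> sets borel"
      using open_halfspace_component_gt_cart[of a 1] open_halfspace_component_lt_cart[of 1 "a + e"] by auto
    show "dist (x $ 1) (y $ 1) \<le> dist x y" for x y :: plane
      using component_le_norm_cart[of "x - y" 1] by (simp add: dist_norm)
    fix r assume "a < r" "r < a + e"
    then show "\<exists>F\<subseteq>?S. (\<lambda>z. z $ 1) ` F \<subseteq> {r} \<and> finite F \<and> card F = 1"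
      by (intro exI[of _ "{vector [r, h]}"]) auto
  qed (use assms in auto)
  then have "ennreal e \<le> hausdorff1 ?S" by simp
  moreover have "0 < ennreal e" using assms by simp
  ultimately show ?thesis by (rule less_le_trans[rotated])
qed

lemma has_trace_at_const:
  assumes U: "U = {x :: plane. 0 < x $ 2}" and y: "y $ 2 = 0" and "0 < e"
    and ball: "ball y e \<inter> K = {}" and u: "AE z in lebesgue. z \<in> ball y e \<inter> U \<longrightarrow> u z = c"
    and trace: "has_trace_at (U - K) u y 0"
  shows "c = 0"
proof -
  have "((\<lambda>r. (\<integral>\<^sup>+z\<in>ball y r \<inter> (U - K). ennreal \<bar>u z - 0\<bar> \<partial>lebesgue) / emeasure lebesgue (ball y r \<inter> (U - K)))
      \<longlongrightarrow> ennreal \<bar>c\<bar>) (at_right 0)"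
  proof (rule Lim_transform_eventually[OF tendsto_const])
    show "\<forall>\<^sub>F r in at_right 0. ennreal \<bar>c\<bar> = (\<integral>\<^sup>+z\<in>ball y r \<inter> (U - K). ennreal \<bar>u z - 0\<bar> \<partial>lebesgue) /
        emeasure lebesgue (ball y r \<inter> (U - K))"
      unfolding eventually_at_right_field
    proof (intro exI[of _ e] conjI allI impI)
      fix r assume r: "0 < r" "r < e"
      let ?B = "ball y r \<inter> U"
      have B: "ball y r \<inter> (U - K) = ?B" using ball r by force
      have "open ?B" using upper_half_plane(1)[OF U] by auto
      moreover have "y + axis 2 (r / 2) \<in> ?B" using r y dist_add_axis[of y "r / 2"] by (auto simp: U axis_def)
      ultimately have "\<not> negligible ?B" using open_not_negligible by blast
      then have pos: "emeasure lebesgue ?B \<noteq> 0"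
        using \<open>open ?B\<close> by (auto simp: negligible_iff_null_sets null_sets_def)
      have "emeasure lebesgue ?B = emeasure lborel ?B" using \<open>open ?B\<close> by simp
      also have "\<dots> < \<infinity>" by (rule emeasure_bounded_finite) (auto intro: bounded_Int)
      finally have fin: "emeasure lebesgue ?B < \<infinity>" .
      have "(\<integral>\<^sup>+z\<in>?B. ennreal \<bar>u z - 0\<bar> \<partial>lebesgue) = (\<integral>\<^sup>+z\<in>?B. ennreal \<bar>c\<bar> \<partial>lebesgue)"
        by (rule nn_integral_cong_AE) (use u r in \<open>auto elim!: eventually_mono simp: indicator_def\<close>)
      also have "\<dots> = ennreal \<bar>c\<bar> * emeasure lebesgue ?B"
        using \<open>open ?B\<close> by (simp add: nn_integral_cmult_indicator)
      finally show "ennreal \<bar>c\<bar> = (\<integral>\<^sup>+z\<in>ball y r \<inter> (U - K). ennreal \<bar>u z - 0\<bar> \<partial>lebesgue) /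
          emeasure lebesgue (ball y r \<inter> (U - K))"
        unfolding B using pos fin by (simp add: ennreal_mult_divide_eq)
    qed (use \<open>0 < e\<close> in auto)
  qed
  with trace have "ennreal \<bar>c\<bar> = 0"
    unfolding has_trace_at_def by (intro tendsto_unique[OF trivial_limit_at_right_real])
  then show ?thesis by simp
qed

text \<open>On \<open>U - K\<close> the value of \<open>v\<close> is the constant that
  \<open>u\<close> equals almost everywhere nearby. The point at issue is the boundary: near a
  boundary point off \<open>K\<close> the half ball is convex, so \<open>v\<close> is constant on
  it, and the zero trace makes the constant 0, which fits the extension by 0.\<close>

lemma elementary_locally_constant:
  assumes U: "U = {x :: plane. 0 < x $ 2}" and adm: "adm_pair U K u" and elem: "elementary U K u"
  obtains v where "locally_constant_on (- K) v" "\<And>x. x $ 2 < 0 \<Longrightarrow> v x = 0"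
    "AE x in lebesgue. x \<in> U - K \<longrightarrow> u x = v x"
proof -
  note H = upper_half_plane[OF U]
  have clK: "closed K" using adm by (simp add: adm_pair_def)
  have op: "open (U - K)" using H(1) clK by (rule open_Diff)
  define g where "g = wgrad (U - K) u"
  have wg: "weak_gradient (U - K) u g"
    using adm unfolding g_def wgrad_def adm_pair_def W12_loc_def by (metis someI_ex)
  have g0: "AE x in lebesgue. x \<in> U - K \<longrightarrow> g x = 0"
  proof (rule AE_locally)
    fix x assume "x \<in> U - K"
    then obtain a b where ab: "cbox a b \<subseteq> U - K" "x \<in> box a b" using open_contains_cbox[OF op] by metis
    define G where "G x = indicator (cbox a b) x *\<^sub>R g x" for x
    have [measurable]: "G \<in> borel_measurable lebesgue"
      using wg ab unfolding weak_gradient_def set_integrable_def G_def[abs_def]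
      by (intro borel_measurable_integrable) (auto intro: compact_cbox)
    have "(\<integral>\<^sup>+x\<in>cbox a b. ennreal ((norm (g x))\<^sup>2) \<partial>lebesgue) \<le> dirichlet U K u UNIV"
      unfolding dirichlet_def g_def[symmetric]
      using ab by (intro nn_integral_mono) (auto simp: indicator_def)
    then have "(\<integral>\<^sup>+x\<in>cbox a b. ennreal ((norm (g x))\<^sup>2) \<partial>lebesgue) = 0"
      using elem by (simp add: elementary_def)
    moreover have "(\<integral>\<^sup>+x\<in>cbox a b. ennreal ((norm (g x))\<^sup>2) \<partial>lebesgue) =
        (\<integral>\<^sup>+x. ennreal ((norm (G x))\<^sup>2) \<partial>lebesgue)"
      by (rule nn_integral_cong) (auto simp: G_def indicator_def)
    ultimately have "AE x in lebesgue. ennreal ((norm (G x))\<^sup>2) = 0"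
      by (simp add: nn_integral_0_iff_AE)
    then have "AE x in lebesgue. x \<in> box a b \<longrightarrow> g x = 0"
      by eventually_elim (use box_subset_cbox[of a b] in \<open>auto simp: G_def indicator_def ennreal_eq_0_iff split: if_splits\<close>)
    then show "\<exists>S. open S \<and> x \<in> S \<and> (AE y in lebesgue. y \<in> S \<longrightarrow> g y = 0)"
      using ab(2) open_box by blast
  qed
  define val where "val x c \<longleftrightarrow> (\<exists>S. open S \<and> x \<in> S \<and> (AE y in lebesgue. y \<in> S \<longrightarrow> u y = c))" for x c
  have val_unique: "c = d" if c: "val x c" and d: "val x d" for x c d
  proof -
    obtain S where S: "open S" "x \<in> S" "AE y in lebesgue. y \<in> S \<longrightarrow> u y = c" using c unfolding val_def by blast
    obtain T where T: "open T" "x \<in> T" "AE y in lebesgue. y \<in> T \<longrightarrow> u y = d" using d unfolding val_def by blast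
    show ?thesis
    proof (rule AE_const_unique[of "S \<inter> T" u])
      show "AE y in lebesgue. y \<in> S \<inter> T \<longrightarrow> u y = c" using S(3) by eventually_elim auto
      show "AE y in lebesgue. y \<in> S \<inter> T \<longrightarrow> u y = d" using T(3) by eventually_elim auto
    qed (use S T in auto)
  qed
  have val_ex: "\<exists>c. val x c" if "x \<in> U - K" for x
  proof -
    obtain a b where ab: "cbox a b \<subseteq> U - K" "x \<in> box a b" using open_contains_cbox[OF op \<open>x \<in> U - K\<close>] by metis
    then obtain c where "AE y in lebesgue. y \<in> cbox a b \<longrightarrow> u y = c"
      using weak_gradient_zero_AE_const_box[OF wg g0 op ab(1)] by blast
    then have "AE y in lebesgue. y \<in> box a b \<longrightarrow> u y = c"
      by eventually_elim (use box_subset_cbox[of a b] in auto)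
    then show ?thesis unfolding val_def using ab(2) open_box by blast
  qed
  define v where "v x = (if x \<in> U then THE c. val x c else 0)" for x
  have v_val: "v x = c" if "x \<in> U" "val x c" for x c
    using that val_unique unfolding v_def by (auto intro: the_equality)
  have v_loc: "\<exists>S. open S \<and> x \<in> S \<and> S \<subseteq> U - K \<and> (AE y in lebesgue. y \<in> S \<longrightarrow> u y = v x) \<and> (\<forall>y\<in>S. v y = v x)"
    if x: "x \<in> U - K" for x
  proof -
    obtain c S where S: "open S" "x \<in> S" "AE y in lebesgue. y \<in> S \<longrightarrow> u y = c"
      using val_ex[OF x] unfolding val_def by blast
    have "AE y in lebesgue. y \<in> S \<inter> (U - K) \<longrightarrow> u y = c" using S(3) by eventually_elim auto
    moreover have "open (S \<inter> (U - K))" using S op by auto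
    ultimately have "v y = c" if "y \<in> S \<inter> (U - K)" for y
      using that by (intro v_val) (auto simp: val_def)
    then show ?thesis
      using S x op \<open>AE y in lebesgue. y \<in> S \<inter> (U - K) \<longrightarrow> u y = c\<close> by (intro exI[of _ "S \<inter> (U - K)"]) auto
  qed
  have locU: "locally_constant_on (U - K) v"
    unfolding locally_constant_on_def eventually_nhds using v_loc by meson
  have ae: "AE x in lebesgue. x \<in> U - K \<longrightarrow> u x = v x"
  proof (rule AE_locally)
    fix x assume "x \<in> U - K"
    then obtain S where S: "open S" "x \<in> S" "AE y in lebesgue. y \<in> S \<longrightarrow> u y = v x" "\<forall>y\<in>S. v y = v x"
      using v_loc by meson
    from S(3) have "AE y in lebesgue. y \<in> S \<longrightarrow> u y = v y" by eventually_elim (use S(4) in simp)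
    then show "\<exists>S. open S \<and> x \<in> S \<and> (AE y in lebesgue. y \<in> S \<longrightarrow> u y = v y)"
      using S(1,2) by blast
  qed
  have loc: "locally_constant_on (- K) v"
    unfolding locally_constant_on_def
  proof
    fix x assume x: "x \<in> - K"
    consider "0 < x $ 2" | "x $ 2 < 0" | "x $ 2 = 0" by linarith
    then show "\<forall>\<^sub>F y in nhds x. v y = v x"
    proof cases
      case 1
      then show ?thesis using locU x by (auto simp: locally_constant_on_def U)
    next
      case 2
      then have "\<forall>\<^sub>F y in nhds x. y \<in> {y. y $ 2 < 0}"
        by (intro eventually_nhds_in_open open_halfspace_component_lt_cart) auto
      then show ?thesis by eventually_elim (use 2 in \<open>auto simp: v_def U\<close>)
    next
      case 3
      obtain e where e: "0 < e" "ball x e \<subseteq> - K" using x clK open_contains_ball[of "- K"] by auto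
      have conn: "connected (ball x e \<inter> U)"
        using convex_halfspace_gt[of 0 "axis 2 1 :: plane"]
        by (intro convex_connected convex_Int) (auto simp: U inner_axis')
      define z0 where "z0 = x + axis 2 (e / 2)"
      have z0: "z0 \<in> ball x e \<inter> U" using e 3 dist_add_axis[of x "e / 2"] by (auto simp: z0_def U axis_def)
      have const: "v z = v z0" if "z \<in> ball x e \<inter> U" for z
        by (rule locally_constant_on_connected[OF locally_constant_on_subset[OF locU] conn that z0]) (use e in auto)
      obtain N where N: "hausdorff1 N = 0" "\<forall>x\<in>frontier U - K - N. has_trace_at (U - K) u x 0"
        using adm by (auto simp: adm_pair_def zero_trace_def)
      \<comment> \<open>The trace may fail to vanish at \<open>x\<close> itself; it is read off at a
        nearby boundary point \<open>y\<close> outside the null set \<open>N\<close>.\<close>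
      have "\<not> {z :: plane. z $ 2 = 0 \<and> x $ 1 < z $ 1 \<and> z $ 1 < x $ 1 + e / 2} \<subseteq> N"
        using hausdorff1_mono[of _ N] hausdorff1_horizontal_pos[of "e / 2" 0 "x $ 1"] N(1) e by fastforce
      then obtain y where y: "y $ 2 = 0" "x $ 1 < y $ 1" "y $ 1 < x $ 1 + e / 2" "y \<notin> N" by blast
      have "dist x y < e / 2"
        using y 3 by (simp add: dist_norm norm_vec_def L2_set_def sum_2)
      then have sub: "ball y (e / 2) \<subseteq> ball x e"
        by (intro subsetI) (metis dist_commute dist_triangle_half_l mem_ball)
      have "y \<in> ball x e" using \<open>dist x y < e / 2\<close> e by simp
      then have "y \<notin> K" using e by blast
      then have tr: "has_trace_at (U - K) u y 0" using N(2) y H(3) by auto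
      have ae': "AE z in lebesgue. z \<in> ball y (e / 2) \<inter> U \<longrightarrow> u z = v z0"
        using ae by eventually_elim (use sub e const in auto)
      have "ball y (e / 2) \<inter> K = {}" using sub e by blast
      then have "v z0 = 0"
        by (rule has_trace_at_const[OF U y(1) _ _ ae' tr, rotated]) (use e in simp)
      then have v0: "v z = 0" if "z \<in> ball x e" for z
        using const that by (cases "z \<in> U") (auto simp: v_def)
      have "\<forall>\<^sub>F z in nhds x. z \<in> ball x e"
        using e by (intro eventually_nhds_in_open) auto
      then show ?thesis by eventually_elim (use v0 e in simp)
    qed
  qed
  show thesis by (rule that[OF loc _ ae]) (auto simp: v_def U)
qed

section \<open>Competitors\<close>

text \<open>A competitor is described by a map \<open>\<rho>\<close> which tells every point off \<open>J\<close> which component of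
  the complement of \<open>K\<close> it is to be merged with. Its function is \<open>v \<circ> \<rho>\<close>, where \<open>v\<close> is the locally
  constant representative of \<open>u\<close>, so that it has no Dirichlet energy.\<close>

lemma hausdorff1_le_competitor:
  assumes U: "U = {x :: plane. 0 < x $ 2}"
    and min: "generalized_minimizer U K u" and elem: "elementary U K u"
    and V: "open V" "bounded V" and J: "closed J" "\<And>z. z \<in> J \<Longrightarrow> 0 \<le> z $ 2" "J - V = K - V"
    and loc: "\<And>z. z \<notin> J \<Longrightarrow> \<forall>\<^sub>F y in nhds z. connected_component (- K) (\<rho> z) (\<rho> y)"
    and out: "\<And>z. z \<notin> V \<union> K \<Longrightarrow> \<rho> z = z"
    and low: "\<And>z. z $ 2 < 0 \<Longrightarrow> connected_component (- K) z (\<rho> z)"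
  shows "hausdorff1 (K \<inter> V) \<le> hausdorff1 (J \<inter> V)"
proof -
  note H = upper_half_plane[OF U]
  have adm: "adm_pair U K u" using min by (simp add: generalized_minimizer_def)
  obtain v where v: "locally_constant_on (- K) v" "\<And>x. x $ 2 < 0 \<Longrightarrow> v x = 0"
    "AE x in lebesgue. x \<in> U - K \<longrightarrow> u x = v x"
    by (rule elementary_locally_constant[OF U adm elem]) (rule that)
  have v_const: "v x = v y" if xy: "connected_component (- K) x y" for x y
  proof -
    have "connected (connected_component_set (- K) x)" by simp
    moreover have "x \<in> connected_component_set (- K) x" "y \<in> connected_component_set (- K) x"
      using xy connected_component_in by (auto simp: connected_component_refl_eq)
    ultimately show ?thesis
      using locally_constant_on_connected[OF locally_constant_on_subset[OF v(1) connected_component_subset]] by blast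
  qed
  define w where "w = (\<lambda>x. v (\<rho> x))"
  have w: "locally_constant_on (- J) w"
    unfolding locally_constant_on_def
  proof
    fix x assume "x \<in> - J"
    then have "\<forall>\<^sub>F y in nhds x. connected_component (- K) (\<rho> x) (\<rho> y)" using loc by auto
    then show "\<forall>\<^sub>F y in nhds x. w y = w x" by eventually_elim (use v_const in \<open>simp add: w_def\<close>)
  qed
  have w_low: "w x = 0" if "x $ 2 < 0" for x
    using v_const[OF low[OF that]] v(2)[OF that] by (simp add: w_def)
  have JU: "J \<subseteq> closure U" unfolding H(2) using J(2) by auto
  have "competitor U K u J w V"
    unfolding competitor_def
  proof (intro conjI V allI impI)
    show "adm_pair U J w" by (rule adm_pair_locally_constant[OF U J(1) JU w w_low])
    show "J \<inter> (closure U - V) = K \<inter> (closure U - V)" using J(3) by auto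
    show "AE x in lebesgue. x \<in> U - V - K \<longrightarrow> w x = u x"
      using v(3) by eventually_elim (use out in \<open>auto simp: w_def\<close>)
    fix x y
    assume xy: "x \<notin> V \<union> K \<and> y \<notin> V \<union> K \<and>
      connected_component_set (- K) x \<noteq> connected_component_set (- K) y"
    \<comment> \<open>Locally \<open>\<rho>\<close> stays in one component of the complement of
      \<open>K\<close>, hence it does so on each component of the complement of \<open>J\<close>.
      Off \<open>V \<union> K\<close> it is the identity, so points separated by \<open>K\<close>
      stay separated.\<close>
    have comp: "locally_constant_on (- J) (\<lambda>z. connected_component_set (- K) (\<rho> z))"
      unfolding locally_constant_on_def
    proof
      fix z assume "z \<in> - J"
      then have "\<forall>\<^sub>F y in nhds z. connected_component (- K) (\<rho> z) (\<rho> y)" using loc by auto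
      then show "\<forall>\<^sub>F y in nhds z. connected_component_set (- K) (\<rho> y) = connected_component_set (- K) (\<rho> z)"
        by eventually_elim (rule connected_component_eq, simp)
    qed
    have J_in: "x \<in> - J" "y \<in> - J" using xy J(3) by auto
    show "connected_component_set (- J) x \<noteq> connected_component_set (- J) y"
    proof
      assume eq: "connected_component_set (- J) x = connected_component_set (- J) y"
      have "x \<in> connected_component_set (- J) x" "y \<in> connected_component_set (- J) y"
        using J_in by (simp_all only: mem_Collect_eq connected_component_refl)
      then have "x \<in> connected_component_set (- J) x" "y \<in> connected_component_set (- J) x"
        using eq by blast+
      then have "connected_component_set (- K) (\<rho> x) = connected_component_set (- K) (\<rho> y)"
        using locally_constant_on_connected[OF locally_constant_on_subset[OF comp connected_component_subset]]
        by blast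
      then show False using xy out[of x] out[of y] by simp
    qed
  qed
  then have le: "energy U K u V \<le> energy U J w V" using min by (simp add: generalized_minimizer_def)
  have "open (U - J)" using H(1) J(1) by (rule open_Diff)
  moreover have "locally_constant_on (U - J) w" by (rule locally_constant_on_subset[OF w]) auto
  ultimately have "energy U J w V = hausdorff1 (J \<inter> V)"
    by (simp add: energy_def dirichlet_locally_constant)
  moreover have "hausdorff1 (K \<inter> V) \<le> energy U K u V" by (simp add: energy_def)
  ultimately show ?thesis using le by simp
qed

text \<open>The function has disappeared, and the admissibility of \<open>J\<close> is witnessed by
  a map \<open>\<rho>\<close>. Its values matter only up to components of the complement of
  \<open>K\<close>, so \<open>\<rho>\<close> may jump within a component.\<close>

locale minimal_set =
  fixes K :: "plane set"
  assumes closed_K: "closed K"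
    and upper: "z \<in> K \<Longrightarrow> 0 \<le> z $ 2"
    and normalized: "x \<in> K \<Longrightarrow> 0 < r \<Longrightarrow> 0 < hausdorff1 (K \<inter> ball x r)"
    and competitor_le: "open V \<Longrightarrow> bounded V \<Longrightarrow> closed J \<Longrightarrow> (\<And>z. z \<in> J \<Longrightarrow> 0 \<le> z $ 2) \<Longrightarrow>
      J - V = K - V \<Longrightarrow>
      (\<And>z. z \<notin> J \<Longrightarrow> \<forall>\<^sub>F y in nhds z. connected_component (- K) (\<rho> z) (\<rho> y)) \<Longrightarrow>
      (\<And>z. z \<notin> V \<union> K \<Longrightarrow> \<rho> z = z) \<Longrightarrow>
      (\<And>z. z $ 2 < 0 \<Longrightarrow> connected_component (- K) z (\<rho> z)) \<Longrightarrow>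
      hausdorff1 (K \<inter> V) \<le> hausdorff1 (J \<inter> V)"

lemma minimal_set_elementary_minimizer:
  assumes U: "U = {x :: plane. 0 < x $ 2}"
    and min: "generalized_minimizer U K u" and elem: "elementary U K u"
  shows "minimal_set K"
proof
  have "closed K" "K \<subseteq> closure U" "normalized K"
    using min by (simp_all add: generalized_minimizer_def adm_pair_def)
  then show "closed K" "\<And>z. z \<in> K \<Longrightarrow> 0 \<le> z $ 2"
    "\<And>x r. x \<in> K \<Longrightarrow> 0 < r \<Longrightarrow> 0 < hausdorff1 (K \<inter> ball x r)"
    using upper_half_plane(2)[OF U] by (auto simp: normalized_def)
qed (rule hausdorff1_le_competitor[OF U min elem])

context minimal_set
begin

section \<open>Comparison with erased discs and with cones\<close>

lemma eventually_connected_component: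
  assumes "z \<notin> K"
  shows "\<forall>\<^sub>F y in nhds z. connected_component (- K) z y"
proof -
  obtain e where e: "0 < e" "ball z e \<subseteq> - K"
    using assms closed_K open_contains_ball[of "- K"] by auto
  have "\<forall>\<^sub>F y in nhds z. y \<in> ball z e" using e by (intro eventually_nhds_in_open) auto
  then show ?thesis
  proof eventually_elim
    case (elim y)
    then show ?case
      unfolding connected_component_def using e by (intro exI[of _ "ball z e"]) auto
  qed
qed

lemma lower_connected_component:
  assumes "a $ 2 < 0" "b $ 2 < 0"
  shows "connected_component (- K) a b"
proof -
  have "convex {z :: plane. z $ 2 < 0}"
    using convex_halfspace_lt[of "axis 2 1 :: plane" 0] by (simp add: inner_axis')
  then have "connected {z :: plane. z $ 2 < 0}" by (rule convex_connected)
  moreover have "{z :: plane. z $ 2 < 0} \<subseteq> - K" using upper by force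
  ultimately show ?thesis
    unfolding connected_component_def using assms by (intro exI[of _ "{z. z $ 2 < 0}"]) auto
qed

lemma sphere_disjoint_measure_zero:
  assumes "0 < r" and disj: "K \<inter> sphere x r = {}"
  shows "hausdorff1 (K \<inter> ball x r) = 0"
proof -
  \<comment> \<open>The circle lies in one component, with which the whole disc is merged. Its
    lowest point represents it: if the disc reaches below height 0, so does \<open>q\<close>, and
    the lower half-plane keeps its component.\<close>
  define q where "q = x + axis 2 (- r)"
  have q: "q \<in> sphere x r" using \<open>0 < r\<close> by (simp add: q_def dist_add_axis)
  define \<rho> where "\<rho> z = (if z \<in> ball x r then q else z)" for z
  have sph: "connected_component (- K) z q" if "z \<in> sphere x r" for z
  proof -
    have "connected (sphere x r)" by (rule connected_sphere) simp
    then show ?thesis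
      unfolding connected_component_def using that q disj by (intro exI[of _ "sphere x r"]) auto
  qed
  have "hausdorff1 (K \<inter> ball x r) \<le> hausdorff1 ((K - ball x r) \<inter> ball x r)"
  proof (rule competitor_le[where \<rho>=\<rho>])
    show "closed (K - ball x r)" using closed_K by (rule closed_Diff) auto
    fix z
    show "0 \<le> z $ 2" if "z \<in> K - ball x r" using that upper by auto
    show "\<rho> z = z" if "z \<notin> ball x r \<union> K" using that by (simp add: \<rho>_def)
    show "connected_component (- K) z (\<rho> z)" if "z $ 2 < 0"
    proof (cases "z \<in> ball x r")
      case True
      have "\<bar>x $ 2 - z $ 2\<bar> \<le> dist x z"
        using component_le_norm_cart[of "x - z" 2] by (simp add: dist_norm)
      then have "q $ 2 < 0" using True that by (simp add: q_def axis_def)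
      then show ?thesis using True that by (simp add: \<rho>_def lower_connected_component)
    next
      case False
      then show ?thesis using that lower_connected_component[of z z] by (simp add: \<rho>_def)
    qed
    assume z: "z \<notin> K - ball x r"
    show "\<forall>\<^sub>F y in nhds z. connected_component (- K) (\<rho> z) (\<rho> y)"
    proof (cases "z \<in> ball x r")
      case True
      then have "\<forall>\<^sub>F y in nhds z. y \<in> ball x r" by (intro eventually_nhds_in_open) auto
      then show ?thesis
        by eventually_elim (use True sph[OF q] in \<open>simp add: \<rho>_def\<close>)
    next
      case False
      then have nz: "z \<notin> K" using z by blast
      show ?thesis
      proof (cases "z \<in> sphere x r")
        case True
        show ?thesis
          using eventually_connected_component[OF nz]
          by eventually_elim (use sph[OF True] False in \<open>auto simp: \<rho>_def\<close>)
      next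
        case nsph: False
        then have "z \<in> - cball x r" using False by auto
        then have "\<forall>\<^sub>F y in nhds z. y \<in> - cball x r" by (intro eventually_nhds_in_open) auto
        with eventually_connected_component[OF nz] show ?thesis
          by eventually_elim (use False in \<open>auto simp: \<rho>_def\<close>)
      qed
    qed
  qed auto
  also have "(K - ball x r) \<inter> ball x r = {}" by blast
  finally show ?thesis by simp
qed

text \<open>The competitor replaces \<open>K\<close> inside the disc by the cone with apex \<open>p\<close> over the points of
  \<open>K\<close> on the circle: \<open>\<rho>\<close> follows the ray from \<open>p\<close> until it leaves the disc.\<close>

lemma cone_competitor:
  assumes p: "p \<in> K" "p \<in> sphere x r"
  shows "hausdorff1 (K \<inter> ball x r) \<le> hausdorff1 (\<Union>q\<in>K \<inter> sphere x r. closed_segment p q)"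
proof -
  \<comment> \<open>The quotient is the parameter at which the line from \<open>p\<close> through
    \<open>z\<close> meets the circle again. It exceeds 1 inside the disc and is at most 1 outside,
    so \<open>max\<close> fixes the points outside. At \<open>z = p\<close> division by zero yields
    0, and \<open>p\<close> is fixed.\<close>
  define t where "t z = max 1 (2 * ((x - p) \<bullet> (z - p)) / ((z - p) \<bullet> (z - p)))" for z
  define \<rho> where "\<rho> z = p + t z *\<^sub>R (z - p)" for z
  \<comment> \<open>The apex is added because \<open>\<rho>\<close> need not be continuous
    there.\<close>
  define J where "J = {p} \<union> {z. \<rho> z \<in> K}"
  have rr: "(x - p) \<bullet> (x - p) = r\<^sup>2"
    using p(2) by (simp add: dist_norm flip: power2_norm_eq_inner)
  have dist_eq: "(dist x z)\<^sup>2 = (z - p) \<bullet> (z - p) - 2 * ((x - p) \<bullet> (z - p)) + r\<^sup>2" for z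
  proof -
    have "(dist x z)\<^sup>2 = (dist z x)\<^sup>2" by (simp only: dist_commute)
    also have "\<dots> = ((z - p) - (x - p)) \<bullet> ((z - p) - (x - p))"
      by (simp add: dist_norm power2_norm_eq_inner)
    also have "\<dots> = (z - p) \<bullet> (z - p) - 2 * ((x - p) \<bullet> (z - p)) + (x - p) \<bullet> (x - p)"
      by (simp only: inner_diff_left inner_diff_right inner_commute) (simp add: inner_commute)
    finally show ?thesis using rr by simp
  qed
  have r0: "0 \<le> r" using p(2) zero_le_dist[of x p] by simp
  have outside: "\<rho> z = z" if "z \<notin> ball x r" for z
  proof (cases "z = p")
    case False
    then have "0 < (z - p) \<bullet> (z - p)" by simp
    moreover have "r\<^sup>2 \<le> (dist x z)\<^sup>2" using that r0 by (intro power_mono) auto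
    ultimately have "t z = 1" using dist_eq[of z] by (simp add: t_def max_def)
    then show ?thesis by (simp add: \<rho>_def)
  qed (simp add: \<rho>_def)
  have inside: "z \<noteq> p" "t z * ((z - p) \<bullet> (z - p)) = 2 * ((x - p) \<bullet> (z - p))"
    if "z \<in> ball x r" for z
  proof -
    show "z \<noteq> p" using that p(2) by auto
    then have pos: "0 < (z - p) \<bullet> (z - p)" by simp
    have "(dist x z)\<^sup>2 < r\<^sup>2" using that by (intro power_strict_mono) auto
    then have "(z - p) \<bullet> (z - p) \<le> 2 * ((x - p) \<bullet> (z - p))" using dist_eq[of z] by simp
    then have "t z = 2 * ((x - p) \<bullet> (z - p)) / ((z - p) \<bullet> (z - p))"
      using pos by (simp add: t_def max_def)
    then show "t z * ((z - p) \<bullet> (z - p)) = 2 * ((x - p) \<bullet> (z - p))" using pos by simp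
  qed
  have t1: "1 \<le> t z" for z by (simp add: t_def)
  have cont: "continuous_on (- {p}) \<rho>"
    unfolding \<rho>_def t_def by (intro continuous_intros) auto
  \<comment> \<open>Moving away from an apex of nonnegative height cannot raise a point of negative
    height. So \<open>\<rho>\<close> respects the lower half-plane, and no part of the cone lies
    below height 0.\<close>
  have low: "\<rho> z $ 2 < 0" if "z $ 2 < 0" for z
  proof -
    have "0 \<le> p $ 2" using upper p(1) by blast
    then have "t z * (z $ 2 - p $ 2) \<le> 1 * (z $ 2 - p $ 2)"
      using that t1[of z] by (intro mult_right_mono_neg) auto
    then show ?thesis using that by (simp add: \<rho>_def)
  qed
  have openJ: "open (- J)"
  proof -
    have "open (\<rho> -` (- K) \<inter> - {p})"
      using cont closed_K continuous_on_open_vimage[of "- {p}" \<rho>] by auto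
    moreover have "- J = \<rho> -` (- K) \<inter> - {p}" by (auto simp: J_def)
    ultimately show ?thesis by simp
  qed
  have "hausdorff1 (K \<inter> ball x r) \<le> hausdorff1 (J \<inter> ball x r)"
  proof (rule competitor_le[where \<rho>=\<rho>])
    show "closed J" using openJ by (simp add: closed_def)
    show "J - ball x r = K - ball x r" using outside p(1) by (auto simp: J_def)
    fix z
    show "0 \<le> z $ 2" if "z \<in> J"
      using that upper p(1) low[of z] by (force simp: J_def)
    show "\<rho> z = z" if "z \<notin> ball x r \<union> K" using that outside by auto
    show "connected_component (- K) z (\<rho> z)" if "z $ 2 < 0"
      using lower_connected_component[OF that low[OF that]] .
    assume z: "z \<notin> J"
    then have "isCont \<rho> z" using cont continuous_on_eq_continuous_at[of "- {p}" \<rho>] by (auto simp: J_def)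
    then have "filterlim \<rho> (nhds (\<rho> z)) (nhds z)"
      by (simp add: isCont_def tendsto_nhds_iff)
    then show "\<forall>\<^sub>F y in nhds z. connected_component (- K) (\<rho> z) (\<rho> y)"
      using eventually_connected_component[of "\<rho> z"] z
      unfolding filterlim_iff J_def by auto
  qed auto
  also have "\<dots> \<le> hausdorff1 (\<Union>q\<in>K \<inter> sphere x r. closed_segment p q)"
  proof (rule hausdorff1_mono, rule subsetI)
    fix z assume "z \<in> J \<inter> ball x r"
    then have z: "z \<in> ball x r" "\<rho> z \<in> K" using inside(1)[of z] by (auto simp: J_def)
    have d: "\<rho> z - p = t z *\<^sub>R (z - p)" by (simp add: \<rho>_def)
    have "(dist x (\<rho> z))\<^sup>2 = t z * (t z * ((z - p) \<bullet> (z - p))) - t z * (2 * ((x - p) \<bullet> (z - p))) + r\<^sup>2"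
      unfolding dist_eq d by (simp add: algebra_simps)
    also have "\<dots> = r\<^sup>2" unfolding inside(2)[OF z(1)] by simp
    finally have "dist x (\<rho> z) = r" using r0 by (simp add: power2_eq_iff_nonneg)
    moreover have "z \<in> closed_segment p (\<rho> z)"
      unfolding in_segment
    proof (intro exI[of _ "1 / t z"] conjI)
      show "z = (1 - 1 / t z) *\<^sub>R p + (1 / t z) *\<^sub>R \<rho> z"
        using t1[of z] by (simp add: \<rho>_def algebra_simps)
    qed (use t1[of z] in auto)
    ultimately show "z \<in> (\<Union>q\<in>K \<inter> sphere x r. closed_segment p q)" using z(2) by auto
  qed
  finally show ?thesis .
qed

end

section \<open>Length in discs about a boundary point\<close>

lemma hausdorff1_half_circle_le:
  "hausdorff1 {z :: plane. norm z = 1 \<and> 0 \<le> z $ 2} \<le> ennreal pi"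
proof -
  let ?C = "{z :: plane. norm z = 1 \<and> 0 \<le> z $ 2}"
  have coord: "z $ 1 = cos (arccos (z $ 1)) \<and> z $ 2 = sin (arccos (z $ 1)) \<and> arccos (z $ 1) \<in> {0..pi}"
    if "z \<in> ?C" for z
  proof -
    have sq: "(z $ 1)\<^sup>2 + (z $ 2)\<^sup>2 = 1"
      using that by (simp add: norm_vec_def L2_set_def sum_2)
    then have "(z $ 1)\<^sup>2 \<le> 1" using zero_le_power2[of "z $ 2"] by linarith
    then have "\<bar>z $ 1\<bar> \<le> 1" by (simp add: abs_square_le_1)
    then have b: "- 1 \<le> z $ 1" "z $ 1 \<le> 1" by auto
    have "z $ 2 = sqrt (1 - (z $ 1)\<^sup>2)"
      using sq that by (intro real_sqrt_unique[symmetric]) auto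
    then show ?thesis using b by (simp add: sin_arccos arccos_lbound arccos_ubound)
  qed
  \<comment> \<open>The angle is an expansive coordinate: a chord has length
    \<open>2 * \<bar>sin ((s - t) / 2)\<bar>\<close>, at most the arc
    \<open>\<bar>s - t\<bar>\<close>.\<close>
  have "hausdorff1 ?C \<le> ennreal 1 * hausdorff1 ((\<lambda>z. arccos (z $ 1)) ` ?C)"
  proof (rule hausdorff1_le_expansive)
    fix y z assume yz: "y \<in> ?C" "z \<in> ?C"
    define s where "s = arccos (y $ 1)"
    define t where "t = arccos (z $ 1)"
    have y: "y $ 1 = cos s" "y $ 2 = sin s" and z: "z $ 1 = cos t" "z $ 2 = sin t"
      using coord[OF yz(1)] coord[OF yz(2)] by (simp_all add: s_def t_def)
    have "(dist y z)\<^sup>2 = (cos s - cos t)\<^sup>2 + (sin s - sin t)\<^sup>2"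
      by (simp add: dist_norm norm_vec_def L2_set_def sum_2 y z)
    also have "\<dots> = 2 - 2 * cos (s - t)"
      using sin_cos_squared_add[of s] sin_cos_squared_add[of t]
      by (simp add: cos_diff power2_diff algebra_simps)
    also have "\<dots> = (2 * sin ((s - t) / 2))\<^sup>2"
    proof -
      define h where "h = (s - t) / 2"
      have "s - t = 2 * h" by (simp add: h_def)
      then show ?thesis
        unfolding h_def[symmetric] by (simp only: cos_double_sin power_mult_distrib) simp
    qed
    also have "\<dots> \<le> (s - t)\<^sup>2"
      using abs_sin_x_le_abs_x[of "(s - t) / 2"]
      by (intro abs_le_square_iff[THEN iffD1]) (simp add: abs_mult)
    finally have "dist y z \<le> \<bar>s - t\<bar>" by (simp add: abs_le_square_iff[symmetric])
    then show "dist y z \<le> 1 * dist (arccos (y $ 1)) (arccos (z $ 1))"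
      by (simp add: s_def t_def dist_real_def)
  qed simp
  also have "(\<lambda>z. arccos (z $ 1)) ` ?C \<subseteq> {0..pi}" using coord by blast
  then have "hausdorff1 ((\<lambda>z. arccos (z $ 1)) ` ?C) \<le> hausdorff1 {0..pi}"
    by (rule hausdorff1_mono)
  also have "\<dots> \<le> ennreal pi" using hausdorff1_interval_le[of 0 pi] by simp
  finally show ?thesis by (simp add: mult_left_mono)
qed

context minimal_set
begin

text \<open>Clearing the half disc. The cut is pushed slightly inside, depending on the distance to
  \<open>K\<close>, since a competitor may not add anything to \<open>K\<close> on the circle itself.\<close>

lemma measure_ball_le:
  assumes "0 < R" and e: "0 < e" "e < 1"
  shows "hausdorff1 (K \<inter> ball 0 R) \<le> ennreal (R / (1 - e) * pi)"
proof (cases "K \<inter> ball 0 R = {}")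
  case False
  then have "K \<noteq> {}" by blast
  \<comment> \<open>The cut is the level set \<open>F z = R\<close>. On the circle \<open>F\<close>
    equals \<open>R\<close> exactly at the points of \<open>K\<close>, and beyond it
    \<open>F\<close> exceeds \<open>R\<close>, so nothing is added outside the open disc. The second
    summand is \<open>e\<close>-Lipschitz, which keeps the cut almost as short as the
    circle.\<close>
  define F where "F z = norm z + e * infdist z K" for z
  have F_cont: "continuous_on UNIV F" unfolding F_def by (intro continuous_intros)
  have F_K: "F z = norm z" if "z \<in> K" for z using that by (simp add: F_def)
  have op_gt: "open {z. R < F z}" and op_lt: "open {z. F z < R}"
    using F_cont by (auto intro!: open_Collect_less continuous_intros)
  define q where "q = (axis 2 (-1) :: plane)"
  have q: "q $ 2 < 0" by (simp add: q_def axis_def)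
  define \<rho> where "\<rho> z = (if R < F z then z else q)" for z
  \<comment> \<open>Below height 0 no cut is made: both sides of the level set lie there in the
    lower half-plane, the component of \<open>q\<close>.\<close>
  define \<Gamma> where "\<Gamma> = {z. F z = R \<and> 0 \<le> z $ 2}"
  define J where "J = (K - ball 0 R) \<union> \<Gamma>"
  have out: "R < F z" if "z \<notin> ball 0 R \<union> K" for z
  proof -
    have "infdist z K \<noteq> 0" using that in_closed_iff_infdist_zero[OF closed_K \<open>K \<noteq> {}\<close>] by blast
    then have "0 < e * infdist z K" using infdist_nonneg[of z K] e by simp
    then show ?thesis using that by (simp add: F_def)
  qed
  have "hausdorff1 (K \<inter> ball 0 R) \<le> hausdorff1 (J \<inter> ball 0 R)"
  proof (rule competitor_le[where \<rho>=\<rho>])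
    have "closed \<Gamma>"
      unfolding \<Gamma>_def using F_cont
      by (intro closed_Collect_conj closed_Collect_eq closed_Collect_le continuous_intros) auto
    then show "closed J" unfolding J_def using closed_K by (intro closed_Un closed_Diff) auto
    show "J - ball 0 R = K - ball 0 R" using out by (force simp: J_def \<Gamma>_def)
    fix z
    show "0 \<le> z $ 2" if "z \<in> J" using that upper by (auto simp: J_def \<Gamma>_def)
    show "\<rho> z = z" if "z \<notin> ball 0 R \<union> K" using out[OF that] by (simp add: \<rho>_def)
    show "connected_component (- K) z (\<rho> z)" if "z $ 2 < 0"
      using that q by (simp add: \<rho>_def lower_connected_component)
    assume z: "z \<notin> J"
    consider "R < F z" | "F z < R" | "F z = R" by linarith
    then show "\<forall>\<^sub>F y in nhds z. connected_component (- K) (\<rho> z) (\<rho> y)"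
    proof cases
      case 1
      then have "z \<notin> K" using F_K[of z] z by (auto simp: J_def)
      moreover have "\<forall>\<^sub>F y in nhds z. y \<in> {y. R < F y}"
        using 1 op_gt by (intro eventually_nhds_in_open) auto
      ultimately show ?thesis
        using eventually_connected_component[of z]
        by (auto simp: \<rho>_def 1 elim: eventually_elim2)
    next
      case 2
      then have "\<forall>\<^sub>F y in nhds z. y \<in> {y. F y < R}"
        using op_lt by (intro eventually_nhds_in_open) auto
      then show ?thesis
        by eventually_elim (use 2 lower_connected_component[OF q q] in \<open>simp add: \<rho>_def\<close>)
    next
      case 3
      then have "z $ 2 < 0" using z by (auto simp: J_def \<Gamma>_def)
      then have "\<forall>\<^sub>F y in nhds z. y \<in> {y. y $ 2 < 0}"
        by (intro eventually_nhds_in_open open_halfspace_component_lt_cart) auto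
      then show ?thesis
        by eventually_elim (use 3 q lower_connected_component[OF q] in \<open>simp add: \<rho>_def\<close>)
    qed
  qed auto
  also have "\<dots> \<le> hausdorff1 \<Gamma>" by (rule hausdorff1_mono) (auto simp: J_def)
  \<comment> \<open>On the cut, norms differ by at most \<open>e\<close> times the distance, so the
    directions control the distance up to the factor \<open>R / (1 - e)\<close>.\<close>
  also have "\<dots> \<le> ennreal (R / (1 - e)) * hausdorff1 (sgn ` \<Gamma>)"
  proof (rule hausdorff1_le_expansive)
    fix y z assume yz: "y \<in> \<Gamma>" "z \<in> \<Gamma>"
    have nz: "norm z \<le> R"
    proof -
      have "0 \<le> e * infdist z K" using e infdist_nonneg[of z K] by simp
      then show ?thesis using yz by (simp add: \<Gamma>_def F_def)
    qed
    have "\<bar>infdist y K - infdist z K\<bar> \<le> dist y z"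
      using infdist_triangle_abs[of y K z] by simp
    moreover have "norm y - norm z = e * (infdist z K - infdist y K)"
      using yz by (simp add: \<Gamma>_def F_def algebra_simps)
    ultimately have diff: "\<bar>norm y - norm z\<bar> \<le> e * dist y z"
      using e by (simp add: abs_mult abs_minus_commute)
    have sgn: "norm a *\<^sub>R sgn a = a" for a :: plane by (cases "a = 0") (simp_all add: sgn_div_norm)
    have "y - z = (norm y - norm z) *\<^sub>R sgn y + norm z *\<^sub>R (sgn y - sgn z)"
      using sgn[of y] sgn[of z] by (simp add: algebra_simps)
    then have "dist y z \<le> norm ((norm y - norm z) *\<^sub>R sgn y) + norm (norm z *\<^sub>R (sgn y - sgn z))"
      unfolding dist_norm by (metis norm_triangle_ineq)
    also have "norm ((norm y - norm z) *\<^sub>R sgn y) \<le> e * dist y z"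
      using diff e by (simp add: norm_sgn)
    also have "norm (norm z *\<^sub>R (sgn y - sgn z)) \<le> R * dist (sgn y) (sgn z)"
      using nz by (simp add: dist_norm mult_right_mono)
    finally have "(1 - e) * dist y z \<le> R * dist (sgn y) (sgn z)" by (simp add: algebra_simps)
    then show "dist y z \<le> R / (1 - e) * dist (sgn y) (sgn z)" using e by (simp add: field_simps)
  qed (use \<open>0 < R\<close> e in auto)
  also have "\<dots> \<le> ennreal (R / (1 - e)) * ennreal pi"
  proof (rule mult_left_mono)
    \<comment> \<open>Since \<open>K\<close> meets the disc, the origin is strictly inside the cut,
      so directions are defined along it.\<close>
    have "F 0 < R"
    proof -
      obtain k where "k \<in> K" "norm k < R" using False by auto
      then have "infdist 0 K < R" using infdist_le[of k K 0] by simp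
      moreover have "e * infdist 0 K \<le> infdist 0 K"
        using e infdist_nonneg[of 0 K] by (simp add: mult_left_le_one_le)
      ultimately have "e * infdist 0 K < R" by simp
      then show ?thesis by (simp add: F_def)
    qed
    then have "z \<noteq> 0" if "z \<in> \<Gamma>" for z using that by (auto simp: \<Gamma>_def)
    then have "sgn ` \<Gamma> \<subseteq> {z. norm z = 1 \<and> 0 \<le> z $ 2}"
      by (auto simp: norm_sgn) (auto simp: \<Gamma>_def sgn_div_norm)
    then show "hausdorff1 (sgn ` \<Gamma>) \<le> ennreal pi"
      using hausdorff1_mono hausdorff1_half_circle_le order_trans by blast
  qed simp
  also have "\<dots> = ennreal (R / (1 - e) * pi)" using \<open>0 < R\<close> e by (intro ennreal_mult[symmetric]) auto
  finally show ?thesis .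
qed simp

end

section \<open>Counting points on circles\<close>

lemma dist_dist_le: "dist (dist x y) (dist x z) \<le> dist y z"
  using dist_triangle[of x y z] dist_triangle[of x z y] by (simp add: dist_real_def dist_commute abs_le_iff)

lemma hausdorff1_growth:
  fixes f :: "'a::{metric_space,second_countable_topology} \<Rightarrow> real"
  assumes A: "A \<in> sets borel" and lip: "\<And>x y. dist (f x) (f y) \<le> dist x y" and "b \<le> c"
    and slices: "\<And>r. b < r \<Longrightarrow> r < c \<Longrightarrow> \<exists>F\<subseteq>A. f ` F \<subseteq> {r} \<and> finite F \<and> card F = k"
  shows "hausdorff1 (A \<inter> {x. f x < b}) + ennreal (real k * (c - b)) \<le> hausdorff1 (A \<inter> {x. f x < c})"
proof -
  have cont: "continuous_on UNIV f"
    unfolding continuous_on_iff using lip by (meson le_less_trans)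
  then have [measurable]: "f \<in> borel_measurable borel" by (rule borel_measurable_continuous_onI)
  note [measurable] = A
  have sets: "A \<inter> {x. f x < b} \<in> sets borel" "A \<inter> {x. b \<le> f x \<and> f x < c} \<in> sets borel"
    by measurable
  have "ennreal (real k * (c - b)) \<le> hausdorff1 (A \<inter> {x. b \<le> f x \<and> f x < c})"
  proof (rule hausdorff1_slices[OF sets(2) lip \<open>b \<le> c\<close>])
    fix r assume r: "b < r" "r < c"
    then obtain F where "F \<subseteq> A" "f ` F \<subseteq> {r}" "finite F" "card F = k" using slices by blast
    then show "\<exists>F\<subseteq>A \<inter> {x. b \<le> f x \<and> f x < c}. f ` F \<subseteq> {r} \<and> finite F \<and> card F = k"
      using r by (intro exI[of _ F]) auto
  qed
  then have "hausdorff1 (A \<inter> {x. f x < b}) + ennreal (real k * (c - b))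
      \<le> hausdorff1 (A \<inter> {x. f x < b}) + hausdorff1 (A \<inter> {x. b \<le> f x \<and> f x < c})"
    by (rule add_left_mono)
  also have "\<dots> = hausdorff1 (A \<inter> {x. f x < b} \<union> A \<inter> {x. b \<le> f x \<and> f x < c})"
    by (rule hausdorff1_add[symmetric, OF sets]) auto
  also have "\<dots> \<le> hausdorff1 (A \<inter> {x. f x < c})"
    using \<open>b \<le> c\<close> by (intro hausdorff1_mono) auto
  finally show ?thesis .
qed

text \<open>The angle at \<open>q\<close> is not acute because \<open>q\<close> lies beyond the chord from \<open>p\<close> to \<open>s\<close>, as seen from
  the centre of the circle.\<close>

lemma half_circle_inner_nonpos:
  fixes p q s :: plane
  assumes norms: "norm p = R" "norm q = R" "norm s = R"
    and up: "0 \<le> p $ 2" "0 \<le> q $ 2" "0 \<le> s $ 2"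
    and ord: "p $ 1 \<le> q $ 1" "q $ 1 \<le> s $ 1"
  shows "(p - q) \<bullet> (s - q) \<le> 0"
proof -
  have sq: "(norm z)\<^sup>2 = (z $ 1)\<^sup>2 + (z $ 2)\<^sup>2" for z :: plane
    by (simp add: norm_vec_def L2_set_def sum_2)
  have inner: "a \<bullet> b = a $ 1 * b $ 1 + a $ 2 * b $ 2" for a b :: plane
    by (simp add: inner_vec_def sum_2)
  show ?thesis
  proof (cases "p $ 1 = s $ 1")
    case True
    then have "(q $ 2)\<^sup>2 = (p $ 2)\<^sup>2" using ord sq[of p] sq[of q] norms by auto
    then have "q = p" using True ord up by (auto simp: vec_eq_iff forall_2)
    then show ?thesis by simp
  next
    case False
    define t where "t = (q $ 1 - p $ 1) / (s $ 1 - p $ 1)"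
    have t: "0 \<le> t" "t \<le> 1" using ord False by (auto simp: t_def)
    \<comment> \<open>\<open>c\<close> will turn out to lie vertically below \<open>q\<close> on the
      chord. The chord lies on the line where the inner product with \<open>p + s\<close> is
      \<open>R\<^sup>2 + p \<bullet> s\<close>; moving up to \<open>q\<close> can only increase this
      product.\<close>
    define c where "c = p + t *\<^sub>R (s - p)"
    have c1: "c $ 1 = q $ 1" using False by (simp add: c_def t_def)
    have "c \<in> closed_segment p s"
      unfolding in_segment using t by (intro exI[of _ t]) (auto simp: c_def algebra_simps)
    moreover have "closed_segment p s \<subseteq> cball 0 R"
      by (rule closed_segment_subset) (use norms in auto)
    ultimately have "norm c \<le> R" by auto
    then have "(norm c)\<^sup>2 \<le> R\<^sup>2" by (intro power_mono) auto
    then have "(c $ 2)\<^sup>2 \<le> (q $ 2)\<^sup>2"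
      using sq[of q] sq[of c] norms c1 by simp
    then have "c $ 2 \<le> q $ 2" using up(2) by (rule power2_le_imp_le)
    have pp: "p \<bullet> p = R\<^sup>2" "q \<bullet> q = R\<^sup>2" "s \<bullet> s = R\<^sup>2"
      using norms by (simp_all flip: power2_norm_eq_inner)
    have "c \<bullet> (p + s) = R\<^sup>2 + p \<bullet> s"
      unfolding c_def using pp by (simp add: inner_simps algebra_simps inner_commute)
    moreover have "q \<bullet> (p + s) = c \<bullet> (p + s) + (q $ 2 - c $ 2) * (p $ 2 + s $ 2)"
      using c1 by (simp add: inner algebra_simps)
    moreover have "0 \<le> (q $ 2 - c $ 2) * (p $ 2 + s $ 2)" using \<open>c $ 2 \<le> q $ 2\<close> up by simp
    moreover have "(p - q) \<bullet> (s - q) = R\<^sup>2 + p \<bullet> s - q \<bullet> (p + s)"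
      using pp by (simp add: inner_simps inner_commute algebra_simps)
    ultimately show ?thesis by simp
  qed
qed

text \<open>Since the angle at \<open>q\<close> is not acute, the squares of the two sides sum to at
  most the square of the third, hence of the diameter \<open>2 * R\<close>. The constant then comes
  from \<open>(a + b)\<^sup>2 \<le> 2 * (a\<^sup>2 + b\<^sup>2)\<close>.\<close>

lemma half_circle_dist_sum:
  fixes p q s :: plane
  assumes norms: "norm p = R" "norm q = R" "norm s = R"
    and up: "0 \<le> p $ 2" "0 \<le> q $ 2" "0 \<le> s $ 2"
    and ord: "p $ 1 \<le> q $ 1" "q $ 1 \<le> s $ 1"
  shows "dist q p + dist q s \<le> 2 * sqrt 2 * R"
proof -
  have "(dist q p)\<^sup>2 + (dist q s)\<^sup>2 = (dist p s)\<^sup>2 + 2 * ((p - q) \<bullet> (s - q))"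
  proof -
    have "p - s = (p - q) - (s - q)" by simp
    then have "(dist p s)\<^sup>2 = (norm (p - q))\<^sup>2 + (norm (s - q))\<^sup>2 - 2 * ((p - q) \<bullet> (s - q))"
      unfolding dist_norm by (simp only: power2_norm_eq_inner inner_diff_left[of "p - q" "s - q"]
          inner_diff_right[of _ "p - q" "s - q"] inner_commute)
    then show ?thesis by (simp add: dist_norm norm_minus_commute)
  qed
  also have "\<dots> \<le> (2 * R)\<^sup>2"
  proof -
    have "dist p s \<le> 2 * R" using norms norm_triangle_ineq4[of p s] by (simp add: dist_norm)
    then have "(dist p s)\<^sup>2 \<le> (2 * R)\<^sup>2" by (intro power_mono) auto
    then show ?thesis using half_circle_inner_nonpos[OF assms] by simp
  qed
  finally have "(dist q p + dist q s)\<^sup>2 \<le> 2 * (2 * R)\<^sup>2"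
    using sum_squares_bound[of "dist q p" "dist q s"] by (simp add: power2_sum)
  also have "\<dots> = (2 * sqrt 2 * R)\<^sup>2" by (simp add: power_mult_distrib)
  finally show ?thesis
    by (rule power2_le_imp_le) (use norms(1) norm_ge_zero[of p] in simp)
qed

section \<open>Growth of length in concentric discs\<close>

context minimal_set
begin

text \<open>A subset of exactly \<open>k\<close> elements expresses "at least \<open>k\<close>
  points" and also covers circles carrying infinitely many.\<close>

definition many :: "nat \<Rightarrow> plane \<Rightarrow> real \<Rightarrow> bool" where
  "many k x r \<longleftrightarrow> (\<exists>F\<subseteq>K \<inter> sphere x r. finite F \<and> card F = k)"

lemma not_many: "\<not> many (Suc k) x r \<Longrightarrow> finite (K \<inter> sphere x r) \<and> card (K \<inter> sphere x r) \<le> k"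
  unfolding many_def by (metis infinite_arbitrarily_large obtain_subset_with_card_n not_less_eq_eq)

lemma borel_K [measurable]: "K \<in> sets borel"
  using closed_K by simp

lemma finite_measure_ball: "hausdorff1 (K \<inter> ball x r) < \<infinity>"
proof -
  have "K \<inter> ball x r \<subseteq> K \<inter> ball 0 (norm x + \<bar>r\<bar> + 1)"
  proof
    fix z assume "z \<in> K \<inter> ball x r"
    then show "z \<in> K \<inter> ball 0 (norm x + \<bar>r\<bar> + 1)"
      using norm_triangle_sub[of z x] abs_ge_self[of r] by (simp add: dist_norm norm_minus_commute)
  qed
  then have "hausdorff1 (K \<inter> ball x r) \<le> hausdorff1 (K \<inter> ball 0 (norm x + \<bar>r\<bar> + 1))"
    by (rule hausdorff1_mono)
  also have "\<dots> \<le> ennreal ((norm x + \<bar>r\<bar> + 1) / (1 - 1/2) * pi)"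
    by (rule measure_ball_le) (auto intro: add_nonneg_pos)
  finally show ?thesis by (rule le_less_trans) simp
qed

definition mass :: "plane \<Rightarrow> real \<Rightarrow> real" where
  "mass x r = enn2real (hausdorff1 (K \<inter> ball x r))"

lemma ennreal_mass: "ennreal (mass x r) = hausdorff1 (K \<inter> ball x r)"
  unfolding mass_def using finite_measure_ball[of x r] by (simp add: less_top)

lemma mass_nonneg: "0 \<le> mass x r" by (simp add: mass_def)

lemma mass_leI: "hausdorff1 (K \<inter> ball x r) \<le> ennreal c \<Longrightarrow> 0 \<le> c \<Longrightarrow> mass x r \<le> c"
  using ennreal_mass[of x r] by (metis ennreal_le_iff)

lemma mass_mono: "ball x r \<subseteq> ball y s \<Longrightarrow> mass x r \<le> mass y s"
  using hausdorff1_mono[of "K \<inter> ball x r" "K \<inter> ball y s"] mass_nonneg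
  by (intro mass_leI) (auto simp: ennreal_mass)

lemma mass_growth:
  assumes "r \<le> s" and many: "\<And>t. r < t \<Longrightarrow> t < s \<Longrightarrow> many k x t"
  shows "mass x r + real k * (s - r) \<le> mass x s"
proof -
  have ball: "ball x t = {y. dist x y < t}" for t by auto
  have "hausdorff1 (K \<inter> {y. dist x y < r}) + ennreal (real k * (s - r)) \<le> hausdorff1 (K \<inter> {y. dist x y < s})"
  proof (rule hausdorff1_growth[OF borel_K dist_dist_le \<open>r \<le> s\<close>])
    fix t assume "r < t" "t < s"
    then obtain F where F: "F \<subseteq> K \<inter> sphere x t" "finite F" "card F = k"
      using many unfolding many_def by blast
    then show "\<exists>F\<subseteq>K. dist x ` F \<subseteq> {t} \<and> finite F \<and> card F = k"
      by (intro exI[of _ F]) auto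
  qed
  then have "ennreal (mass x r + real k * (s - r)) \<le> ennreal (mass x s)"
    using \<open>r \<le> s\<close> mass_nonneg by (simp add: ball[symmetric] ennreal_mass[symmetric] ennreal_plus)
  then show ?thesis using mass_nonneg by (simp add: ennreal_le_iff)
qed

lemma cone_mass_le:
  assumes "p \<in> K" "p \<in> sphere x r" "finite (K \<inter> sphere x r)"
  shows "mass x r \<le> (\<Sum>q\<in>K \<inter> sphere x r - {p}. dist p q)"
proof (rule mass_leI)
  have "hausdorff1 (K \<inter> ball x r) \<le> hausdorff1 (\<Union>q\<in>K \<inter> sphere x r. closed_segment p q)"
    using assms by (intro cone_competitor)
  also have "\<dots> \<le> (\<Sum>q\<in>K \<inter> sphere x r. hausdorff1 (closed_segment p q))"
    by (rule hausdorff1_UN_finite_le[OF assms(3)])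
  also have "\<dots> \<le> (\<Sum>q\<in>K \<inter> sphere x r. ennreal (dist p q))"
    by (intro sum_mono hausdorff1_closed_segment_le)
  also have "\<dots> = ennreal (\<Sum>q\<in>K \<inter> sphere x r. dist p q)" by (rule sum_ennreal) simp
  also have "(\<Sum>q\<in>K \<inter> sphere x r. dist p q) = (\<Sum>q\<in>K \<inter> sphere x r - {p}. dist p q)"
    using assms by (subst sum.remove[of _ p]) auto
  finally show "hausdorff1 (K \<inter> ball x r) \<le> ennreal (\<Sum>q\<in>K \<inter> sphere x r - {p}. dist p q)" .
qed (auto intro: sum_nonneg)

lemma mass_two:
  assumes "0 < r" "\<not> many 2 x r"
  shows "mass x r = 0"
proof (cases "K \<inter> sphere x r = {}")
  case True
  then show ?thesis using sphere_disjoint_measure_zero[OF assms(1)] by (simp add: mass_def)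
next
  case False
  then obtain p where p: "p \<in> K \<inter> sphere x r" by blast
  have fin: "finite (K \<inter> sphere x r)" "card (K \<inter> sphere x r) \<le> 1"
    using not_many[of 1 x r] assms(2) by (simp_all add: numeral_2_eq_2)
  then have e: "K \<inter> sphere x r - {p} = {}" using p card_le_Suc0_iff_eq[OF fin(1)] by auto
  have "mass x r \<le> 0" using cone_mass_le[of p x r] p fin(1) unfolding e by simp
  then show ?thesis using mass_nonneg[of x r] by simp
qed

text \<open>The chord is retained instead of its bound \<open>2 * r\<close>: once the length is
  known to be \<open>2 * r\<close>, the chord forces \<open>p\<close> and \<open>q\<close> to be
  antipodal.\<close>

lemma mass_three:
  assumes "0 < r" "\<not> many 3 x r"
  obtains p q where "p \<in> K \<inter> sphere x r" "q \<in> K \<inter> sphere x r" "mass x r \<le> dist p q"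
    | "mass x r = 0"
proof (cases "many 2 x r")
  case True
  then obtain F where F: "F \<subseteq> K \<inter> sphere x r" "card F = 2" unfolding many_def by blast
  then obtain p q where pq: "F = {p, q}" "p \<noteq> q" by (auto simp: card_2_iff)
  have fin: "finite (K \<inter> sphere x r)" "card (K \<inter> sphere x r) \<le> 2"
    using not_many[of 2 x r] assms(2) by (simp_all add: numeral_3_eq_3)
  then have eq: "K \<inter> sphere x r = {p, q}" using F pq by (metis card_seteq)
  have in_K: "p \<in> K \<inter> sphere x r" "q \<in> K \<inter> sphere x r" unfolding eq by auto
  have "K \<inter> sphere x r - {p} = {q}" using eq pq(2) by auto
  then have "mass x r \<le> dist p q" using cone_mass_le[of p x r] in_K(1) fin(1) by simp
  with in_K show ?thesis by (rule that(1))
next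
  case False
  then show ?thesis using mass_two[OF assms(1)] that(2) by blast
qed

lemma mass_le_two_radii:
  assumes "0 < r" "\<not> many 3 x r"
  shows "mass x r \<le> 2 * r"
proof -
  have "dist p q \<le> 2 * r" if "p \<in> sphere x r" "q \<in> sphere x r" for p q
    using dist_triangle3[of p q x] that by simp
  then show ?thesis using mass_three[OF assms] assms(1)
    by (metis IntD2 less_eq_real_def mult_nonneg_nonneg order_trans zero_le_numeral)
qed

text \<open>The apex of the cone is the middle one of the three points in the order of the first
  coordinate, for there the angle is not acute.\<close>

lemma mass_four_origin:
  assumes "0 < R" "many 3 0 R" "\<not> many 4 0 R"
  shows "mass 0 R \<le> 2 * sqrt 2 * R"
proof -
  obtain F where F: "F \<subseteq> K \<inter> sphere 0 R" "card F = 3" using assms(2) unfolding many_def by blast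
  have fin: "finite (K \<inter> sphere 0 R)" "card (K \<inter> sphere 0 R) \<le> 3"
    using not_many[of 3 0 R] assms(3) by (simp_all add: eval_nat_numeral)
  then have eq: "K \<inter> sphere 0 R = F" using F by (metis card_seteq)
  obtain a b c where abc: "F = {a, b, c}" "a \<noteq> b" "b \<noteq> c" "a \<noteq> c"
    using F(2) by (auto simp: card_3_iff)
  have key: ?thesis
    if pqs: "F = {p, q, s}" "p \<noteq> q" "q \<noteq> s" "p \<noteq> s" "p $ 1 \<le> q $ 1" "q $ 1 \<le> s $ 1" for p q s
  proof -
    have in_K: "z \<in> K" "norm z = R" if "z \<in> {p, q, s}" for z
      using that F(1) pqs(1) by auto
    have "mass 0 R \<le> (\<Sum>z\<in>K \<inter> sphere 0 R - {q}. dist q z)"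
      by (rule cone_mass_le) (use in_K[of q] fin in auto)
    also have "K \<inter> sphere 0 R - {q} = {p, s}" using eq pqs by auto
    also have "(\<Sum>z\<in>{p, s}. dist q z) = dist q p + dist q s" using pqs by simp
    also have "\<dots> \<le> 2 * sqrt 2 * R"
      by (rule half_circle_dist_sum) (simp_all add: in_K upper pqs(5,6))
    finally show ?thesis .
  qed
  consider "a $ 1 \<le> b $ 1" "b $ 1 \<le> c $ 1" | "a $ 1 \<le> c $ 1" "c $ 1 \<le> b $ 1"
    | "b $ 1 \<le> a $ 1" "a $ 1 \<le> c $ 1" | "b $ 1 \<le> c $ 1" "c $ 1 \<le> a $ 1"
    | "c $ 1 \<le> a $ 1" "a $ 1 \<le> b $ 1" | "c $ 1 \<le> b $ 1" "b $ 1 \<le> a $ 1" by linarith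
  then show ?thesis
  proof cases
    case 1 show ?thesis by (rule key[of a b c]) (use abc 1 in auto)
  next
    case 2 show ?thesis by (rule key[of a c b]) (use abc 2 in auto)
  next
    case 3 show ?thesis by (rule key[of b a c]) (use abc 3 in auto)
  next
    case 4 show ?thesis by (rule key[of b c a]) (use abc 4 in auto)
  next
    case 5 show ?thesis by (rule key[of c a b]) (use abc 5 in auto)
  next
    case 6 show ?thesis by (rule key[of c b a]) (use abc 6 in auto)
  qed
qed

lemma few_points_origin: "\<exists>R>R0. \<not> many 3 0 R"
proof (rule ccontr)
  assume "\<not> ?thesis"
  then have m3: "many 3 0 R" if "R0 < R" for R using that by blast
  define R1 where "R1 = max R0 1"
  have lower3: "3 * (R - R1) \<le> mass 0 R" if "R1 \<le> R" for R
    using mass_growth[of R1 R 3 0] m3 mass_nonneg[of 0 R1] that by (simp add: R1_def)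
  \<comment> \<open>Half of the gap between \<pi> and 4 is given to the perturbed cut:
    \<open>4 * (1 - e)\<close> is \<open>(4 + pi) / 2\<close>, which exceeds
    \<open>pi\<close>.\<close>
  define e where "e = (4 - pi) / 8"
  have e: "0 < e" using pi_less_4 by (simp add: e_def)
  have e': "e < 1" using less_trans[of "- pi" 0 4] by (simp add: e_def)
  define \<kappa> where "\<kappa> = pi / (1 - e)"
  have "\<kappa> < 4"
  proof -
    have "a < 4 * (1 - (4 - a) / 8)" if "a < 4" for a :: real using that by (simp add: field_simps)
    then have "pi < 4 * (1 - e)" using pi_less_4 unfolding e_def .
    then show ?thesis using e' by (simp add: \<kappa>_def field_simps)
  qed
  have up: "mass 0 R \<le> \<kappa> * R" if "0 < R" for R
  proof (rule mass_leI)
    have "R / (1 - e) * pi = \<kappa> * R" by (simp add: \<kappa>_def)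
    then show "hausdorff1 (K \<inter> ball 0 R) \<le> ennreal (\<kappa> * R)"
      using measure_ball_le[OF that e e'] by simp
    show "0 \<le> \<kappa> * R" using that e' by (simp add: \<kappa>_def)
  qed
  have "\<exists>R>S. \<not> many 4 0 R" for S
  proof (rule ccontr)
    assume "\<not> ?thesis"
    then have m4: "many 4 0 R" if "S < R" for R using that by blast
    define S1 where "S1 = max S 1"
    \<comment> \<open>At this radius \<open>(4 - \<kappa>) * R\<close> exceeds
      \<open>4 * S1\<close>, so growth at rate 4 from \<open>S1\<close> on has overtaken the bound
      \<open>\<kappa> * R\<close>.\<close>
    define R where "R = S1 + (4 * S1) / (4 - \<kappa>)"
    have R: "S1 < R" "0 < R" using \<open>\<kappa> < 4\<close> by (auto simp: R_def S1_def intro: add_pos_pos)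
    have "4 * (R - S1) \<le> mass 0 R"
      using mass_growth[of S1 R 4 0] m4 mass_nonneg[of 0 S1] R by (simp add: S1_def)
    then have "4 * (R - S1) \<le> \<kappa> * R" using up[OF R(2)] by linarith
    then have "(4 - \<kappa>) * R \<le> 4 * S1" by (simp add: algebra_simps)
    moreover have "(4 - \<kappa>) * R = (4 - \<kappa>) * S1 + 4 * S1"
      using \<open>\<kappa> < 4\<close> unfolding R_def distrib_left by simp
    moreover have "0 < (4 - \<kappa>) * S1" using \<open>\<kappa> < 4\<close> by (simp add: S1_def)
    ultimately show False by linarith
  qed
  \<comment> \<open>Beyond the first bound, growth at rate 3 from \<open>R1\<close> on exceeds
    \<open>2 * sqrt 2 * R\<close>; beyond \<open>R1\<close> the circle has at least three points, so
    \<open>mass_four_origin\<close> applies.\<close>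
  then obtain R where R: "max (3 * R1 / (3 - 2 * sqrt 2)) R1 < R" "\<not> many 4 0 R" by blast
  have sq: "2 * sqrt 2 < (3 :: real)"
  proof -
    have "sqrt 2 < sqrt ((3/2)\<^sup>2)" by (rule real_sqrt_less_mono) (simp add: power2_eq_square)
    then show ?thesis by simp
  qed
  have "0 < R" using R(1) by (simp add: R1_def)
  have "mass 0 R \<le> 2 * sqrt 2 * R"
    using R m3[of R] \<open>0 < R\<close> by (intro mass_four_origin) (auto simp: R1_def)
  then have "3 * (R - R1) \<le> 2 * sqrt 2 * R" using lower3[of R] R(1) by simp
  then have "(3 - 2 * sqrt 2) * R \<le> 3 * R1" by (simp add: algebra_simps)
  then have "R \<le> 3 * R1 / (3 - 2 * sqrt 2)" using sq by (simp add: field_simps)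
  then show False using R(1) by simp
qed

lemma many_two:
  assumes "x \<in> K" "0 < r"
  shows "many 2 x r"
proof (rule ccontr)
  assume "\<not> many 2 x r"
  then have "mass x r = 0" using mass_two assms(2) by blast
  then show False using normalized[OF assms] ennreal_mass[of x r] by simp
qed

lemma few_points:
  assumes "x \<in> K"
  shows "\<exists>s>s0. \<not> many 3 x s"
proof (rule ccontr)
  assume "\<not> ?thesis"
  then have m3: "many 3 x s" if "s0 < s" for s using that by blast
  define s1 where "s1 = max s0 0"
  \<comment> \<open>The disc of radius \<open>R - norm x\<close> about \<open>x\<close> lies in the
    disc of radius \<open>R\<close> about the origin. Rate 3 about \<open>x\<close> would thus give
    \<open>3 * (R - norm x - s1) \<le> 2 * R\<close>, which fails for this \<open>R\<close>.\<close>
  obtain R where R: "3 * norm x + 3 * s1 + 1 < R" "\<not> many 3 0 R" using few_points_origin by blast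
  have s1: "0 \<le> s1" by (simp add: s1_def)
  have "0 < R" using R(1) s1 norm_ge_zero[of x] by linarith
  have le: "s1 \<le> R - norm x" using R(1) s1 norm_ge_zero[of x] by linarith
  have "3 * (R - norm x - s1) \<le> mass x (R - norm x)"
    using mass_growth[of s1 "R - norm x" 3 x] m3 mass_nonneg[of x s1] le by (simp add: s1_def)
  also have "\<dots> \<le> mass 0 R"
  proof (rule mass_mono)
    show "ball x (R - norm x) \<subseteq> ball 0 R"
    proof
      fix z assume "z \<in> ball x (R - norm x)"
      then show "z \<in> ball 0 R"
        using norm_triangle_sub[of z x] by (simp add: dist_norm norm_minus_commute)
    qed
  qed
  also have "\<dots> \<le> 2 * R" using mass_le_two_radii[OF \<open>0 < R\<close> R(2)] .
  finally show False using R(1) by (simp add: algebra_simps)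
qed

text \<open>Two points on every circle make \<open>mass x r - 2 * r\<close> nondecreasing in
  \<open>r\<close>. It is nonnegative at radius 0 and at most 0 for arbitrarily large radii, so it
  vanishes throughout.\<close>

lemma mass_eq:
  assumes "x \<in> K" "0 < r"
  shows "mass x r = 2 * r"
proof (rule antisym)
  obtain s where s: "r < s" "\<not> many 3 x s" using few_points[OF assms(1)] by blast
  have "mass x r + 2 * (s - r) \<le> mass x s"
    using mass_growth[of r s 2 x] many_two[OF assms(1)] assms(2) s(1) by simp
  also have "\<dots> \<le> 2 * s" using s assms(2) by (intro mass_le_two_radii) auto
  finally show "mass x r \<le> 2 * r" by simp
  show "2 * r \<le> mass x r"
    using mass_growth[of 0 r 2 x] many_two[OF assms(1)] assms(2) mass_nonneg[of x 0] by simp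
qed

text \<open>Three points on all these circles would make the length grow at rate 3 instead of 2. On
  a circle with fewer, two points are at least a diameter apart, and the parallelogram identity
  makes them antipodal.\<close>

lemma antipodal_dense:
  assumes x: "x \<in> K" and ab: "0 < a" "a < b"
  shows "\<exists>s p. a < s \<and> s < b \<and> p \<in> K \<and> 2 *\<^sub>R x - p \<in> K \<and> dist x p = s"
proof -
  have "\<exists>s. a < s \<and> s < b \<and> \<not> many 3 x s"
  proof (rule ccontr)
    assume "\<not> ?thesis"
    then have "mass x a + 3 * (b - a) \<le> mass x b"
      using mass_growth[of a b 3 x] ab by simp
    then show False using mass_eq[OF x, of a] mass_eq[OF x, of b] ab by simp
  qed
  then obtain s where s: "a < s" "s < b" "\<not> many 3 x s" by blast
  have ms: "mass x s = 2 * s" using mass_eq[OF x] s ab by simp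
  have "0 < s" using s ab by simp
  then obtain p q where pq: "p \<in> K \<inter> sphere x s" "q \<in> K \<inter> sphere x s" "2 * s \<le> dist p q"
    using mass_three[OF \<open>0 < s\<close> s(3)] ms by (metis less_irrefl mult_pos_pos zero_less_numeral)
  have "q = 2 *\<^sub>R x - p"
  proof -
    have n: "norm (p - x) = s" "norm (q - x) = s" "2 * s \<le> norm (p - q)"
      using pq by (auto simp: dist_norm norm_minus_commute)
    have "(norm (a + b))\<^sup>2 + (norm (a - b))\<^sup>2 = 2 * (norm a)\<^sup>2 + 2 * (norm b)\<^sup>2" for a b :: plane
      by (simp add: power2_norm_eq_inner inner_simps inner_commute)
    from this[of "p - x" "q - x"]
    have "(norm ((p - x) + (q - x)))\<^sup>2 + (norm ((p - x) - (q - x)))\<^sup>2 = 2 * s\<^sup>2 + 2 * s\<^sup>2"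
      unfolding n(1,2) .
    moreover have "(2 * s)\<^sup>2 \<le> (norm ((p - x) - (q - x)))\<^sup>2"
      using n \<open>0 < s\<close> by (intro power_mono) auto
    moreover have "(2 * s)\<^sup>2 = 2 * s\<^sup>2 + 2 * s\<^sup>2" by (simp add: power_mult_distrib)
    ultimately have "(norm ((p - x) + (q - x)))\<^sup>2 \<le> 0" by linarith
    then have "(p - x) + (q - x) = 0" by simp
    then show ?thesis by (simp add: scaleR_2 algebra_simps)
  qed
  then show ?thesis using pq s by (intro exI[of _ s] exI[of _ p]) auto
qed

text \<open>The points belonging to antipodal pairs form a closed set, so their distances from
  \<open>x\<close> within a bounded range form a closed set too; being dense, it contains
  \<open>r\<close>.\<close>

lemma antipodal:
  assumes x: "x \<in> K" and "0 < r"
  obtains p where "p \<in> K" "2 *\<^sub>R x - p \<in> K" "dist x p = r"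
proof -
  define G where "G = {p \<in> K. 2 *\<^sub>R x - p \<in> K}"
  have "closed ((\<lambda>p. 2 *\<^sub>R x - p) -` K)"
    by (rule closed_vimage[OF closed_K]) (intro continuous_intros)
  then have "closed G" using closed_K unfolding G_def by (simp add: vimage_def closed_Collect_conj closed_Int Collect_conj_eq)
  then have "compact (dist x ` (G \<inter> cball x (r + 1)))"
    by (intro compact_continuous_image continuous_intros closed_Int_compact) auto
  then have cl: "closed (dist x ` (G \<inter> cball x (r + 1)))" by (rule compact_imp_closed)
  have "r \<in> closure (dist x ` (G \<inter> cball x (r + 1)))"
    unfolding closure_approachable
  proof (intro allI impI)
    fix e :: real assume "0 < e"
    have "0 < max (r - e) (r / 2)" "max (r - e) (r / 2) < min (r + e) (r + 1)"
      using \<open>0 < r\<close> \<open>0 < e\<close> by (simp_all add: less_max_iff_disj)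
    then obtain s p where sp: "max (r - e) (r / 2) < s" "s < min (r + e) (r + 1)"
      "p \<in> K" "2 *\<^sub>R x - p \<in> K" "dist x p = s"
      using antipodal_dense[OF x] by blast
    then have "p \<in> G \<inter> cball x (r + 1)" by (simp add: G_def)
    then show "\<exists>y\<in>dist x ` (G \<inter> cball x (r + 1)). dist y r < e"
      using sp by (intro bexI[of _ s]) (auto simp: dist_real_def)
  qed
  then obtain p where "p \<in> G" "r = dist x p" using closure_closed[OF cl] by auto
  then show ?thesis using that by (auto simp: G_def)
qed

end

section \<open>Rigidity\<close>

text \<open>For \<open>\<delta> = 0\<close> the two circles touch at the point \<open>x + (r\<^sub>0 / d) (y - x)\<close>.\<close>

lemma tangent_circles:
  fixes x y :: "'a::real_inner"
  assumes d: "d = dist x y" "0 < d" and r0: "0 < r0" "r0 < 2 * d" and "0 < \<eta>"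
  obtains \<delta> where "0 < \<delta>" "\<bar>r0 - d\<bar> + \<delta> \<le> d"
    "\<And>z. \<bar>dist x z - r0\<bar> < \<delta> \<Longrightarrow> dist y z < \<bar>r0 - d\<bar> + \<delta> \<Longrightarrow>
      dist (x + (r0 / d) *\<^sub>R (y - x)) z < \<eta>"
proof -
  define s0 where "s0 = \<bar>r0 - d\<bar>"
  define q where "q = r0 / d"
  have q: "0 < q" "q * d = r0" using d r0 by (auto simp: q_def)
  have s0: "0 \<le> s0" "s0 < d" using r0 by (auto simp: s0_def)
  define C where "C = \<bar>1 - q\<bar> * (2 * r0 + 1) + q * (2 * s0 + 1)"
  have C: "0 \<le> C" using q s0 r0 by (simp add: C_def)
  define \<delta> where "\<delta> = min (min 1 (d - s0)) (\<eta>\<^sup>2 / (C + 1))"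
  have \<delta>: "0 < \<delta>" "\<delta> \<le> 1" "\<delta> \<le> d - s0" "\<delta> \<le> \<eta>\<^sup>2 / (C + 1)"
    using s0 C \<open>0 < \<eta>\<close> by (auto simp: \<delta>_def)
  have near: "dist (x + q *\<^sub>R (y - x)) z < \<eta>"
    if z: "\<bar>dist x z - r0\<bar> < \<delta>" "dist y z < s0 + \<delta>" for z
  proof -
    define a where "a = z - x"
    define w where "w = y - x"
    define r where "r = dist x z"
    have r: "0 \<le> r" "\<bar>r - r0\<bar> < \<delta>" using z(1) by (auto simp: r_def)
    have aa: "a \<bullet> a = r\<^sup>2" by (simp add: a_def r_def dist_norm norm_minus_commute flip: power2_norm_eq_inner)
    have ww: "w \<bullet> w = d\<^sup>2" by (simp add: w_def d dist_norm norm_minus_commute flip: power2_norm_eq_inner)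
    have "(dist y z)\<^sup>2 = (a - w) \<bullet> (a - w)"
      by (simp add: a_def w_def dist_norm norm_minus_commute flip: power2_norm_eq_inner)
    also have "\<dots> = r\<^sup>2 - 2 * (a \<bullet> w) + d\<^sup>2"
      using aa ww by (simp add: inner_diff inner_commute)
    finally have yz: "(dist y z)\<^sup>2 = r\<^sup>2 - 2 * (a \<bullet> w) + d\<^sup>2" .
    have "(dist y z)\<^sup>2 \<le> (s0 + \<delta>)\<^sup>2" using z(2) by (intro power_mono) auto
    then have "r\<^sup>2 + d\<^sup>2 - (s0 + \<delta>)\<^sup>2 \<le> 2 * (a \<bullet> w)" using yz by linarith
    then have aw: "q * (r\<^sup>2 + d\<^sup>2 - (s0 + \<delta>)\<^sup>2) \<le> q * (2 * (a \<bullet> w))"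
      using q by (intro mult_left_mono) auto
    have "(dist (x + q *\<^sub>R (y - x)) z)\<^sup>2 = (a - q *\<^sub>R w) \<bullet> (a - q *\<^sub>R w)"
    proof -
      have "z - (x + q *\<^sub>R (y - x)) = a - q *\<^sub>R w" by (simp add: a_def w_def)
      then show ?thesis by (metis dist_commute dist_norm power2_norm_eq_inner)
    qed
    also have "\<dots> = a \<bullet> a - q * (2 * (a \<bullet> w)) + q * q * (w \<bullet> w)"
      by (simp add: inner_diff inner_commute algebra_simps)
    also have "\<dots> = r\<^sup>2 - q * (2 * (a \<bullet> w)) + r0\<^sup>2"
      unfolding aa ww q(2)[symmetric] by (simp add: power2_eq_square)
    also have "\<dots> \<le> r\<^sup>2 - q * (r\<^sup>2 + d\<^sup>2 - (s0 + \<delta>)\<^sup>2) + r0\<^sup>2" using aw by simp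
    \<comment> \<open>In this form the bound visibly vanishes in the tangent case
      \<open>r = r0\<close>, \<open>\<delta> = 0\<close>, and the deviations contribute terms of
      order \<open>\<delta>\<close>.\<close>
    also have "\<dots> = (1 - q) * (r\<^sup>2 - r0\<^sup>2) + q * ((s0 + \<delta>)\<^sup>2 - s0\<^sup>2)"
    proof -
      have e: "s0\<^sup>2 = r0\<^sup>2 + d\<^sup>2 - 2 * r0 * d" by (simp add: s0_def power2_diff)
      have "q * s0\<^sup>2 = q * r0\<^sup>2 - 2 * r0 * (q * d) + q * d\<^sup>2"
        unfolding e by (simp add: algebra_simps)
      then have "q * s0\<^sup>2 = q * r0\<^sup>2 - 2 * r0\<^sup>2 + q * d\<^sup>2" unfolding q(2) by (simp add: power2_eq_square)
      then show ?thesis by (simp add: algebra_simps)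
    qed
    also have "\<dots> \<le> \<bar>1 - q\<bar> * (\<delta> * (2 * r0 + 1)) + q * (\<delta> * (2 * s0 + 1))"
    proof (rule add_mono)
      have "\<bar>r\<^sup>2 - r0\<^sup>2\<bar> = \<bar>r - r0\<bar> * (r + r0)"
        using r r0 by (simp add: power2_eq_square square_diff_square_factored abs_mult)
      also have "\<dots> \<le> \<delta> * (2 * r0 + 1)"
        using r r0 \<delta> by (intro mult_mono) (auto simp: abs_less_iff)
      finally have "\<bar>1 - q\<bar> * \<bar>r\<^sup>2 - r0\<^sup>2\<bar> \<le> \<bar>1 - q\<bar> * (\<delta> * (2 * r0 + 1))"
        by (rule mult_left_mono) simp
      then show "(1 - q) * (r\<^sup>2 - r0\<^sup>2) \<le> \<bar>1 - q\<bar> * (\<delta> * (2 * r0 + 1))"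
        using abs_ge_self[of "(1 - q) * (r\<^sup>2 - r0\<^sup>2)"] by (simp add: abs_mult)
      have "(s0 + \<delta>)\<^sup>2 - s0\<^sup>2 = \<delta> * (2 * s0 + \<delta>)" by (simp add: power2_eq_square algebra_simps)
      also have "\<dots> \<le> \<delta> * (2 * s0 + 1)" using \<delta> by (intro mult_left_mono) auto
      finally show "q * ((s0 + \<delta>)\<^sup>2 - s0\<^sup>2) \<le> q * (\<delta> * (2 * s0 + 1))"
        using q by (intro mult_left_mono) auto
    qed
    also have "\<dots> = C * \<delta>" by (simp add: C_def algebra_simps)
    also have "\<dots> < (C + 1) * \<delta>" using \<delta> by simp
    also have "\<dots> \<le> (C + 1) * (\<eta>\<^sup>2 / (C + 1))" using \<delta>(4) C by (intro mult_left_mono) auto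
    also have "\<dots> = \<eta>\<^sup>2" using C by simp
    finally show ?thesis using \<open>0 < \<eta>\<close> by (simp add: power2_less_imp_less)
  qed
  show thesis
    by (rule that[of \<delta>]) (use \<delta> near in \<open>auto simp: s0_def q_def\<close>)
qed

context minimal_set
begin

text \<open>Every circle about \<open>x\<close> contains an antipodal pair of \<open>K\<close>. The ball of radius \<open>s\<close> about \<open>y\<close> contains
  at most one point of such a pair, and none for the radii near \<open>r\<^sub>0\<close> if the claim fails. This makes
  \<open>K - ball y s\<close> longer than the value \<open>2 (d + s) - 2 s\<close> enforced by \<open>mass_eq\<close>.\<close>

lemma extended_segment:
  assumes x: "x \<in> K" and y: "y \<in> K" and "x \<noteq> y" and t: "0 < t" "t < 2"
  shows "x + t *\<^sub>R (y - x) \<in> K"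
proof (rule ccontr)
  define d where "d = dist x y"
  have "0 < d" using \<open>x \<noteq> y\<close> by (simp add: d_def)
  define r0 where "r0 = t * d"
  have r0: "0 < r0" "r0 < 2 * d" "r0 / d = t" using t \<open>0 < d\<close> by (auto simp: r0_def)
  assume "x + t *\<^sub>R (y - x) \<notin> K"
  then obtain \<eta> where \<eta>: "0 < \<eta>" "ball (x + t *\<^sub>R (y - x)) \<eta> \<subseteq> - K"
    using closed_K open_contains_ball[of "- K"] by auto
  obtain \<delta> where \<delta>: "0 < \<delta>" "\<bar>r0 - d\<bar> + \<delta> \<le> d"
    "\<And>z. \<bar>dist x z - r0\<bar> < \<delta> \<Longrightarrow> dist y z < \<bar>r0 - d\<bar> + \<delta> \<Longrightarrow> dist (x + t *\<^sub>R (y - x)) z < \<eta>"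
    using tangent_circles[OF d_def \<open>0 < d\<close> r0(1,2) \<eta>(1)] unfolding r0(3) by blast
  \<comment> \<open>Slightly more than tangency: radii within \<open>\<delta>\<close> of
    \<open>r0\<close> lie between \<open>d - s\<close> and \<open>d + s\<close>, yet such circles
    meet the disc about \<open>y\<close> only near the point assumed to be missing.
    \<open>s \<le> d\<close> keeps \<open>x\<close> out of this disc.\<close>
  define s where "s = \<bar>r0 - d\<bar> + \<delta>"
  have s: "0 < s" "s \<le> d" "d - s \<le> r0 - \<delta>" "r0 + \<delta> \<le> d + s" using \<delta>(1,2) by (auto simp: s_def)
  define A where "A = K - ball y s"
  have A_borel: "A \<in> sets borel" by (simp add: A_def)
  define h where "h b = enn2real (hausdorff1 (A \<inter> ball x b))" for b
  have h: "ennreal (h b) = hausdorff1 (A \<inter> ball x b)" for b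
  proof -
    have "hausdorff1 (A \<inter> ball x b) \<le> hausdorff1 (K \<inter> ball x b)"
      by (rule hausdorff1_mono) (auto simp: A_def)
    also have "\<dots> < \<infinity>" by (rule finite_measure_ball)
    finally show ?thesis unfolding h_def by (simp add: less_top)
  qed
  have h_nonneg: "0 \<le> h b" for b by (simp add: h_def)
  have growth: "h b + real k * (c - b) \<le> h c"
    if "b \<le> c" and slices: "\<And>r. b < r \<Longrightarrow> r < c \<Longrightarrow> \<exists>F\<subseteq>A \<inter> sphere x r. finite F \<and> card F = k" for b c k
  proof -
    have ball: "ball x t = {y. dist x y < t}" for t by auto
    have "hausdorff1 (A \<inter> {y. dist x y < b}) + ennreal (real k * (c - b)) \<le> hausdorff1 (A \<inter> {y. dist x y < c})"
    proof (rule hausdorff1_growth[OF A_borel dist_dist_le \<open>b \<le> c\<close>])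
      fix r assume "b < r" "r < c"
      then obtain F where "F \<subseteq> A \<inter> sphere x r" "finite F" "card F = k" using slices by blast
      then show "\<exists>F\<subseteq>A. dist x ` F \<subseteq> {r} \<and> finite F \<and> card F = k" by (intro exI[of _ F]) auto
    qed
    then have "ennreal (h b + real k * (c - b)) \<le> ennreal (h c)"
      using \<open>b \<le> c\<close> h_nonneg by (simp add: ball[symmetric] h[symmetric] ennreal_plus)
    then show ?thesis using h_nonneg by (simp add: ennreal_le_iff)
  qed
  have two: "\<exists>F\<subseteq>A \<inter> sphere x r. finite F \<and> card F = 2"
    if "0 < r" and out: "\<And>z. z \<in> K \<Longrightarrow> dist x z = r \<Longrightarrow> z \<notin> ball y s" for r
  proof -
    obtain p where p: "p \<in> K" "2 *\<^sub>R x - p \<in> K" "dist x p = r" using antipodal[OF x \<open>0 < r\<close>] .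
    have "dist x (2 *\<^sub>R x - p) = r" using p(3) by (simp add: dist_norm scaleR_2 norm_minus_commute)
    moreover have "p \<noteq> 2 *\<^sub>R x - p"
    proof
      assume "p = 2 *\<^sub>R x - p"
      then have "2 *\<^sub>R x = 2 *\<^sub>R p" by (simp add: scaleR_2 algebra_simps)
      then show False using p(3) \<open>0 < r\<close> by simp
    qed
    ultimately show ?thesis using p out by (intro exI[of _ "{p, 2 *\<^sub>R x - p}"]) (auto simp: A_def)
  qed
  have one: "\<exists>F\<subseteq>A \<inter> sphere x r. finite F \<and> card F = 1" if "0 < r" for r
  proof -
    obtain p where p: "p \<in> K" "2 *\<^sub>R x - p \<in> K" "dist x p = r" using antipodal[OF x \<open>0 < r\<close>] .
    have r: "dist x (2 *\<^sub>R x - p) = r" using p(3) by (simp add: dist_norm scaleR_2 norm_minus_commute)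
    \<comment> \<open>\<open>x\<close> is the midpoint of the pair, and the convex disc about
      \<open>y\<close> does not contain it.\<close>
    have "p \<notin> ball y s \<or> 2 *\<^sub>R x - p \<notin> ball y s"
    proof (rule ccontr)
      assume "\<not> ?thesis"
      then have "(1/2) *\<^sub>R p + (1/2) *\<^sub>R (2 *\<^sub>R x - p) \<in> ball y s"
        using convex_ball[of y s] unfolding convex_def by auto
      also have "(1/2) *\<^sub>R p + (1/2) *\<^sub>R (2 *\<^sub>R x - p) = x" by (simp add: algebra_simps)
      finally show False using s(2) by (simp add: d_def dist_commute)
    qed
    then show ?thesis
    proof
      assume "p \<notin> ball y s"
      then show ?thesis using p by (intro exI[of _ "{p}"]) (auto simp: A_def)
    next
      assume "2 *\<^sub>R x - p \<notin> ball y s"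
      then show ?thesis using p r by (intro exI[of _ "{2 *\<^sub>R x - p}"]) (auto simp: A_def)
    qed
  qed
  \<comment> \<open>Four ranges of radii with 2, 1, 2 and 1 points outside the disc about
    \<open>y\<close>. The gains sum to \<open>2 * d + 2 * \<delta>\<close>; the excess over the
    permitted \<open>2 * d\<close> stems from the window around \<open>r0\<close>.\<close>
  have "h 0 + real 2 * ((d - s) - 0) \<le> h (d - s)"
  proof (rule growth)
    fix r assume r: "0 < r" "r < d - s"
    show "\<exists>F\<subseteq>A \<inter> sphere x r. finite F \<and> card F = 2"
    proof (rule two)
      fix z assume "dist x z = r"
      then show "z \<notin> ball y s"
        using r dist_triangle[of x y z] by (simp add: d_def dist_commute)
    qed (use r in simp)
  qed (use s in simp)
  moreover have "h (d - s) + real 1 * ((r0 - \<delta>) - (d - s)) \<le> h (r0 - \<delta>)"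
  proof (rule growth)
    fix r assume "d - s < r"
    then have "0 < r" using s(2) by simp
    then show "\<exists>F\<subseteq>A \<inter> sphere x r. finite F \<and> card F = 1" by (rule one)
  qed (use s in simp)
  moreover have "h (r0 - \<delta>) + real 2 * ((r0 + \<delta>) - (r0 - \<delta>)) \<le> h (r0 + \<delta>)"
  proof (rule growth)
    fix r assume r: "r0 - \<delta> < r" "r < r0 + \<delta>"
    show "\<exists>F\<subseteq>A \<inter> sphere x r. finite F \<and> card F = 2"
    proof (rule two)
      fix z assume z: "z \<in> K" "dist x z = r"
      then have "\<not> dist (x + t *\<^sub>R (y - x)) z < \<eta>" using \<eta>(2) by (auto simp: subset_eq)
      moreover have "\<bar>dist x z - r0\<bar> < \<delta>" using r z(2) by (simp add: abs_less_iff)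
      ultimately show "z \<notin> ball y s" using \<delta>(3)[of z] by (auto simp: s_def)
    qed (use r s in simp)
  qed (use \<delta>(1) in simp)
  moreover have "h (r0 + \<delta>) + real 1 * ((d + s) - (r0 + \<delta>)) \<le> h (d + s)"
  proof (rule growth)
    fix r assume "r0 + \<delta> < r"
    then have "0 < r" using r0(1) \<delta>(1) by simp
    then show "\<exists>F\<subseteq>A \<inter> sphere x r. finite F \<and> card F = 1" by (rule one)
  qed (use s in simp)
  ultimately have "2 * d + 2 * \<delta> \<le> h (d + s)" using h_nonneg[of 0] by (simp add: algebra_simps)
  moreover have "mass x (d + s) = h (d + s) + mass y s"
  proof -
    have sub: "ball y s \<subseteq> ball x (d + s)"
    proof
      fix z assume "z \<in> ball y s"
      then show "z \<in> ball x (d + s)" using dist_triangle[of x z y] by (simp add: d_def)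
    qed
    have "hausdorff1 (K \<inter> ball x (d + s)) = hausdorff1 ((A \<inter> ball x (d + s)) \<union> (K \<inter> ball y s))"
      by (rule arg_cong[where f=hausdorff1]) (use sub in \<open>auto simp: A_def\<close>)
    also have "\<dots> = hausdorff1 (A \<inter> ball x (d + s)) + hausdorff1 (K \<inter> ball y s)"
      by (rule hausdorff1_add) (use A_borel in \<open>auto simp: A_def\<close>)
    finally have "ennreal (mass x (d + s)) = ennreal (h (d + s) + mass y s)"
      using h_nonneg mass_nonneg by (simp add: h[symmetric] ennreal_mass[symmetric] ennreal_plus)
    then show ?thesis
      by (subst (asm) ennreal_inj) (auto intro: h_nonneg mass_nonneg add_nonneg_nonneg)
  qed
  ultimately show False
    using mass_eq[OF x, of "d + s"] mass_eq[OF y, of s] s(1) \<open>0 < d\<close> \<delta>(1) by simp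
qed

section \<open>From segments to the whole line\<close>

lemma ray:
  assumes x: "x \<in> K" and y: "y \<in> K" and "x \<noteq> y" and "0 \<le> t"
  shows "x + t *\<^sub>R (y - x) \<in> K"
proof (cases "t = 0")
  case False
  then have "0 < t" using \<open>0 \<le> t\<close> by simp
  \<comment> \<open>The factor \<open>3/2\<close> is in the range allowed for \<open>t\<close>, and
    its powers exceed every bound; any point of the ray then lies on a segment from \<open>x\<close>
    to a known point of \<open>K\<close>.\<close>
  have pow: "x + (3/2) ^ n *\<^sub>R (y - x) \<in> K" for n :: nat
  proof (induction n)
    case (Suc n)
    have "x + (3/2) *\<^sub>R ((x + (3/2) ^ n *\<^sub>R (y - x)) - x) \<in> K"
      by (rule extended_segment[OF x Suc.IH]) (use \<open>x \<noteq> y\<close> in auto)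
    then show ?case by simp
  qed (use y in simp)
  obtain n where n: "t < (3/2 :: real) ^ n" using real_arch_pow[of "3/2" t] by auto
  have "t / (3/2) ^ n < 1" using n by (subst divide_less_eq_1_pos) auto
  then have "t / (3/2) ^ n < 2" by linarith
  have "x + (t / (3/2) ^ n) *\<^sub>R ((x + (3/2) ^ n *\<^sub>R (y - x)) - x) \<in> K"
    by (rule extended_segment[OF x pow]) (use \<open>x \<noteq> y\<close> \<open>0 < t\<close> \<open>t / (3/2) ^ n < 2\<close> in simp_all)
  then show ?thesis by simp
qed (use x in simp)

lemma same_height:
  assumes x: "x \<in> K" and y: "y \<in> K"
  shows "y $ 2 \<le> x $ 2"
proof (rule ccontr)
  assume "\<not> ?thesis"
  then have lt: "x $ 2 < y $ 2" by simp
  then have "x \<noteq> y" by auto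
  \<comment> \<open>Chosen so that the ray from the higher point through the lower one is at height
    -1.\<close>
  define t where "t = (y $ 2 + 1) / (y $ 2 - x $ 2)"
  have "0 \<le> t" using lt upper[OF y] by (simp add: t_def)
  then have "y + t *\<^sub>R (x - y) \<in> K" using ray[OF y x] \<open>x \<noteq> y\<close> by blast
  from upper[OF this] have "0 \<le> y $ 2 - t * (y $ 2 - x $ 2)" by (simp add: algebra_simps)
  also have "t * (y $ 2 - x $ 2) = y $ 2 + 1" using lt by (simp add: t_def)
  finally show False by simp
qed

lemma empty_or_horizontal_line: "K = {} \<or> (\<exists>a\<ge>0. K = {z. z $ 2 = a})"
proof (cases "K = {}")
  case False
  then obtain x where x: "x \<in> K" by blast
  obtain y where y: "y \<in> K" "dist x y = 1" using antipodal[OF x, of 1] by auto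
  then have "x \<noteq> y" by auto
  have height: "z $ 2 = x $ 2" if "z \<in> K" for z
    using same_height[OF x that] same_height[OF that x] by simp
  have "z \<in> K" if "z $ 2 = x $ 2" for z
  proof -
    have "x $ 1 \<noteq> y $ 1" using \<open>x \<noteq> y\<close> height[OF y(1)] by (auto simp: vec_eq_iff forall_2)
    define t where "t = (z $ 1 - x $ 1) / (y $ 1 - x $ 1)"
    have z: "z = x + t *\<^sub>R (y - x)"
      using \<open>x $ 1 \<noteq> y $ 1\<close> height[OF y(1)] that by (simp add: vec_eq_iff forall_2 t_def)
    show ?thesis
    proof (cases "0 \<le> t")
      case True
      then show ?thesis unfolding z using ray[OF x y(1) \<open>x \<noteq> y\<close>] by blast
    next
      case False
      \<comment> \<open>For negative \<open>t\<close> the point lies on the opposite ray, from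
        \<open>y\<close> through \<open>x\<close>.\<close>
      have "y + (1 - t) *\<^sub>R (x - y) \<in> K" using ray[OF y(1) x] \<open>x \<noteq> y\<close> False by auto
      then show ?thesis unfolding z by (simp add: algebra_simps)
    qed
  qed
  then have "K = {z. z $ 2 = x $ 2}" using height by blast
  then show ?thesis using upper[OF x] by blast
qed simp

end

lemma convex_above: "convex {z :: plane. a < z $ 2}" and convex_below: "convex {z :: plane. z $ 2 < a}"
  using convex_halfspace_gt[of a "axis 2 1 :: plane"] convex_halfspace_lt[of "axis 2 1 :: plane" a]
  by (simp_all add: inner_axis')

theorem theorem2p13:
  fixes U K :: "plane set" and u :: "plane \<Rightarrow> real"
  assumes U: "U = {x. x $ 2 > 0}"
    and min: "generalized_minimizer U K u"
    and elem: "elementary U K u"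
  shows
    "let case_i = (K = {} \<and> (AE x in lebesgue. x \<in> U - K \<longrightarrow> u x = 0));
         case_ii = (K = {x. x $ 2 = 0} \<and> (\<exists>c. AE x in lebesgue. x \<in> U - K \<longrightarrow> u x = c));
         case_iii = (\<exists>a>0. K = {x. x $ 2 = a} \<and>
            (\<exists>c. AE x in lebesgue. x \<in> U - K \<longrightarrow> u x = c * indicator {x. x $ 2 > a} x))
     in (case_i \<or> case_ii \<or> case_iii) \<and>
        \<not> (case_i \<and> case_ii) \<and> \<not> (case_i \<and> case_iii) \<and> \<not> (case_ii \<and> case_iii)"
proof -
  interpret minimal_set K by (rule minimal_set_elementary_minimizer[OF U min elem])
  have adm: "adm_pair U K u" using min by (simp add: generalized_minimizer_def)
  obtain v where v: "locally_constant_on (- K) v" "\<And>x. x $ 2 < 0 \<Longrightarrow> v x = 0"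
    "AE x in lebesgue. x \<in> U - K \<longrightarrow> u x = v x"
    by (rule elementary_locally_constant[OF U adm elem]) (rule that)
  have v_const: "v x = v y" if "convex S" "S \<subseteq> - K" "x \<in> S" "y \<in> S" for S x y
    using locally_constant_on_connected[OF locally_constant_on_subset[OF v(1)]] that
    by (blast intro: convex_connected)
  have line_in: "vector [0, b] \<in> {x :: plane. x $ 2 = b}" for b by simp
  have line_ne: "{x :: plane. x $ 2 = b} \<noteq> {}" for b using line_in[of b] by blast
  have line_inj: "b = c" if "{x :: plane. x $ 2 = b} = {x. x $ 2 = c}" for b c
    using line_in[of b] unfolding that by simp
  consider (empty) "K = {}" | (line) a where "0 \<le> a" "K = {z. z $ 2 = a}"
    using empty_or_horizontal_line by blast
  then have "(K = {} \<and> (AE x in lebesgue. x \<in> U - K \<longrightarrow> u x = 0)) \<or>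
      (K = {x. x $ 2 = 0} \<and> (\<exists>c. AE x in lebesgue. x \<in> U - K \<longrightarrow> u x = c)) \<or>
      (\<exists>a>0. K = {x. x $ 2 = a} \<and>
        (\<exists>c. AE x in lebesgue. x \<in> U - K \<longrightarrow> u x = c * indicator {x. x $ 2 > a} x))"
  proof cases
    case empty
    have "v x = 0" for x
      using v_const[of UNIV x "vector [0, -1]"] v(2)[of "vector [0, -1]"] empty by simp
    then show ?thesis using v(3) empty by simp
  next
    case line
    define c where "c = v (vector [0, a + 1])"
    have above: "v x = c" if "a < x $ 2" for x
      unfolding c_def using that line(2) by (intro v_const[OF convex_above[of a]]) auto
    show ?thesis
    proof (cases "a = 0")
      case True
      \<comment> \<open>The line itself separates \<open>U\<close> from the lower half-plane, so
        nothing fixes the constant.\<close>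
      have "AE x in lebesgue. x \<in> U - K \<longrightarrow> u x = c"
        using v(3) by eventually_elim (use above True in \<open>auto simp: U\<close>)
      moreover have "K = {x. x $ 2 = 0}" using line(2) True by simp
      ultimately show ?thesis by (intro disjI2[OF disjI1] conjI exI[of _ c])
    next
      case False
      then have "0 < a" using line(1) by simp
      \<comment> \<open>The strip below the line is joined to the lower half-plane, where
        \<open>v\<close> is 0.\<close>
      have below: "v x = 0" if "x $ 2 < a" for x
        using v_const[OF convex_below[of a] _ _ , of x "vector [0, -1]"] v(2)[of "vector [0, -1]"]
          that line(2) \<open>0 < a\<close> by auto
      have "AE x in lebesgue. x \<in> U - K \<longrightarrow> u x = c * indicator {x. x $ 2 > a} x"
        using v(3)
      proof eventually_elim
        case (elim x)
        show ?case
        proof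
          assume x: "x \<in> U - K"
          then consider "a < x $ 2" | "x $ 2 < a" using line(2) by fastforce
          then show "u x = c * indicator {x. x $ 2 > a} x"
            using elim x above[of x] below[of x] by cases auto
        qed
      qed
      then show ?thesis
        using line(2) \<open>0 < a\<close> by (intro disjI2[OF disjI2] exI[of _ a] conjI exI[of _ c])
    qed
  qed
  moreover have "\<not> (K = {} \<and> K = {x. x $ 2 = b})" for b using line_ne[of b] by auto
  moreover have "\<not> (K = {x. x $ 2 = 0} \<and> K = {x. x $ 2 = b})" if "0 < b" for b
    using line_inj[of 0 b] that by auto
  ultimately show ?thesis unfolding Let_def by blast
qed

end
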